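(* Every (finite-dimensional abelian) real mixed Hodge structure $V$ admits an $\mathcal S$-splitting, i.e. an $\mathcal S$-linear isomorphism $$V\otimes\mathcal S\cong(\mathrm{gr}^WV)\otimes\mathcal S$$ of quasi-MHS, inducing the identity on the grading associated to $W$. The set of such splittings is a torsor for the group $$\mathrm{id}+W_{-1}\gamma^0\mathrm{End}\big((\mathrm{gr}^WV)\otimes\mathcal S\big).$$
   Context: A (real) quasi-MHS is a real vector space $V$ with an exhaustive increasing filtration $W$ on $V$ and an exhaustive decreasing filtration $F$ on $V\otimes\mathbb C$. A (real) MHS is a finite-dimensional quasi-MHS on which $W$ is Hausdorff and $\mathrm{gr}_F^i\mathrm{gr}_{\bar F}^j\mathrm{gr}^W_n(V\otimes\mathbb C)=0$ for $i+j\ne n$. $\mathcal S=\mathbb R[x]$ is the ring with $F^p(\mathcal S\otimes\mathbb C)=(x-i)^p\mathbb C[x]$ (so $F^p=\mathcal S\otimes\mathbb C$ up to the convention that $F^p(\mathcal S\otimes\mathbb C)=\mathbb C[x]$ for $p\le0$), $W_0\mathcal S=\mathcal S$, $W_{-1}\mathcal S=0$. Tensor products have the usual tensor product filtrations. $\mathrm{gr}^WV=\bigoplus_n\mathrm{gr}^W_nV$ has its induced (split) mixed Hodge structure. For a quasi-MHS $U$, $\gamma^pU:=U\cap F^p(U\otimes\mathbb C)$. $\mathrm{End}((\mathrm{gr}^WV)\otimes\mathcal S)$ denotes $\mathcal S$-linear endomorphisms, i.e. $\mathrm{End}_{\mathbb R}(\mathrm{gr}^WV)\otimes\mathcal S$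 with its natural quasi-MHS structure; thus the group consists of the $\mathcal S$-linear automorphisms of $(\mathrm{gr}^WV)\otimes\mathcal S$ preserving the quasi-MHS structure and inducing the identity on $\mathrm{gr}^W$.
   Formalization: The formal definition of a real mixed Hodge structure also requires the filtration F to be Hausdorff (the intersection of all F^p is 0), as holds for the usual finite Hodge filtrations; without this the claim fails. *)

theory Defs
  imports
    "HOL-Algebra.AbelCoset"
    "HOL-Algebra.Group_Action"
    "Jordan_Normal_Form.VS_Connect"
    "HOL-Computational_Algebra.Polynomial"
begin

text \<open>
  Vector spaces are carrier-based (\<^locale>\<open>vectorspace\<close>), with scalars \<^term>\<open>class_ring\<close>, the field
  structure of the type \<^typ>\<open>real\<close> or \<^typ>\<open>complex\<close>.  The fields \<open>mult\<close> and \<open>one\<close> of module records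
  play no role; where no product is available they are filled with zeros.
\<close>

section \<open>Complexification and subquotients\<close>

text \<open>\<open>V \<otimes> \<complex>\<close>, the pair \<open>(u, v)\<close> standing for \<open>u + \<i>v\<close>.\<close>

definition cplx :: "(real, 'a, 'm) module_scheme \<Rightarrow> (complex, 'a \<times> 'a) module" where
  "cplx V = \<lparr>carrier = carrier V \<times> carrier V,
     monoid.mult = (\<lambda>z w. (\<zero>\<^bsub>V\<^esub>, \<zero>\<^bsub>V\<^esub>)), monoid.one = (\<zero>\<^bsub>V\<^esub>, \<zero>\<^bsub>V\<^esub>),
     ring.zero = (\<zero>\<^bsub>V\<^esub>, \<zero>\<^bsub>V\<^esub>),
     ring.add = (\<lambda>(u, v) (u', v'). (u \<oplus>\<^bsub>V\<^esub> u', v \<oplus>\<^bsub>V\<^esub> v')),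
     module.smult = (\<lambda>c (u, v). (Re c \<odot>\<^bsub>V\<^esub> u \<ominus>\<^bsub>V\<^esub> Im c \<odot>\<^bsub>V\<^esub> v, Re c \<odot>\<^bsub>V\<^esub> v \<oplus>\<^bsub>V\<^esub> Im c \<odot>\<^bsub>V\<^esub> u))\<rparr>"

definition cconj :: "(real, 'a, 'm) module_scheme \<Rightarrow> 'a \<times> 'a \<Rightarrow> 'a \<times> 'a" where
  "cconj V = (\<lambda>(u, v). (u, \<ominus>\<^bsub>V\<^esub> v))"

text \<open>The subquotient \<open>A / B\<close>, for subspaces \<open>B \<subseteq> A\<close> of \<open>M\<close>, and the subspace of it induced by a
  subspace \<open>X\<close> of \<open>M\<close>.\<close>

definition quot_space :: "('k, 'a, 'm) module_scheme \<Rightarrow> 'a set \<Rightarrow> 'a set \<Rightarrow> ('k, 'a set) module" where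
  "quot_space M A B = \<lparr>carrier = (\<lambda>x. B +>\<^bsub>M\<^esub> x) ` A,
     monoid.mult = (\<lambda>X Y. B), monoid.one = B,
     ring.zero = B,
     ring.add = (\<lambda>X Y. X <+>\<^bsub>M\<^esub> Y),
     module.smult = (\<lambda>c X. \<Union>x\<in>X. B +>\<^bsub>M\<^esub> (c \<odot>\<^bsub>M\<^esub> x))\<rparr>"

definition quot_fil :: "('k, 'a, 'm) module_scheme \<Rightarrow> 'a set \<Rightarrow> 'a set \<Rightarrow> 'a set \<Rightarrow> 'a set set" where
  "quot_fil M A B X = (\<lambda>x. B +>\<^bsub>M\<^esub> x) ` (X \<inter> A)"

section \<open>Quasi-mixed Hodge structures\<close>

record 'a qmhs = "(real, 'a) module" +
  Wfil :: "int \<Rightarrow> 'a set"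
  Ffil :: "int \<Rightarrow> ('a \<times> 'a) set"

locale quasi_mhs = vectorspace class_ring V for V :: "'a qmhs" (structure) +
  assumes W_subspace: "\<And>n. VectorSpace.subspace class_ring (Wfil V n) V"
    and W_mono: "\<And>m n. m \<le> n \<Longrightarrow> Wfil V m \<subseteq> Wfil V n"
    and W_exhaustive: "(\<Union>n. Wfil V n) = carrier V"
    and F_subspace: "\<And>p. VectorSpace.subspace class_ring (Ffil V p) (cplx V)"
    and F_antimono: "\<And>p q. p \<le> q \<Longrightarrow> Ffil V q \<subseteq> Ffil V p"
    and F_exhaustive: "(\<Union>p. Ffil V p) = carrier (cplx V)"

text \<open>\<open>gr\<^sup>W\<^sub>n V\<close> with its induced filtrations.  A coset of \<open>W\<^sub>n\<^sub>-\<^sub>1 \<otimes> \<complex>\<close> in \<open>W\<^sub>n \<otimes> \<complex>\<close> is the same as a pair of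
  cosets of \<open>W\<^sub>n\<^sub>-\<^sub>1\<close> in \<open>W\<^sub>n\<close>.\<close>

definition gr_W :: "'a qmhs \<Rightarrow> int \<Rightarrow> 'a set qmhs" where
  "gr_W V n =
     (let A = Wfil V n; B = Wfil V (n - 1) in
      module.extend (quot_space V A B)
        (qmhs.fields
          (\<lambda>m. quot_fil V A B (Wfil V m))
          (\<lambda>p. (\<lambda>(u, v). (B +>\<^bsub>V\<^esub> u, B +>\<^bsub>V\<^esub> v)) ` (Ffil V p \<inter> A \<times> A))))"

text \<open>\<open>gr\<^sub>F\<^sup>i gr\<^sub>F\<^sub>b\<^sub>a\<^sub>r\<^sup>j (H \<otimes> \<complex>)\<close>: first the graded piece for the conjugate filtration, then that for the
  filtration induced on it by \<open>F\<close>.\<close>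

definition gr_F_Fbar :: "'a qmhs \<Rightarrow> int \<Rightarrow> int \<Rightarrow> (complex, ('a \<times> 'a) set set) module" where
  "gr_F_Fbar H i j =
     (let Fbar = (\<lambda>j. cconj H ` Ffil H j);
          Q = quot_space (cplx H) (Fbar j) (Fbar (j + 1));
          G = (\<lambda>i. quot_fil (cplx H) (Fbar j) (Fbar (j + 1)) (Ffil H i))
      in quot_space Q (G i) (G (i + 1)))"

text \<open>Both filtrations of a mixed Hodge structure are finite.  For \<open>F\<close> this has to be asked
  explicitly, as the vanishing condition is vacuous for a constant filtration \<open>F\<^sup>p = V \<otimes> \<complex>\<close>.\<close>

locale mhs = quasi_mhs +
  assumes finite_dimensional: "fin_dim"
    and W_Hausdorff: "(\<Inter>n. Wfil V n) = {\<zero>}"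
    and F_Hausdorff: "(\<Inter>p. Ffil V p) = {\<zero>\<^bsub>cplx V\<^esub>}"
    and opposed: "\<And>n i j. i + j \<noteq> n \<Longrightarrow>
      carrier (gr_F_Fbar (gr_W V n) i j) = {\<zero>\<^bsub>gr_F_Fbar (gr_W V n) i j\<^esub>}"

text \<open>Linear maps are taken extensional, so that they form a set in the ordinary sense.\<close>

definition qmhs_hom :: "'a qmhs \<Rightarrow> 'b qmhs \<Rightarrow> ('a \<Rightarrow> 'b) set" where
  "qmhs_hom A B = {\<phi> \<in> LinearCombinations.module_hom class_ring A B \<inter> extensional (carrier A).
     (\<forall>n. \<phi> ` Wfil A n \<subseteq> Wfil B n) \<and> (\<forall>p. map_prod \<phi> \<phi> ` Ffil A p \<subseteq> Ffil B p)}"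

definition qmhs_iso :: "'a qmhs \<Rightarrow> 'b qmhs \<Rightarrow> ('a \<Rightarrow> 'b) set" where
  "qmhs_iso A B = {\<phi> \<in> qmhs_hom A B. \<exists>\<psi> \<in> qmhs_hom B A.
     (\<forall>x \<in> carrier A. \<psi> (\<phi> x) = x) \<and> (\<forall>y \<in> carrier B. \<phi> (\<psi> y) = y)}"

definition qmhs_sum :: "('i \<Rightarrow> 'a qmhs) \<Rightarrow> ('i \<Rightarrow> 'a) qmhs" where
  "qmhs_sum U =
     (let C = {g. (\<forall>n. g n \<in> carrier (U n)) \<and> finite {n. g n \<noteq> \<zero>\<^bsub>U n\<^esub>}} in
      \<lparr>carrier = C,
       monoid.mult = (\<lambda>g h n. \<zero>\<^bsub>U n\<^esub>), monoid.one = (\<lambda>n. \<zero>\<^bsub>U n\<^esub>),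
       ring.zero = (\<lambda>n. \<zero>\<^bsub>U n\<^esub>),
       ring.add = (\<lambda>g h n. g n \<oplus>\<^bsub>U n\<^esub> h n),
       module.smult = (\<lambda>r g n. r \<odot>\<^bsub>U n\<^esub> g n),
       Wfil = (\<lambda>m. {g \<in> C. \<forall>n. g n \<in> Wfil (U n) m}),
       Ffil = (\<lambda>p. {(g, h). g \<in> C \<and> h \<in> C \<and> (\<forall>n. (g n, h n) \<in> Ffil (U n) p)})\<rparr>)"

definition gr :: "'a qmhs \<Rightarrow> (int \<Rightarrow> 'a set) qmhs" where
  "gr V = qmhs_sum (gr_W V)"

definition gam :: "int \<Rightarrow> 'a qmhs \<Rightarrow> 'a set" where
  "gam p U = {u \<in> carrier U. (u, \<zero>\<^bsub>U\<^esub>) \<in> Ffil U p}"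

section \<open>The ring \<open>\<S> = \<real>[x]\<close> and tensor products with it\<close>

text \<open>\<open>F\<^sup>p\<close> consists of the multiples of \<open>(x - \<i>)\<^sup>p\<close>; since \<open>nat p = 0\<close> for \<open>p \<le> 0\<close>, it is all of \<open>\<complex>[x]\<close>
  for those \<open>p\<close>.\<close>

definition S_ring :: "real poly qmhs" where
  "S_ring = \<lparr>carrier = UNIV, monoid.mult = (*), monoid.one = 1, ring.zero = 0, ring.add = (+),
     module.smult = Polynomial.smult,
     Wfil = (\<lambda>n. if n \<ge> 0 then UNIV else {0}),
     Ffil = (\<lambda>p. {(f, g). [:- \<i>, 1:] ^ nat p dvd
        map_poly complex_of_real f + Polynomial.smult \<i> (map_poly complex_of_real g)})\<rparr>"

text \<open>\<open>V \<otimes> \<S>\<close> is realised as \<open>V[x]\<close>, a finitely supported \<open>f\<close> standing for \<open>\<Sum>k. f k \<otimes> x\<^sup>k\<close>.\<close>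

definition S_module :: "(real, 'a, 'm) module_scheme \<Rightarrow> (real poly, nat \<Rightarrow> 'a) module" where
  "S_module V = \<lparr>carrier = {f. (\<forall>k. f k \<in> carrier V) \<and> finite {k. f k \<noteq> \<zero>\<^bsub>V\<^esub>}},
     monoid.mult = (\<lambda>f g k. \<zero>\<^bsub>V\<^esub>), monoid.one = (\<lambda>k. \<zero>\<^bsub>V\<^esub>),
     ring.zero = (\<lambda>k. \<zero>\<^bsub>V\<^esub>),
     ring.add = (\<lambda>f g k. f k \<oplus>\<^bsub>V\<^esub> g k),
     module.smult = (\<lambda>s f n. \<Oplus>\<^bsub>V\<^esub>k\<in>{..n}. coeff s k \<odot>\<^bsub>V\<^esub> f (n - k))\<rparr>"

definition S_vs :: "(real, 'a, 'm) module_scheme \<Rightarrow> (real, nat \<Rightarrow> 'a) module" where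
  "S_vs V = \<lparr>carrier = carrier (S_module V),
     monoid.mult = monoid.mult (S_module V), monoid.one = monoid.one (S_module V),
     ring.zero = ring.zero (S_module V), ring.add = ring.add (S_module V),
     module.smult = (\<lambda>r f k. r \<odot>\<^bsub>V\<^esub> f k)\<rparr>"

definition tens :: "(real, 'a, 'm) module_scheme \<Rightarrow> 'a \<Rightarrow> real poly \<Rightarrow> nat \<Rightarrow> 'a" where
  "tens V v s = (\<lambda>k. coeff s k \<odot>\<^bsub>V\<^esub> v)"

text \<open>The tensor of an element of \<open>V \<otimes> \<complex>\<close> with one of \<open>\<S> \<otimes> \<complex>\<close>, taken over \<open>\<complex>\<close>.\<close>

definition ctens ::
  "(real, 'a, 'm) module_scheme \<Rightarrow> 'a \<times> 'a \<Rightarrow> real poly \<times> real poly \<Rightarrow> (nat \<Rightarrow> 'a) \<times> (nat \<Rightarrow> 'a)" where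
  "ctens V = (\<lambda>(u, v) (s, t).
     (tens V u s \<ominus>\<^bsub>S_vs V\<^esub> tens V v t, tens V u t \<oplus>\<^bsub>S_vs V\<^esub> tens V v s))"

definition tensor_S :: "'a qmhs \<Rightarrow> (nat \<Rightarrow> 'a) qmhs" where
  "tensor_S V = module.extend (S_vs V)
     (qmhs.fields
       (\<lambda>n. LinearCombinations.module.span class_ring (S_vs V)
          (\<Union>a. {tens V v s | v s. v \<in> Wfil V a \<and> s \<in> Wfil S_ring (n - a)}))
       (\<lambda>p. LinearCombinations.module.span class_ring (cplx (S_vs V))
          (\<Union>a. {ctens V z w | z w. z \<in> Ffil V a \<and> w \<in> Ffil S_ring (p - a)})))"

section \<open>Endomorphisms\<close>

text \<open>In \<open>Ffil\<close>, the pair \<open>(f, g)\<close> is the endomorphism \<open>f + \<i>g\<close> of \<open>U \<otimes> \<complex>\<close>.\<close>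

definition End_qmhs :: "'a qmhs \<Rightarrow> ('a \<Rightarrow> 'a) qmhs" where
  "End_qmhs U =
     (let C = LinearCombinations.module_hom class_ring U U \<inter> extensional (carrier U) in
      \<lparr>carrier = C,
       monoid.mult = (\<lambda>f g. compose (carrier U) f g), monoid.one = (\<lambda>x\<in>carrier U. x),
       ring.zero = (\<lambda>x\<in>carrier U. \<zero>\<^bsub>U\<^esub>),
       ring.add = (\<lambda>f g. \<lambda>x\<in>carrier U. f x \<oplus>\<^bsub>U\<^esub> g x),
       module.smult = (\<lambda>r f. \<lambda>x\<in>carrier U. r \<odot>\<^bsub>U\<^esub> f x),
       Wfil = (\<lambda>n. {f \<in> C. \<forall>k. f ` Wfil U k \<subseteq> Wfil U (k + n)}),
       Ffil = (\<lambda>p. {(f, g). f \<in> C \<and> g \<in> C \<and>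
          (\<forall>q. (\<lambda>(u, v). (f u \<ominus>\<^bsub>U\<^esub> g v, f v \<oplus>\<^bsub>U\<^esub> g u)) ` Ffil U q \<subseteq> Ffil U (q + p))})\<rparr>)"

text \<open>The \<open>\<S>\<close>-linear endomorphism of \<open>U \<otimes> \<S>\<close> given by \<open>\<Sum>k. e k \<otimes> x\<^sup>k \<in> End U \<otimes> \<S>\<close>.\<close>

definition End_act :: "'a qmhs \<Rightarrow> (nat \<Rightarrow> 'a \<Rightarrow> 'a) \<Rightarrow> (nat \<Rightarrow> 'a) \<Rightarrow> nat \<Rightarrow> 'a" where
  "End_act U e f = (\<lambda>n. \<Oplus>\<^bsub>U\<^esub>k\<in>{..n}. e k (f (n - k)))"

section \<open>Splittings\<close>

text \<open>For \<open>f \<in> W\<^sub>n V \<otimes> \<S>\<close>, the element of \<open>gr\<^sup>W\<^sub>n V \<otimes> \<S> \<subseteq> gr\<^sup>W V \<otimes> \<S>\<close> that it determines.\<close>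

definition symbol :: "'a qmhs \<Rightarrow> int \<Rightarrow> (nat \<Rightarrow> 'a) \<Rightarrow> nat \<Rightarrow> int \<Rightarrow> 'a set" where
  "symbol V n f = (\<lambda>k m. if m = n then Wfil V (n - 1) +>\<^bsub>V\<^esub> f k else \<zero>\<^bsub>gr_W V m\<^esub>)"

text \<open>Inducing the identity on \<open>gr\<^sup>W\<close> refers to the canonical identification of both
  \<open>gr\<^sup>W\<^sub>n (V \<otimes> \<S>)\<close> and \<open>gr\<^sup>W\<^sub>n (gr\<^sup>W V \<otimes> \<S>)\<close> with \<open>gr\<^sup>W\<^sub>n V \<otimes> \<S>\<close>.\<close>

definition S_splittings :: "'a qmhs \<Rightarrow> ((nat \<Rightarrow> 'a) \<Rightarrow> nat \<Rightarrow> int \<Rightarrow> 'a set) set" where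
  "S_splittings V = {\<phi> \<in> qmhs_iso (tensor_S V) (tensor_S (gr V)).
     \<phi> \<in> LinearCombinations.module_hom class_ring (S_module V) (S_module (gr V)) \<and>
     (\<forall>n. \<forall>f \<in> Wfil (tensor_S V) n.
        \<phi> f \<ominus>\<^bsub>tensor_S (gr V)\<^esub> symbol V n f \<in> Wfil (tensor_S (gr V)) (n - 1))}"

text \<open>The group \<open>id + W\<^sub>-\<^sub>1 \<gamma>\<^sup>0 End (gr\<^sup>W V \<otimes> \<S>)\<close> under composition, and its action on splittings.\<close>

definition split_group ::
  "'a qmhs \<Rightarrow> ((nat \<Rightarrow> int \<Rightarrow> 'a set) \<Rightarrow> nat \<Rightarrow> int \<Rightarrow> 'a set) monoid" where
  "split_group V =
     (let C = carrier (tensor_S (gr V)); E = tensor_S (End_qmhs (gr V)) in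
      \<lparr>carrier = {\<lambda>f\<in>C. f \<oplus>\<^bsub>tensor_S (gr V)\<^esub> End_act (gr V) e f | e. e \<in> Wfil E (- 1) \<inter> gam 0 E},
       monoid.mult = (\<lambda>g h. compose C g h),
       monoid.one = (\<lambda>f\<in>C. f)\<rparr>)"

definition split_action ::
  "'a qmhs \<Rightarrow> ((nat \<Rightarrow> int \<Rightarrow> 'a set) \<Rightarrow> nat \<Rightarrow> int \<Rightarrow> 'a set) \<Rightarrow>
    ((nat \<Rightarrow> 'a) \<Rightarrow> nat \<Rightarrow> int \<Rightarrow> 'a set) \<Rightarrow> (nat \<Rightarrow> 'a) \<Rightarrow> nat \<Rightarrow> int \<Rightarrow> 'a set" where
  "split_action V g = (\<lambda>\<phi>\<in>S_splittings V. compose (carrier (tensor_S V)) g \<phi>)"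

locale torsor = group_action +
  assumes nonempty: "E \<noteq> {}"
    and simply_transitive: "\<And>x y. \<lbrakk>x \<in> E; y \<in> E\<rbrakk> \<Longrightarrow> \<exists>!g. g \<in> carrier G \<and> \<phi> g x = y"

end

theory Submission
  imports Defs
begin

text \<open>
  Over \<open>\<complex>\<close> the space \<open>V\<close> has coordinates adapted to both filtrations (\<open>biframe_exists\<close>): vectors \<open>b\<^sub>j\<close>
  of weight \<open>n\<^sub>j\<close> and Hodge degree \<open>d\<^sub>j\<close>, with functionals \<open>c\<^sub>j\<close> such that \<open>z = \<Sum>\<^sub>j c\<^sub>j(z) b\<^sub>j\<close>, where
  for \<open>z \<in> W\<^sub>m\<close> only the terms with \<open>n\<^sub>j \<le> m\<close> occur and for \<open>z \<in> F\<^sup>p\<close> only those with \<open>d\<^sub>j \<ge> p\<close>.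
  The classes of the \<open>b\<^sub>j\<close> are coordinates of the same kind for \<open>gr V\<close>.  Exchanging the \<open>b\<^sub>j\<close> with
  their classes gives complex linear maps \<open>\<alpha>\<close> from \<open>V\<close> to \<open>gr V\<close> and \<open>\<sigma>\<close> back that respect \<open>W\<close>
  and \<open>F\<close> and induce the identity on \<open>gr\<^sup>W\<close>.

  Such a map is not real, but it becomes so over \<open>\<S>\<close>.  Write \<open>\<alpha> = A + \<i>B\<close> with \<open>A\<close> and \<open>B\<close> real, choose a
  real polynomial \<open>s\<close> with \<open>s \<equiv> \<i>\<close> modulo \<open>(x - \<i>)\<^sup>N\<close> (\<open>real_poly_approximates_i\<close>), and put
  \<open>\<phi> = A + sB\<close>.  The error \<open>\<phi> - \<alpha> = (s - \<i>)B\<close> is divisible by \<open>(x - \<i>)\<^sup>N\<close>; once \<open>N\<close> is at least the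
  length of \<open>F\<close>, this factor lifts every vector as far up in \<open>F\<close> as is necessary, so \<open>\<phi>\<close> respects
  \<open>F\<close> as well (locale \<open>S_ext\<close>).  Since \<open>\<alpha>\<close> is the identity on \<open>gr\<^sup>W\<close>, the map \<open>B\<close> lowers weights, and
  \<open>\<phi>\<close> is the identity on \<open>gr\<^sup>W\<close> too.

  The same construction turns \<open>\<sigma>\<close> into \<open>\<psi>\<close>.  The composites \<open>\<psi>\<phi>\<close> and \<open>\<phi>\<psi>\<close> need not be the identity, but
  they respect \<open>F\<close> and are unipotent for \<open>W\<close>.  Maps of this kind form a group
  (\<open>S_unip_left_inverse\<close>), so \<open>\<phi>\<close> is an isomorphism and hence a splitting.

  Two splittings \<open>\<phi>\<close> and \<open>\<phi>'\<close> differ by exactly one such unipotent automorphism of \<open>gr V \<otimes> \<S>\<close>, namely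
  \<open>\<phi>'\<phi>\<^sup>-\<^sup>1\<close>.  What remains is to identify the group of these automorphisms with
  \<open>id + W\<^sub>-\<^sub>1 \<gamma>\<^sup>0 End(gr V \<otimes> \<S>)\<close> (\<open>id_plus_act_unip\<close> and \<open>unip_is_act\<close>).  The filtration on
  \<open>End(gr V) \<otimes> \<S>\<close> is that of a tensor product, so the point is that an \<open>\<S>\<close>-linear endomorphism \<open>e\<close>
  respecting \<open>F\<close> is a sum of tensors of degree \<open>0\<close>.  The coordinates give one:
  \<open>e = \<Sum>\<^sub>j c\<^sub>j \<otimes> e(b\<^sub>j)\<close>, where \<open>e(b\<^sub>j)\<close> lies in \<open>F\<^sup>d\<close> for \<open>d = d\<^sub>j\<close> and \<open>c\<^sub>j \<otimes> _\<close> shifts degrees by \<open>- d\<^sub>j\<close>.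
\<close>

section \<open>Vector spaces over the field of a type\<close>

text \<open>
  Scalars form a whole type here, so that no membership conditions on them remain.
\<close>

locale vsp = fixes M :: "('k::field, 'a, 'm) module_scheme" (structure)
  assumes vectorspace: "vectorspace class_ring M"

sublocale vsp \<subseteq> abelian_group M
  using vectorspace by (simp add: vectorspace_def Module.module_def)

abbreviation subsp :: "'a set \<Rightarrow> ('k::field, 'a, 'm) module_scheme \<Rightarrow> bool" where
  "subsp N M \<equiv> VectorSpace.subspace class_ring N M"

abbreviation lin :: "('k::{times,plus,one,zero}, 'a, 'm) module_scheme \<Rightarrow> ('k, 'b, 'n) module_scheme \<Rightarrow> ('a \<Rightarrow> 'b) set" where
  "lin M M' \<equiv> LinearCombinations.module_hom class_ring M M'"

context vsp begin

lemma module: "Module.module class_ring M" and is_vsp: "vsp M"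
  using vectorspace by (auto simp: vectorspace_def vsp_def)

lemma scl [simp, intro]: "x \<in> carrier M \<Longrightarrow> c \<odot> x \<in> carrier M"
  using module.smult_closed[OF module, of c x] by simp

lemma smult_ladd: "x \<in> carrier M \<Longrightarrow> (a + b) \<odot> x = a \<odot> x \<oplus> b \<odot> x"
  using module.smult_l_distr[OF module, of a b x] by simp

lemma smult_radd: "x \<in> carrier M \<Longrightarrow> y \<in> carrier M \<Longrightarrow> a \<odot> (x \<oplus> y) = a \<odot> x \<oplus> a \<odot> y"
  using module.smult_r_distr[OF module, of a x y] by simp

lemma smult_smult: "x \<in> carrier M \<Longrightarrow> a \<odot> (b \<odot> x) = (a * b) \<odot> x"
  using module.smult_assoc1[OF module, of a b x] by simp

lemma smult_1 [simp]: "x \<in> carrier M \<Longrightarrow> 1 \<odot> x = x"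
  using module.smult_one[OF module, of x] by simp

lemma smult_0 [simp]: "x \<in> carrier M \<Longrightarrow> 0 \<odot> x = \<zero>"
  using module.smult_l_null[OF module, of x] by simp

lemma smult_zero [simp]: "a \<odot> \<zero> = \<zero>"
  using module.smult_r_null[OF module, of a] by simp

lemma smult_neg: "x \<in> carrier M \<Longrightarrow> (- a) \<odot> x = \<ominus> (a \<odot> x)"
  using module.smult_l_minus[OF module, of a x] by (simp add: class_ring_simps)

lemma smult_a_inv: "x \<in> carrier M \<Longrightarrow> a \<odot> (\<ominus> x) = \<ominus> (a \<odot> x)"
  using module.smult_r_minus[OF module, of a x] by simp

lemma smult_lminus: "x \<in> carrier M \<Longrightarrow> (a - b) \<odot> x = a \<odot> x \<ominus> b \<odot> x"
  using smult_ladd[of x a "-b"] by (simp add: smult_neg minus_eq)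

lemma smult_rminus: "x \<in> carrier M \<Longrightarrow> y \<in> carrier M \<Longrightarrow> a \<odot> (x \<ominus> y) = a \<odot> x \<ominus> a \<odot> y"
  by (simp add: minus_eq smult_radd smult_a_inv)

lemma a_inv_smult: "x \<in> carrier M \<Longrightarrow> \<ominus> x = (- 1) \<odot> x"
  by (simp add: smult_neg)

lemma minus_smult: "x \<in> carrier M \<Longrightarrow> y \<in> carrier M \<Longrightarrow> x \<ominus> y = x \<oplus> (- 1) \<odot> y"
  by (simp add: smult_neg minus_eq)

lemma add_minus_cancel [simp]: "x \<in> carrier M \<Longrightarrow> y \<in> carrier M \<Longrightarrow> y \<oplus> (x \<ominus> y) = x"
  by (simp add: minus_eq a_comm[of x] a_assoc[symmetric] r_neg)

lemma minus_add_cancel [simp]: "x \<in> carrier M \<Longrightarrow> y \<in> carrier M \<Longrightarrow> (x \<ominus> y) \<oplus> y = x"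
  by (simp add: minus_eq a_assoc l_neg)

lemma add_minus_cancel2 [simp]: "x \<in> carrier M \<Longrightarrow> y \<in> carrier M \<Longrightarrow> (y \<oplus> x) \<ominus> y = x"
  by (simp add: minus_eq a_comm[of y] a_assoc r_neg)

lemma minus_self [simp]: "x \<in> carrier M \<Longrightarrow> x \<ominus> x = \<zero>"
  by (simp add: minus_eq r_neg)

lemma minus_zero_right [simp]: "x \<in> carrier M \<Longrightarrow> x \<ominus> \<zero> = x"
  by (simp add: minus_eq)

lemma minus_eq_zero: "x \<in> carrier M \<Longrightarrow> y \<in> carrier M \<Longrightarrow> x \<ominus> y = \<zero> \<longleftrightarrow> x = y"
  by (metis add_minus_cancel minus_self r_zero)

lemma subsp_iff: "subsp N M \<longleftrightarrow> N \<subseteq> carrier M \<and> \<zero> \<in> N \<and> (\<forall>x\<in>N. \<forall>y\<in>N. x \<oplus> y \<in> N) \<and>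
    (\<forall>c. \<forall>x\<in>N. c \<odot> x \<in> N)"
  using vectorspace module
  by (auto simp: VectorSpace.subspace_def submodule_def)

lemma subspD:
  assumes "subsp N M"
  shows "N \<subseteq> carrier M" and "\<zero> \<in> N"
    and "x \<in> N \<Longrightarrow> y \<in> N \<Longrightarrow> x \<oplus> y \<in> N"
    and "x \<in> N \<Longrightarrow> c \<odot> x \<in> N"
    and "x \<in> N \<Longrightarrow> y \<in> N \<Longrightarrow> x \<ominus> y \<in> N"
    and "x \<in> N \<Longrightarrow> x \<in> carrier M"
proof -
  have *: "N \<subseteq> carrier M \<and> \<zero> \<in> N \<and> (\<forall>x\<in>N. \<forall>y\<in>N. x \<oplus> y \<in> N) \<and> (\<forall>c. \<forall>x\<in>N. c \<odot> x \<in> N)"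
 
    using assms unfolding subsp_iff .
  show "N \<subseteq> carrier M" "\<zero> \<in> N" "x \<in> N \<Longrightarrow> y \<in> N \<Longrightarrow> x \<oplus> y \<in> N"
    "x \<in> N \<Longrightarrow> c \<odot> x \<in> N" "x \<in> N \<Longrightarrow> x \<in> carrier M" using * by (blast+)
  show "x \<in> N \<Longrightarrow> y \<in> N \<Longrightarrow> x \<ominus> y \<in> N" using * by (auto simp: minus_smult subset_iff)
qed

lemma subsp_finsum:
  assumes "subsp N M" "\<And>i. i \<in> I \<Longrightarrow> f i \<in> N"
  shows "(\<Oplus>i\<in>I. f i) \<in> N"
  using assms(2)
proof (induction I rule: infinite_finite_induct)
  case (insert i I)
  then show ?case using subspD[OF assms(1)] by (subst finsum_insert) auto
qed (auto simp: subspD[OF assms(1)])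

lemma subsp_carrier: "subsp (carrier M) M"
  by (auto simp: subsp_iff)

lemma subsp_Int: "subsp N M \<Longrightarrow> subsp N' M \<Longrightarrow> subsp (N \<inter> N') M"
  by (auto simp: subsp_iff)

abbreviation (input) lspan :: "'a set \<Rightarrow> 'a set" where "lspan \<equiv> LinearCombinations.module.span class_ring M"

lemma span_subsp: "A \<subseteq> carrier M \<Longrightarrow> subsp (lspan A) M"
  using vectorspace.span_is_subspace[OF vectorspace] by simp

lemma span_least: "A \<subseteq> N \<Longrightarrow> subsp N M \<Longrightarrow> lspan A \<subseteq> N"
  using LinearCombinations.module.span_is_subset[OF module] by (simp add: VectorSpace.subspace_def)

lemma span_superset: "A \<subseteq> carrier M \<Longrightarrow> A \<subseteq> lspan A"
  using LinearCombinations.module.in_own_span[OF module] by simp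

end

lemma vspI:
  fixes M :: "('k::field, 'a, 'm) module_scheme" (structure)
  assumes "\<zero> \<in> carrier M" "\<And>x y. x \<in> carrier M \<Longrightarrow> y \<in> carrier M \<Longrightarrow> x \<oplus> y \<in> carrier M"
    "\<And>c x. x \<in> carrier M \<Longrightarrow> c \<odot> x \<in> carrier M"
    "\<And>x y. x \<in> carrier M \<Longrightarrow> y \<in> carrier M \<Longrightarrow> x \<oplus> y = y \<oplus> x"
    "\<And>x y z. x \<in> carrier M \<Longrightarrow> y \<in> carrier M \<Longrightarrow> z \<in> carrier M \<Longrightarrow> (x \<oplus> y) \<oplus> z = x \<oplus> (y \<oplus> z)"
    "\<And>x. x \<in> carrier M \<Longrightarrow> x \<oplus> \<zero> = x"
    "\<And>x. x \<in> carrier M \<Longrightarrow> 0 \<odot> x = \<zero>"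
    "\<And>x. x \<in> carrier M \<Longrightarrow> 1 \<odot> x = x"
    "\<And>a b x. x \<in> carrier M \<Longrightarrow> a \<odot> (b \<odot> x) = (a * b) \<odot> x"
    "\<And>a b x. x \<in> carrier M \<Longrightarrow> (a + b) \<odot> x = a \<odot> x \<oplus> b \<odot> x"
    "\<And>a x y. x \<in> carrier M \<Longrightarrow> y \<in> carrier M \<Longrightarrow> a \<odot> (x \<oplus> y) = a \<odot> x \<oplus> a \<odot> y"
  shows "vsp M"
proof -
  have "x \<oplus> (- 1) \<odot> x = \<zero>" if "x \<in> carrier M" for x
    using assms(7)[OF that] assms(8)[OF that] assms(10)[OF that, of 1 "-1"] by simp
  then have "\<forall>x\<in>carrier M. \<exists>y\<in>carrier M. x \<oplus> y = \<zero>" using assms(3) by blast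
  then show ?thesis unfolding vsp_def
    by (intro vs_criteria) (simp_all add: assms(1-4,6-) class_field, metis assms(4,5))
qed

lemma linI:
  assumes "\<And>x. x \<in> carrier M \<Longrightarrow> h x \<in> carrier M'"
    "\<And>x y. x \<in> carrier M \<Longrightarrow> y \<in> carrier M \<Longrightarrow> h (x \<oplus>\<^bsub>M\<^esub> y) = h x \<oplus>\<^bsub>M'\<^esub> h y"
    "\<And>c x. x \<in> carrier M \<Longrightarrow> h (c \<odot>\<^bsub>M\<^esub> x) = c \<odot>\<^bsub>M'\<^esub> h x"
  shows "h \<in> lin M M'"
  using assms by (auto simp: LinearCombinations.module_hom_def)

locale linmap = A: vsp M + B: vsp M'
  for M :: "('k::field, 'a, 'm) module_scheme" and M' :: "('k, 'b, 'n) module_scheme" and h +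
  assumes lin: "h \<in> lin M M'"
begin

lemma closed [simp, intro]: "x \<in> carrier M \<Longrightarrow> h x \<in> carrier M'"
  and add: "x \<in> carrier M \<Longrightarrow> y \<in> carrier M \<Longrightarrow> h (x \<oplus>\<^bsub>M\<^esub> y) = h x \<oplus>\<^bsub>M'\<^esub> h y"
  and smult: "x \<in> carrier M \<Longrightarrow> h (c \<odot>\<^bsub>M\<^esub> x) = c \<odot>\<^bsub>M'\<^esub> h x"
  using lin by (auto simp: LinearCombinations.module_hom_def)

lemma zero [simp]: "h \<zero>\<^bsub>M\<^esub> = \<zero>\<^bsub>M'\<^esub>"
  using smult[of "\<zero>\<^bsub>M\<^esub>" 0] by simp

lemma a_inv: "x \<in> carrier M \<Longrightarrow> h (\<ominus>\<^bsub>M\<^esub> x) = \<ominus>\<^bsub>M'\<^esub> h x"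
  using smult[of x "-1"] by (simp add: A.a_inv_smult B.a_inv_smult)

lemma minus: "x \<in> carrier M \<Longrightarrow> y \<in> carrier M \<Longrightarrow> h (x \<ominus>\<^bsub>M\<^esub> y) = h x \<ominus>\<^bsub>M'\<^esub> h y"
  by (simp add: A.minus_eq B.minus_eq add a_inv)

lemma finsum: "(\<And>i. i \<in> I \<Longrightarrow> f i \<in> carrier M) \<Longrightarrow> h (\<Oplus>\<^bsub>M\<^esub>i\<in>I. f i) = (\<Oplus>\<^bsub>M'\<^esub>i\<in>I. h (f i))"
proof (induction I rule: infinite_finite_induct)
  case (insert i I)
  then show ?case by (simp add: A.finsum_insert B.finsum_insert add Pi_def A.finsum_closed)
qed auto

lemma vimage_subsp: "subsp N M' \<Longrightarrow> subsp {x \<in> carrier M. h x \<in> N} M"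
  by (auto simp: A.subsp_iff B.subsp_iff add smult)

lemma span_image_subset:
  assumes "A \<subseteq> carrier M" "h ` A \<subseteq> N" "subsp N M'"
  shows "h ` (LinearCombinations.module.span class_ring M A) \<subseteq> N"
  using A.span_least[OF _ vimage_subsp[OF assms(3)], of A] assms by auto

end

lemma lin_compose: "g \<in> lin M' M'' \<Longrightarrow> f \<in> lin M M' \<Longrightarrow> (\<lambda>x. g (f x)) \<in> lin M M''"
  by (auto simp: LinearCombinations.module_hom_def Pi_def)

lemma subsp_image_on:
  fixes M :: "('k::field, 'a, 'm) module_scheme" and M' :: "('k, 'b, 'n) module_scheme"
  assumes "vsp M" "vsp M'" and N: "subsp N M" and closed: "\<And>x. x \<in> N \<Longrightarrow> h x \<in> carrier M'"
    and add: "\<And>x y. x \<in> N \<Longrightarrow> y \<in> N \<Longrightarrow> h (x \<oplus>\<^bsub>M\<^esub> y) = h x \<oplus>\<^bsub>M'\<^esub> h y"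
    and smult: "\<And>c x. x \<in> N \<Longrightarrow> h (c \<odot>\<^bsub>M\<^esub> x) = c \<odot>\<^bsub>M'\<^esub> h x"
  shows "subsp (h ` N) M'"
proof -
  interpret A: vsp M by fact
  interpret B: vsp M' by fact
  note N = A.subspD[OF N]
  show ?thesis unfolding B.subsp_iff
  proof (intro conjI ballI allI)
    show "h ` N \<subseteq> carrier M'" using closed by auto
    have "h (0 \<odot>\<^bsub>M\<^esub> \<zero>\<^bsub>M\<^esub>) = \<zero>\<^bsub>M'\<^esub>" using smult[OF N(2), of 0] closed[OF N(2)] by simp
    then show "\<zero>\<^bsub>M'\<^esub> \<in> h ` N" using N(2) by (metis A.smult_zero imageI)
    fix x assume x: "x \<in> h ` N"
    then obtain a where a: "a \<in> N" "x = h a" by auto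
    { fix y assume "y \<in> h ` N"
      then obtain b where b: "b \<in> N" "y = h b" by auto
      show "x \<oplus>\<^bsub>M'\<^esub> y \<in> h ` N"
        using add[OF a(1) b(1)] a(2) b(2) N(3)[OF a(1) b(1)] by (metis imageI) }
    show "c \<odot>\<^bsub>M'\<^esub> x \<in> h ` N" for c
      using smult[OF a(1)] a(2) N(4)[OF a(1)] by (metis imageI)
  qed
qed

text \<open>
  The axioms are identities, and a surjection compatible with the operations carries them over; this
  is how quotients become vector spaces.
\<close>

lemma vsp_transport:
  fixes M' :: "('k::field, 'b, 'n) module_scheme"
  assumes "vsp M" and surj: "h ` carrier M = carrier M'"
    and add: "\<And>x y. x \<in> carrier M \<Longrightarrow> y \<in> carrier M \<Longrightarrow> h (x \<oplus>\<^bsub>M\<^esub> y) = h x \<oplus>\<^bsub>M'\<^esub> h y"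
    and smult: "\<And>c x. x \<in> carrier M \<Longrightarrow> h (c \<odot>\<^bsub>M\<^esub> x) = c \<odot>\<^bsub>M'\<^esub> h x"
    and zero: "h \<zero>\<^bsub>M\<^esub> = \<zero>\<^bsub>M'\<^esub>"
  shows "vsp M'"
proof -
  interpret A: vsp M by fact
  have ex: "\<exists>a. a \<in> carrier M \<and> x = h a" if "x \<in> carrier M'" for x using that surj by blast
  have cl: "h a \<in> carrier M'" if "a \<in> carrier M" for a using that surj by blast
  show ?thesis
  proof (rule vspI)
    show "\<zero>\<^bsub>M'\<^esub> \<in> carrier M'" using cl[of "\<zero>\<^bsub>M\<^esub>"] zero by simp
  qed (auto dest!: ex simp: add[symmetric] smult[symmetric] zero[symmetric] cl A.a_ac
       A.smult_smult A.smult_ladd A.smult_radd)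
qed

lemma (in vsp) finsum_minus:
  assumes "\<And>j. j \<in> I \<Longrightarrow> f j \<in> carrier M" "\<And>j. j \<in> I \<Longrightarrow> g j \<in> carrier M"
  shows "(\<Oplus>j\<in>I. f j) \<ominus> (\<Oplus>j\<in>I. g j) = (\<Oplus>j\<in>I. f j \<ominus> g j)"
proof -
  interpret r: linmap M M "\<lambda>x. (- 1) \<odot> x"
    by unfold_locales (auto intro!: linI simp: smult_radd smult_smult mult.commute)
  have "(\<Oplus>j\<in>I. f j \<ominus> g j) = (\<Oplus>j\<in>I. f j \<oplus> (- 1) \<odot> g j)"
    by (rule finsum_cong') (use assms in \<open>auto simp: minus_smult\<close>)
  also have "\<dots> = (\<Oplus>j\<in>I. f j) \<oplus> (\<Oplus>j\<in>I. (- 1) \<odot> g j)" by (rule finsum_addf) (use assms in auto)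
  also have "(\<Oplus>j\<in>I. (- 1) \<odot> g j) = (- 1) \<odot> (\<Oplus>j\<in>I. g j)" by (rule r.finsum[symmetric]) (use assms in auto)
  finally show ?thesis using assms by (subst minus_smult) (auto intro: finsum_closed)
qed

lemma (in vsp) subsp_combination:
  assumes "subsp K M" "\<And>j. j < N \<Longrightarrow> y j \<in> carrier M" "\<And>j. j < N \<Longrightarrow> a j = 0 \<or> y j \<in> K"
  shows "(\<Oplus>j\<in>{..<N}. a j \<odot> y j) \<in> K"
  using assms(2,3) subspD(2,4)[OF assms(1)] by (intro subsp_finsum[OF assms(1)]) (metis lessThan_iff smult_0)

lemma (in vsp) telescope: "x \<in> carrier M \<Longrightarrow> y \<in> carrier M \<Longrightarrow> z \<in> carrier M \<Longrightarrow> (x \<ominus> y) \<oplus> (y \<ominus> z) = x \<ominus> z"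
  by (simp add: minus_eq a_assoc r_neg1 r_neg2)

lemma (in vsp) subsp_telescope:
  assumes "subsp N M" "x \<in> carrier M" "y \<in> carrier M" "z \<in> carrier M" "x \<ominus> y \<in> N" "y \<ominus> z \<in> N"
  shows "x \<ominus> z \<in> N"
  using subspD(3)[OF assms(1,5,6)] telescope[OF assms(2-4)] by simp

lemma (in vsp) subsp_minus_swap:
  assumes "subsp N M" "x \<in> carrier M" "y \<in> carrier M" "x \<ominus> y \<in> N"
  shows "y \<ominus> x \<in> N"
proof -
  have "y \<ominus> x = (- 1) \<odot> (x \<ominus> y)" using assms by (simp add: minus_smult smult_radd smult_smult a_comm)
  then show ?thesis using subspD(4)[OF assms(1,4)] by simp
qed

section \<open>Complexifications and the spaces \<open>V[x]\<close>\<close>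

lemma cplx_simps [simp]:
  "carrier (cplx M) = carrier M \<times> carrier M"
  "\<zero>\<^bsub>cplx M\<^esub> = (\<zero>\<^bsub>M\<^esub>, \<zero>\<^bsub>M\<^esub>)"
  "(u, v) \<oplus>\<^bsub>cplx M\<^esub> (u', v') = (u \<oplus>\<^bsub>M\<^esub> u', v \<oplus>\<^bsub>M\<^esub> v')"
  "c \<odot>\<^bsub>cplx M\<^esub> (u, v) = (Re c \<odot>\<^bsub>M\<^esub> u \<ominus>\<^bsub>M\<^esub> Im c \<odot>\<^bsub>M\<^esub> v, Re c \<odot>\<^bsub>M\<^esub> v \<oplus>\<^bsub>M\<^esub> Im c \<odot>\<^bsub>M\<^esub> u)"
  by (auto simp: cplx_def)

lemma vsp_cplx: 
  fixes M :: "(real, 'a, 'm) module_scheme" assumes "vsp M" shows "vsp (cplx M)"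
proof -
  interpret vsp M by fact
  show ?thesis
  proof (rule vspI, goal_cases)
    case (9 a b x)
    then show ?case by (cases x)
      (simp add: minus_smult smult_smult smult_ladd smult_lminus smult_radd a_ac)
  qed (auto simp: a_ac minus_smult smult_smult smult_ladd smult_radd algebra_simps)
qed

lemma cplx_minus:
  assumes "vsp M" "u \<in> carrier M" "v \<in> carrier M" "u' \<in> carrier M" "v' \<in> carrier M"
  shows "(u, v) \<ominus>\<^bsub>cplx M\<^esub> (u', v') = (u \<ominus>\<^bsub>M\<^esub> u', v \<ominus>\<^bsub>M\<^esub> v')"
proof -
  interpret vsp M by fact
  interpret C: vsp "cplx M" by (rule vsp_cplx) fact
  show ?thesis using assms by (simp add: C.minus_smult minus_smult smult_neg)
qed

lemma map_prod_lin: 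
  fixes M :: "(real, 'a, 'm) module_scheme"
  assumes "vsp M" "vsp M'" "h \<in> lin M M'" shows "map_prod h h \<in> lin (cplx M) (cplx M')"
proof -
  interpret linmap M M' h using assms by (simp add: linmap_def linmap_axioms_def)
  show ?thesis by (rule linI) (auto simp: add smult minus)
qed

lemma subsp_cplx: 
  fixes M :: "(real, 'a, 'm) module_scheme"
  assumes "vsp M" "subsp N M" shows "subsp (N \<times> N) (cplx M)"
proof -
  interpret vsp M by fact
  interpret C: vsp "cplx M" by (rule vsp_cplx) fact
  show ?thesis using subspD[OF assms(2)] by (auto simp: C.subsp_iff)
qed

lemma S_module_simps [simp]:
  "carrier (S_module M) = carrier (S_vs M)"
  "\<zero>\<^bsub>S_module M\<^esub> = (\<lambda>k. \<zero>\<^bsub>M\<^esub>)"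
  "f \<oplus>\<^bsub>S_module M\<^esub> g = (\<lambda>k. f k \<oplus>\<^bsub>M\<^esub> g k)"
  "s \<odot>\<^bsub>S_module M\<^esub> f = (\<lambda>n. \<Oplus>\<^bsub>M\<^esub>k\<in>{..n}. coeff s k \<odot>\<^bsub>M\<^esub> f (n - k))"
  by (auto simp: S_module_def S_vs_def)

lemma S_vs_simps [simp]:
  "\<zero>\<^bsub>S_vs M\<^esub> = (\<lambda>k. \<zero>\<^bsub>M\<^esub>)"
  "f \<oplus>\<^bsub>S_vs M\<^esub> g = (\<lambda>k. f k \<oplus>\<^bsub>M\<^esub> g k)"
  "r \<odot>\<^bsub>S_vs M\<^esub> f = (\<lambda>k. r \<odot>\<^bsub>M\<^esub> f k)"
  by (simp_all add: S_vs_def del: S_module_simps(1))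

lemma S_vs_carrier: "f \<in> carrier (S_vs M) \<longleftrightarrow> (\<forall>k. f k \<in> carrier M) \<and> finite {k. f k \<noteq> \<zero>\<^bsub>M\<^esub>}"
  by (simp add: S_vs_def S_module_def del: S_module_simps(1))

lemma S_vs_carrierI: 
  assumes "\<And>k. f k \<in> carrier M" "\<And>k. k \<ge> N \<Longrightarrow> f k = \<zero>\<^bsub>M\<^esub>"
  shows "f \<in> carrier (S_vs M)"
proof -
  have "{k. f k \<noteq> \<zero>\<^bsub>M\<^esub>} \<subseteq> {..<N}" using assms(2) by (auto simp: not_le[symmetric])
  then show ?thesis using assms(1) finite_subset by (auto simp: S_vs_carrier)
qed

lemma S_vs_nth [simp]: "f \<in> carrier (S_vs M) \<Longrightarrow> f k \<in> carrier M"
  by (auto simp: S_vs_carrier)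

lemma S_vs_bound:
  assumes "f \<in> carrier (S_vs M)" obtains N where "\<And>k. k \<ge> N \<Longrightarrow> f k = \<zero>\<^bsub>M\<^esub>"
proof -
  obtain N where "\<forall>k\<in>{k. f k \<noteq> \<zero>\<^bsub>M\<^esub>}. k < N"
    using assms finite_nat_set_iff_bounded by (auto simp: S_vs_carrier)
  then show ?thesis using that[of N] by (auto simp: not_le[symmetric])
qed

lemma vsp_S_vs: 
  fixes M :: "(real, 'a, 'm) module_scheme"
  assumes "vsp M" shows "vsp (S_vs M)"
proof -
  interpret vsp M by fact
  show ?thesis
  proof (rule vspI, goal_cases)
    case 1 show ?case by (simp add: S_vs_carrier)
  next
    case (2 x y)
    obtain N where N: "\<And>k. k \<ge> N \<Longrightarrow> x k = \<zero>\<^bsub>M\<^esub>" using S_vs_bound[OF 2(1)] by metis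
    obtain N' where N': "\<And>k. k \<ge> N' \<Longrightarrow> y k = \<zero>\<^bsub>M\<^esub>" using S_vs_bound[OF 2(2)] by metis
    show ?case using 2 by (intro S_vs_carrierI[of _ _ "max N N'"]) (auto simp: N N')
  next
    case (3 c x)
    obtain N where N: "\<And>k. k \<ge> N \<Longrightarrow> x k = \<zero>\<^bsub>M\<^esub>" using S_vs_bound[OF 3] by metis
    show ?case using 3 by (intro S_vs_carrierI[of _ _ N]) (auto simp: N)
  qed (auto intro!: ext simp: a_ac smult_smult smult_ladd smult_radd)
qed

lemma S_vs_minus:
  fixes M :: "(real, 'a, 'm) module_scheme"
  assumes "vsp M" "f \<in> carrier (S_vs M)" "g \<in> carrier (S_vs M)"
  shows "f \<ominus>\<^bsub>S_vs M\<^esub> g = (\<lambda>k. f k \<ominus>\<^bsub>M\<^esub> g k)"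
proof -
  interpret vsp M by fact
  interpret C: vsp "S_vs M" by (rule vsp_S_vs) fact
  show ?thesis using assms by (simp add: C.minus_smult minus_smult S_vs_nth)
qed

lemma tens_closed [simp, intro]:
  fixes M :: "(real, 'a, 'm) module_scheme"
  assumes "vsp M" "v \<in> carrier M" shows "tens M v s \<in> carrier (S_vs M)"
proof -
  interpret vsp M by fact
  show ?thesis using assms by (intro S_vs_carrierI[of _ _ "Suc (degree s)"]) (auto simp: tens_def coeff_eq_0)
qed

lemma tens_linear:
  fixes M :: "(real, 'a, 'm) module_scheme"
  assumes "vsp M" "v \<in> carrier M"
  shows tens_add_right: "tens M v (s + t) = tens M v s \<oplus>\<^bsub>S_vs M\<^esub> tens M v t"
    and tens_diff_right: "tens M v (s - t) = tens M v s \<ominus>\<^bsub>S_vs M\<^esub> tens M v t"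
    and tens_smult_right: "tens M v (Polynomial.smult r s) = r \<odot>\<^bsub>S_vs M\<^esub> tens M v s"
    and tens_add_left: "w \<in> carrier M \<Longrightarrow> tens M (v \<oplus>\<^bsub>M\<^esub> w) s = tens M v s \<oplus>\<^bsub>S_vs M\<^esub> tens M w s"
    and tens_diff_left: "w \<in> carrier M \<Longrightarrow> tens M (v \<ominus>\<^bsub>M\<^esub> w) s = tens M v s \<ominus>\<^bsub>S_vs M\<^esub> tens M w s"
    and tens_smult_left: "tens M (r \<odot>\<^bsub>M\<^esub> v) s = r \<odot>\<^bsub>S_vs M\<^esub> tens M v s"
    and tens_zero_right [simp]: "tens M v 0 = \<zero>\<^bsub>S_vs M\<^esub>"
    and tens_zero_left [simp]: "tens M \<zero>\<^bsub>M\<^esub> s = \<zero>\<^bsub>S_vs M\<^esub>"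
proof -
  interpret vsp M by fact
  note [simp] = assms(2)
  show "tens M v (s + t) = tens M v s \<oplus>\<^bsub>S_vs M\<^esub> tens M v t"
   "tens M v (s - t) = tens M v s \<ominus>\<^bsub>S_vs M\<^esub> tens M v t"
   "tens M v (Polynomial.smult r s) = r \<odot>\<^bsub>S_vs M\<^esub> tens M v s"
   "tens M (r \<odot>\<^bsub>M\<^esub> v) s = r \<odot>\<^bsub>S_vs M\<^esub> tens M v s"
   "tens M v 0 = \<zero>\<^bsub>S_vs M\<^esub>" "tens M \<zero>\<^bsub>M\<^esub> s = \<zero>\<^bsub>S_vs M\<^esub>"
    by (simp_all add: S_vs_minus assms) (auto simp: tens_def smult_ladd smult_lminus smult_smult mult.commute)
  assume [simp]: "w \<in> carrier M"
  show "tens M (v \<oplus>\<^bsub>M\<^esub> w) s = tens M v s \<oplus>\<^bsub>S_vs M\<^esub> tens M w s"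
    "tens M (v \<ominus>\<^bsub>M\<^esub> w) s = tens M v s \<ominus>\<^bsub>S_vs M\<^esub> tens M w s"
    by (simp_all add: S_vs_minus assms) (auto simp: tens_def smult_radd smult_rminus)
qed

lemma ctens_closed:
  fixes M :: "(real, 'a, 'm) module_scheme"
  assumes "vsp M" "z \<in> carrier (cplx M)"
  shows "ctens M z w \<in> carrier (cplx (S_vs M))"
proof -
  interpret S: vsp "S_vs M" by (rule vsp_S_vs) fact
  show ?thesis using assms tens_closed[OF assms(1)] by (cases w) (auto simp: ctens_def simp del: S_vs_simps)
qed

section \<open>The tensor product with \<open>\<S>\<close>\<close>

lemma tensor_S_simps [simp]:
  "carrier (tensor_S V) = carrier (S_vs V)" "\<zero>\<^bsub>tensor_S V\<^esub> = \<zero>\<^bsub>S_vs V\<^esub>"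
  "add (tensor_S V) = add (S_vs V)" "module.smult (tensor_S V) = module.smult (S_vs V)"
  by (auto simp: tensor_S_def module.extend_def qmhs.fields_def)

lemma tensor_S_minus [simp]: "a_minus (tensor_S V) = a_minus (S_vs V)"
  by (intro ext) (simp add: a_minus_def a_inv_def m_inv_def)

lemma cplx_tensor_S [simp]: "cplx (tensor_S V) = cplx (S_vs V)"
  by (simp add: cplx_def)

lemma vsp_tensor_S:
  fixes V :: "'a qmhs" assumes "vsp V" shows "vsp (tensor_S V)"
  by (rule vsp_transport[OF vsp_S_vs[OF assms], of "\<lambda>x. x"]) auto

lemma Ffil_tensor_S: "Ffil (tensor_S V) p = LinearCombinations.module.span class_ring (cplx (S_vs V))
   (\<Union>a. {ctens V z w | z w. z \<in> Ffil V a \<and> w \<in> Ffil S_ring (p - a)})"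
  and Wfil_tensor_S': "Wfil (tensor_S V) n = LinearCombinations.module.span class_ring (S_vs V)
   (\<Union>a. {tens V v s | v s. v \<in> Wfil V a \<and> s \<in> Wfil S_ring (n - a)})"
  by (auto simp: tensor_S_def module.extend_def qmhs.fields_def)

section \<open>Adapted frames\<close>

definition functional :: "('k::field, 'a, 'm) module_scheme \<Rightarrow> ('a \<Rightarrow> 'k) \<Rightarrow> bool" where
  "functional M c \<longleftrightarrow> (\<forall>x\<in>carrier M. \<forall>y\<in>carrier M. c (x \<oplus>\<^bsub>M\<^esub> y) = c x + c y) \<and>
     (\<forall>r. \<forall>x\<in>carrier M. c (r \<odot>\<^bsub>M\<^esub> x) = r * c x)"

lemma functionalI:
  assumes "\<And>x y. x \<in> carrier M \<Longrightarrow> y \<in> carrier M \<Longrightarrow> c (x \<oplus>\<^bsub>M\<^esub> y) = c x + c y"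
    "\<And>r x. x \<in> carrier M \<Longrightarrow> c (r \<odot>\<^bsub>M\<^esub> x) = r * c x"
  shows "functional M c"
  using assms by (auto simp: functional_def)

context vsp begin

lemma functionalD:
  assumes "functional M c"
  shows functional_add: "x \<in> carrier M \<Longrightarrow> y \<in> carrier M \<Longrightarrow> c (x \<oplus> y) = c x + c y"
    and functional_smult: "x \<in> carrier M \<Longrightarrow> c (r \<odot> x) = r * c x"
    and functional_minus: "x \<in> carrier M \<Longrightarrow> y \<in> carrier M \<Longrightarrow> c (x \<ominus> y) = c x - c y"
    and functional_zero: "c \<zero> = 0"
proof -
  show *: "x \<in> carrier M \<Longrightarrow> y \<in> carrier M \<Longrightarrow> c (x \<oplus> y) = c x + c y"
    "x \<in> carrier M \<Longrightarrow> c (r \<odot> x) = r * c x" for x y r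
    using assms by (auto simp: functional_def)
  show "x \<in> carrier M \<Longrightarrow> y \<in> carrier M \<Longrightarrow> c (x \<ominus> y) = c x - c y"
    by (simp add: minus_smult *)
  show "c \<zero> = 0" using *(2)[of \<zero> 0] by simp
qed

lemma functional_kernel:
  assumes c: "functional M c" and K: "subsp K M" shows "subsp {x \<in> K. c x = 0} M"
  using subspD[OF K] functionalD[OF c] by (auto simp: subsp_iff)

end

text \<open>
  Enlarge \<open>N\<close> to a subspace \<open>N'\<close> that still avoids \<open>b\<close> but for which \<open>N'\<close> and \<open>b\<close> together span \<open>M\<close>; the
  coefficient of \<open>b\<close> modulo \<open>N'\<close> is the functional.  Each step of the enlargement adjoins a generator
  outside \<open>N + \<langle>b\<rangle>\<close>, so at most \<open>card G\<close> steps are necessary.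
\<close>

lemma (in vsp) functional_vanishing_on:
  assumes fin: "finite G" and G: "G \<subseteq> carrier M" and gen: "lspan G = carrier M"
    and N: "subsp N M" and b: "b \<in> carrier M" "b \<notin> N"
  obtains c where "functional M c" "\<And>x. x \<in> N \<Longrightarrow> c x = 0" "c b = 1"
proof -
  let ?good = "\<lambda>N x. \<exists>t. x \<ominus> t \<odot> b \<in> N"
  have good_subsp: "subsp {x \<in> carrier M. ?good N x} M" if N: "subsp N M" for N
    unfolding subsp_iff
  proof (intro conjI ballI allI; clarsimp)
    note NN = subspD[OF N]
    show "?good N \<zero>" using b NN(2) by (intro exI[of _ 0]) simp
    show "?good N (x \<oplus> y)" if "x \<in> carrier M" "y \<in> carrier M" "x \<ominus> t \<odot> b \<in> N" "y \<ominus> u \<odot> b \<in> N" for x y t u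
      using NN(3)[OF that(3,4)] that b
      by (intro exI[of _ "t + u"]) (simp add: minus_smult smult_smult smult_ladd smult_radd a_ac)
    show "?good N (c \<odot> x)" if "x \<in> carrier M" "x \<ominus> t \<odot> b \<in> N" for x t c
      using NN(4)[OF that(2), of c] that b
      by (intro exI[of _ "c * t"]) (simp add: minus_smult smult_smult smult_ladd smult_radd a_ac)
  qed
  have "\<exists>N'. subsp N' M \<and> N \<subseteq> N' \<and> b \<notin> N' \<and> (\<forall>x\<in>carrier M. ?good N' x)"
    using N b(2)
  proof (induction "card {g \<in> G. \<not> ?good N g}" arbitrary: N rule: less_induct)
    case less
    note NN = subspD[OF less(2)]
    show ?case
    proof (cases "\<forall>g\<in>G. ?good N g")
      case True
      then have "lspan G \<subseteq> {x \<in> carrier M. ?good N x}"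
        using G by (intro span_least good_subsp less) auto
      then show ?thesis using gen less(2,3) by (intro exI[of _ N]) auto
    next
      case False
      then obtain g where g: "g \<in> G" "\<not> ?good N g" by auto
      then have gM: "g \<in> carrier M" using G by auto
      define N' where "N' = {x \<oplus> s \<odot> g | x s. x \<in> N}"
      have N'I: "x \<oplus> s \<odot> g \<in> N'" if "x \<in> N" for x s using that N'_def by auto
      have N': "subsp N' M" unfolding subsp_iff
      proof (intro conjI ballI allI)
        show "N' \<subseteq> carrier M" using NN gM by (auto simp: N'_def)
        show "\<zero> \<in> N'" using N'I[OF NN(2), of 0] gM by simp
        show "x \<oplus> y \<in> N'" if "x \<in> N'" "y \<in> N'" for x y
        proof -
          obtain x' s y' t where *: "x' \<in> N" "y' \<in> N" "x = x' \<oplus> s \<odot> g" "y = y' \<oplus> t \<odot> g"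
            using \<open>x \<in> N'\<close> \<open>y \<in> N'\<close> by (auto simp: N'_def)
          show ?thesis using N'I[OF NN(3)[OF *(1,2)], of "s + t"] * NN(6) gM
            by (simp add: smult_ladd a_ac)
        qed
        show "c \<odot> x \<in> N'" if "x \<in> N'" for x c
        proof -
          obtain x' s where *: "x' \<in> N" "x = x' \<oplus> s \<odot> g" using \<open>x \<in> N'\<close> by (auto simp: N'_def)
          show ?thesis using N'I[OF NN(4)[OF *(1), of c], of "c * s"] * NN(6) gM
            by (simp add: smult_radd smult_smult)
        qed
      qed
      have sub: "N \<subseteq> N'" 
      proof
        fix x assume "x \<in> N" then show "x \<in> N'" using N'I[of x 0] gM NN(6) by simp
      qed
      have bN': "b \<notin> N'"
      proof
        assume "b \<in> N'"
        then obtain x s where xs: "x \<in> N" "b = x \<oplus> s \<odot> g" by (auto simp: N'_def)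
        have "s \<noteq> 0" using xs less(3) gM NN(6) by auto
        have "g \<ominus> (1/s) \<odot> b = (- (1 / s)) \<odot> x"
          using xs gM NN(6) \<open>s \<noteq> 0\<close> 
          by (simp add: minus_smult smult_smult smult_radd a_lcomm[of g] r_neg flip: a_inv_smult)
        then show False using g(2) NN(4)[OF xs(1)] by metis
      qed
      have "{h \<in> G. \<not> ?good N' h} \<subseteq> {h \<in> G. \<not> ?good N h} - {g}"
      proof -
        have "g \<ominus> 0 \<odot> b \<in> N'" using N'I[OF NN(2), of 1] gM b by simp
        then show ?thesis using sub by auto
      qed
      then have "card {h \<in> G. \<not> ?good N' h} < card {h \<in> G. \<not> ?good N h}"
        using g fin by (intro psubset_card_mono) auto
      from less(1)[OF this N' bN'] show ?thesis using sub by blast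
    qed
  qed
  then obtain N' where N': "subsp N' M" "N \<subseteq> N'" "b \<notin> N'" and good: "\<And>x. x \<in> carrier M \<Longrightarrow> ?good N' x"
    by blast
  note NN = subspD[OF N'(1)]
  have uniq: "t = u" if x: "x \<in> carrier M" "x \<ominus> t \<odot> b \<in> N'" "x \<ominus> u \<odot> b \<in> N'" for x t u
  proof (rule ccontr)
    assume "t \<noteq> u"
    have "(x \<ominus> u \<odot> b) \<ominus> (x \<ominus> t \<odot> b) = (t - u) \<odot> b"
      using x b by (simp add: minus_smult smult_smult smult_radd smult_lminus a_ac r_neg flip: a_inv_smult)
       (simp add: a_inv_smult a_assoc[symmetric], simp add: r_neg flip: a_inv_smult)
    then have "(t - u) \<odot> b \<in> N'" using NN(5)[OF x(3,2)] by simp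
    then have "(1 / (t - u)) \<odot> ((t - u) \<odot> b) \<in> N'" using NN(4) by blast
    then show False using N'(3) b \<open>t \<noteq> u\<close> by (simp add: smult_smult)
  qed
  define c where "c x = (SOME t. x \<ominus> t \<odot> b \<in> N')" for x
  have c: "x \<ominus> c x \<odot> b \<in> N'" if "x \<in> carrier M" for x
    unfolding c_def using good[OF that] by (rule someI_ex)
  have cI: "c x = t" if "x \<in> carrier M" "x \<ominus> t \<odot> b \<in> N'" for x t
    using uniq[OF that(1) c[OF that(1)] that(2)] .
  show ?thesis
  proof (rule that, rule functionalI)
    show "c (x \<oplus> y) = c x + c y" if "x \<in> carrier M" "y \<in> carrier M" for x y
      using NN(3)[OF c[OF that(1)] c[OF that(2)]] that b
      by (intro cI) (simp_all add: minus_smult smult_smult smult_ladd smult_radd a_ac)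
    show "c (r \<odot> x) = r * c x" if "x \<in> carrier M" for x r
      using NN(4)[OF c[OF that], of r] that b
      by (intro cI) (simp_all add: minus_smult smult_smult smult_ladd smult_radd a_ac)
    show "c x = 0" if "x \<in> N" for x using that N'(2) NN(6) b by (intro cI) auto
    show "c b = 1" using NN(2) b by (intro cI) auto
  qed
qed

text \<open>
  Induction on the dimension in a form that keeps all functionals defined on the whole of \<open>M\<close>.  The
  measure is the size of a finite set \<open>G\<close> whose span contains \<open>K\<close>: if \<open>c\<close> does not vanish at \<open>g \<in> G\<close>, the
  projection \<open>\<rho>\<close> to the kernel of \<open>c\<close> along \<open>g\<close> fixes the hyperplane section and kills \<open>g\<close>, so the section
  lies in the span of fewer vectors.
\<close>

lemma (in vsp) hyperplane_section_induct:
  assumes fin: "finite G" and G: "G \<subseteq> carrier M" and gen: "lspan G = carrier M"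
    and K: "subsp K M" and base: "P {\<zero>}"
    and step: "\<And>K. subsp K M \<Longrightarrow> K \<noteq> {\<zero>} \<Longrightarrow>
      (\<And>c b. functional M c \<Longrightarrow> b \<in> K \<Longrightarrow> c b = 1 \<Longrightarrow> P {x \<in> K. c x = 0}) \<Longrightarrow> P K"
  shows "P K"
proof -
  have "P K" if "finite G" "G \<subseteq> carrier M" "subsp K M" "K \<subseteq> lspan G" for G
    using that
  proof (induction "card G" arbitrary: G K rule: less_induct)
    case (less G K)
    show ?case
    proof (cases "K = {\<zero>}")
      case True then show ?thesis using base by simp
    next
      case False
      show ?thesis
      proof (rule step[OF less(4) False])
        fix c b assume c: "functional M c" and b: "b \<in> K" "c b = 1"
        note cc = functionalD[OF c]
        have "\<not> G \<subseteq> {x \<in> carrier M. c x = 0}"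
        proof
          assume "G \<subseteq> {x \<in> carrier M. c x = 0}"
          then have "b \<in> {x \<in> carrier M. c x = 0}"
            using subsetD[OF span_least[OF _ functional_kernel[OF c subsp_carrier]], of G b] b(1) subsetD[OF less(5)] by simp
          then show False using b(2) by simp
        qed
        then obtain g where g: "g \<in> G" "c g \<noteq> 0" "g \<in> carrier M" using less(3) by auto
        \<comment> \<open>the projection to the kernel of \<open>c\<close> along
          \<open>g\<close>\<close>
        define \<rho> where "\<rho> x = x \<ominus> (c x / c g) \<odot> g" for x
        have \<rho>: "\<rho> \<in> lin M M"
          by (rule linI) (use g cc in \<open>auto simp: \<rho>_def minus_smult smult_smult smult_radd smult_ladd add_divide_distrib a_ac\<close>)
        interpret \<rho>: linmap M M \<rho> by unfold_locales (rule \<rho>)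
        let ?G = "\<rho> ` G - {\<zero>}"
        have sG: "subsp (lspan ?G) M" using less(3) by (intro span_subsp) auto
        show "P {x \<in> K. c x = 0}"
        proof (rule less(1))
          have "\<rho> g = \<zero>" using g by (simp add: \<rho>_def)
          then have "?G \<subseteq> \<rho> ` (G - {g})" by auto
          then have "card ?G \<le> card (G - {g})"
            using less(2) by (meson card_image_le card_mono finite_Diff finite_imageI le_trans)
          also have "\<dots> < card G" by (rule card_Diff1_less[OF less(2) g(1)])
          finally show "card ?G < card G" .
          show "finite ?G" using less(2) by simp
          show "?G \<subseteq> carrier M" using less(3) by auto
          show "subsp {x \<in> K. c x = 0} M" by (rule functional_kernel[OF c less(4)])
          show "{x \<in> K. c x = 0} \<subseteq> lspan ?G"
          proof
            fix x assume x: "x \<in> {x \<in> K. c x = 0}"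
            then have xM: "x \<in> carrier M" using subspD[OF less(4)] by auto
            have "\<rho> ` G \<subseteq> lspan ?G"
            proof
              fix y assume y: "y \<in> \<rho> ` G"
              have "?G \<subseteq> lspan ?G" using less(3) by (intro span_superset) auto
              moreover have "y = \<zero> \<or> y \<in> ?G" using y by simp
              ultimately show "y \<in> lspan ?G" using subspD(2)[OF sG] by (elim disjE) (simp, rule subsetD)
            qed
            then have "\<rho> ` lspan G \<subseteq> lspan ?G"
              by (rule \<rho>.span_image_subset[OF less(3) _ sG])
            moreover have "\<rho> x = x" using x xM g by (simp add: \<rho>_def)
            ultimately show "x \<in> lspan ?G" using x less(5) by (metis (no_types, lifting) image_subset_iff mem_Collect_eq subset_eq)
          qed
        qed
      qed
    qed
  qed
  then show ?thesis using fin G gen K subspD(1)[OF K] by blast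
qed

text \<open>
  Take a nonzero \<open>b \<in> K\<close>, some \<open>F p\<close> without \<open>b\<close>, and a functional \<open>c\<close> that vanishes on \<open>F p\<close> but not at
  \<open>b\<close>.  From \<open>p\<close> on, the filtration lives in the kernel of \<open>c\<close>, and the dimension has dropped.
\<close>

lemma (in vsp) separated_filtration_bounded:
  fixes F :: "int \<Rightarrow> 'a set"
  assumes fin: "finite G" and G: "G \<subseteq> carrier M" and gen: "lspan G = carrier M"
    and F: "\<And>p. subsp (F p) M" and anti: "\<And>p q. p \<le> q \<Longrightarrow> F q \<subseteq> F p" and sep: "(\<Inter>p. F p) = {\<zero>}"
  obtains p where "F p = {\<zero>}"
proof -
  have "\<exists>p. F p \<inter> carrier M \<subseteq> {\<zero>}"
  proof (rule hyperplane_section_induct[OF fin G gen subsp_carrier, where P = "\<lambda>K. \<exists>p. F p \<inter> K \<subseteq> {\<zero>}"])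
    fix K assume K: "subsp K M" "K \<noteq> {\<zero>}"
      and IH: "\<And>c b. functional M c \<Longrightarrow> b \<in> K \<Longrightarrow> c b = 1 \<Longrightarrow> \<exists>p. F p \<inter> {x \<in> K. c x = 0} \<subseteq> {\<zero>}"
    obtain b where b: "b \<in> K" "b \<noteq> \<zero>" using K subspD(2)[OF K(1)] by blast
    then obtain p where "b \<notin> F p" using sep by auto
    then obtain c where c: "functional M c" "\<And>x. x \<in> F p \<Longrightarrow> c x = 0" "c b = 1"
      using functional_vanishing_on[OF fin G gen F] b subspD(6)[OF K(1)] by metis
    obtain q where q: "F q \<inter> {x \<in> K. c x = 0} \<subseteq> {\<zero>}" using IH[OF c(1) b(1) c(3)] by blast
    have "F (max p q) \<subseteq> F p \<inter> F q" using anti[of p "max p q"] anti[of q "max p q"] by simp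
    then have "F (max p q) \<inter> K \<subseteq> {\<zero>}" using q c(2) by blast
    then show "\<exists>p. F p \<inter> K \<subseteq> {\<zero>}" by blast
  qed auto
  then obtain p where "F p \<inter> carrier M \<subseteq> {\<zero>}" by blast
  then have "F p = {\<zero>}" using subspD(1,2)[OF F[of p]] by blast
  then show ?thesis by (rule that)
qed

lemma (in vsp) exhaustive_filtration_bounded:
  fixes W :: "int \<Rightarrow> 'a set"
  assumes fin: "finite G" and G: "G \<subseteq> carrier M" and gen: "lspan G = carrier M"
    and W: "\<And>n. subsp (W n) M" and mono: "\<And>m n. m \<le> n \<Longrightarrow> W m \<subseteq> W n" and ex: "(\<Union>n. W n) = carrier M"
  obtains n where "W n = carrier M"
proof -
  have "\<exists>n. G \<subseteq> W n" using fin G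
  proof (induction G)
    case empty then show ?case by simp
  next
    case (insert g G)
    then obtain n where n: "G \<subseteq> W n" by blast
    obtain m where m: "g \<in> W m" using insert.prems ex by blast
    have "insert g G \<subseteq> W (max m n)" using n m mono[of m "max m n"] mono[of n "max m n"] by auto
    then show ?case by blast
  qed
  then obtain n where "G \<subseteq> W n" by blast
  then have "carrier M \<subseteq> W n" using span_least[OF _ W] gen by blast
  then show ?thesis using that[of n] subspD(1)[OF W[of n]] by blast
qed

text \<open>
  Coordinates on \<open>K\<close> adapted to two filtrations, as a basis adapted to both would give them: \<open>b j\<close> has
  degree \<open>d j\<close> for \<open>F\<close> and \<open>n j\<close> for \<open>W\<close>, and elements of \<open>F p\<close> and \<open>W m\<close> involve only those \<open>b j\<close> that lie
  in \<open>F p\<close> and \<open>W m\<close>.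
\<close>

definition biframe :: "('k::field, 'a, 'm) module_scheme \<Rightarrow> (int \<Rightarrow> 'a set) \<Rightarrow> (int \<Rightarrow> 'a set) \<Rightarrow> 'a set \<Rightarrow>
    nat \<Rightarrow> (nat \<Rightarrow> 'a) \<Rightarrow> (nat \<Rightarrow> 'a \<Rightarrow> 'k) \<Rightarrow> (nat \<Rightarrow> int) \<Rightarrow> (nat \<Rightarrow> int) \<Rightarrow> bool" where
  "biframe M F W K N b c d n \<longleftrightarrow>
     (\<forall>j<N. b j \<in> K \<and> b j \<in> F (d j) \<and> b j \<in> W (n j) \<and> functional M (c j)) \<and>
     (\<forall>x\<in>K. x = (\<Oplus>\<^bsub>M\<^esub>j\<in>{..<N}. c j x \<odot>\<^bsub>M\<^esub> b j)) \<and>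
     (\<forall>x\<in>K. \<forall>p. x \<in> F p \<longrightarrow> (\<forall>j<N. d j < p \<longrightarrow> c j x = 0)) \<and>
     (\<forall>x\<in>K. \<forall>m. x \<in> W m \<longrightarrow> (\<forall>j<N. m < n j \<longrightarrow> c j x = 0))"

lemma int_least:
  fixes P :: "int \<Rightarrow> bool"
  assumes "P a" "\<And>i. P i \<Longrightarrow> lo \<le> i" obtains n where "P n" "\<And>i. P i \<Longrightarrow> n \<le> i"
proof -
  let ?Q = "\<lambda>k. P (lo + int k)"
  have Q: "?Q (nat (a - lo))" using assms by simp
  show ?thesis
  proof (rule that[of "lo + int (LEAST k. ?Q k)"])
    show "?Q (LEAST k. ?Q k)" by (rule LeastI[of ?Q, OF Q])
    show "lo + int (LEAST k. ?Q k) \<le> i" if "P i" for i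
    proof -
      have "?Q (nat (i - lo))" using that assms(2)[OF that] by simp
      then have "(LEAST k. ?Q k) \<le> nat (i - lo)" by (rule Least_le[of ?Q])
      then show ?thesis using assms(2)[OF that] by linarith
    qed
  qed
qed

text \<open>
  Any two finite filtrations have adapted coordinates; vectors are split off one at a time.  Let \<open>b\<close> be
  a nonzero vector in the lowest \<open>W n\<close> that meets \<open>K\<close>, and there in the highest possible \<open>F p\<close>.  Then
  \<open>b \<notin> F (p + 1)\<close>, so some functional \<open>c\<close> vanishes on \<open>F (p + 1)\<close> and takes the value \<open>1\<close> at \<open>b\<close>.  The
  remainder \<open>x - c(x) b\<close> of \<open>x \<in> K\<close> stays in every \<open>F q\<close> and every \<open>W m\<close> that contains \<open>x\<close>, because either
  \<open>b\<close> lies in that subspace as well or \<open>c(x) = 0\<close>.  Hence coordinates on the kernel of \<open>c\<close> in \<open>K\<close>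
  extend to \<open>K\<close>.
\<close>

theorem (in vsp) biframe_exists:
  fixes F W :: "int \<Rightarrow> 'a set"
  assumes fin: "finite G" and G: "G \<subseteq> carrier M" and gen: "lspan G = carrier M"
    and F: "\<And>p. subsp (F p) M" and F_anti: "\<And>p q. p \<le> q \<Longrightarrow> F q \<subseteq> F p"
    and F_ex: "(\<Union>p. F p) = carrier M" and F_top: "F pF = {\<zero>}"
    and W: "\<And>n. subsp (W n) M" and W_mono: "\<And>m n. m \<le> n \<Longrightarrow> W m \<subseteq> W n"
    and W_ex: "(\<Union>n. W n) = carrier M" and W_bot: "W m0 = {\<zero>}"
  shows "\<exists>N b c d n. biframe M F W (carrier M) N b c d n"
proof (rule hyperplane_section_induct[OF fin G gen subsp_carrier, where P = "\<lambda>K. \<exists>N b c d n. biframe M F W K N b c d n"])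
  show "\<exists>N b c d n. biframe M F W {\<zero>} N b c d n"
    by (rule exI[of _ 0]) (simp add: biframe_def)
next
  fix K assume K: "subsp K M" "K \<noteq> {\<zero>}"
    and IH: "\<And>c b. functional M c \<Longrightarrow> b \<in> K \<Longrightarrow> c b = 1 \<Longrightarrow>
      \<exists>N b' c' d n. biframe M F W {x \<in> K. c x = 0} N b' c' d n"
  note KK = subspD[OF K(1)]
  obtain x where x: "x \<in> K" "x \<noteq> \<zero>" using K(2) KK(2) by blast
  then obtain a where a: "x \<in> W a" using KK(6) W_ex by blast
  have lo: "m0 \<le> i" if "\<exists>x\<in>W i \<inter> K. x \<noteq> \<zero>" for i
    using W_mono[of i m0] W_bot that by (cases "m0 \<le> i") auto
  obtain n where n: "\<exists>x\<in>W n \<inter> K. x \<noteq> \<zero>" and n_min: "\<And>i. \<exists>x\<in>W i \<inter> K. x \<noteq> \<zero> \<Longrightarrow> n \<le> i"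
    using int_least[of "\<lambda>i. \<exists>x\<in>W i \<inter> K. x \<noteq> \<zero>" a m0] lo x a by blast
  obtain y where y: "y \<in> W n" "y \<in> K" "y \<noteq> \<zero>" using n by blast
  then obtain a' where a': "y \<in> F a'" using KK(6) F_ex by blast
  let ?P = "\<lambda>i. \<exists>x\<in>F (- i) \<inter> W n \<inter> K. x \<noteq> \<zero>"
  have lo': "- pF \<le> i" if "?P i" for i
    using F_anti[of pF "-i"] F_top that by (cases "- pF \<le> i") auto
  have "?P (- a')" using y a' by auto
  then obtain p' where p': "?P p'" and p'_min: "\<And>i. ?P i \<Longrightarrow> p' \<le> i"
    using int_least[of ?P "- a'" "- pF"] lo' by blast
  define p where "p = - p'"
  obtain b where b: "b \<in> F p" "b \<in> W n" "b \<in> K" "b \<noteq> \<zero>" using p' by (auto simp: p_def)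
  have "b \<notin> F (p + 1)" using p'_min[of "- (p + 1)"] b by (auto simp: p_def)
  then obtain c where c: "functional M c" "\<And>x. x \<in> F (p + 1) \<Longrightarrow> c x = 0" "c b = 1"
    using functional_vanishing_on[OF fin G gen F] b KK(6) by metis
  note cc = functionalD[OF c(1)]
  obtain N b' c' d' n' where fr: "biframe M F W {x \<in> K. c x = 0} N b' c' d' n'"
    using IH[OF c(1) b(3) c(3)] by blast
  have bM: "b \<in> carrier M" using b KK by blast
  let ?r = "\<lambda>x. x \<ominus> c x \<odot> b"
  define b'' where "b'' = b'(N := b)"
  define d'' where "d'' = d'(N := p)"
  define n'' where "n'' = n'(N := n)"
  define c'' where "c'' = (\<lambda>j x. c' j (?r x))(N := c)"
  have bM': "b' j \<in> carrier M" if "j < N" for j using fr that KK by (auto simp: biframe_def)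
  have c': "functional M (c' j)" if "j < N" for j using fr that by (auto simp: biframe_def)
  have r: "?r x \<in> {x \<in> K. c x = 0}" if "x \<in> K" for x
    using that b c(3) KK bM by (simp add: cc)
  have small: "c x = 0" "x = \<zero>" if "x \<in> K" "x \<in> W m" "m < n" for x m
  proof -
    show "x = \<zero>" using n_min[of m] that by auto
    then show "c x = 0" using cc(4) by simp
  qed
  have "biframe M F W K (Suc N) b'' c'' d'' n''"
    unfolding biframe_def
  proof (intro conjI ballI allI impI)
    fix j assume j: "j < Suc N"
    show "b'' j \<in> K" "b'' j \<in> F (d'' j)" "b'' j \<in> W (n'' j)"
      using fr b j by (auto simp: b''_def d''_def n''_def biframe_def)
    show "functional M (c'' j)"
    proof (cases "j = N")
      case True then show ?thesis using c by (simp add: c''_def)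
    next
      case False
      then have "j < N" using j by simp
      note cj = functionalD[OF c'[OF this]]
      show ?thesis using False bM
        by (intro functionalI) (simp_all add: c''_def cj cc algebra_simps)
    qed
  next
    fix x assume x: "x \<in> K"
    let ?y = "\<Oplus>j\<in>{..<N}. c' j (?r x) \<odot> b' j"
    have "?r x = ?y" using fr r[OF x] by (simp add: biframe_def)
    moreover have "(\<Oplus>j\<in>{..<N}. c'' j x \<odot> b'' j) = ?y"
      using bM' by (intro finsum_cong') (auto simp: b''_def c''_def)
    moreover have "(\<Oplus>j\<in>{..<Suc N}. c'' j x \<odot> b'' j) = c x \<odot> b \<oplus> (\<Oplus>j\<in>{..<N}. c'' j x \<odot> b'' j)"
      unfolding lessThan_Suc using bM bM'
      by (subst finsum_insert) (auto simp: b''_def c''_def)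
    ultimately show "x = (\<Oplus>j\<in>{..<Suc N}. c'' j x \<odot> b'' j)" using x KK(6) bM by (metis add_minus_cancel scl)
  next
    fix x q j assume x: "x \<in> K" "x \<in> F q" and j: "j < Suc N" "d'' j < q"
    show "c'' j x = 0"
    proof (cases "j = N")
      case True
      then have "x \<in> F (p + 1)" using F_anti[of "p + 1" q] x j by (auto simp: d''_def)
      then show ?thesis using True c(2) by (simp add: c''_def)
    next
      case False
      have "?r x \<in> F q"
      proof (cases "c x = 0")
        case True then show ?thesis using x KK(6) bM by simp
      next
        case False
        then have "x \<notin> F (p + 1)" using c(2) by blast
        then have "q \<le> p" using F_anti[of "p + 1" q] x by force
        then have "b \<in> F q" using b F_anti by blast
        then show ?thesis using x subspD[OF F] by simp
      qed
      then show ?thesis using fr r[OF x(1)] False j by (simp add: biframe_def c''_def d''_def)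
    qed
  next
    fix x m j assume x: "x \<in> K" "x \<in> W m" and j: "j < Suc N" "m < n'' j"
    show "c'' j x = 0"
    proof (cases "j = N")
      case True then show ?thesis using small(1)[OF x] j by (simp add: c''_def n''_def)
    next
      case False
      have "?r x \<in> W m"
      proof (cases "m < n")
        case True then show ?thesis using small[OF x True] subspD(2)[OF W] x bM by simp
      next
        case False
        then have "b \<in> W m" using b W_mono[of n m] by auto
        then show ?thesis using x subspD[OF W] by simp
      qed
      then show ?thesis using fr r[OF x(1)] False j by (simp add: biframe_def c''_def n''_def)
    qed
  qed
  then show "\<exists>N b c d n. biframe M F W K N b c d n" by blast
qed

lemma frame_map_lin:
  assumes "vsp M" "vsp M'" and c: "\<And>j. j < N \<Longrightarrow> functional M (c j)" and y: "\<And>j. j < N \<Longrightarrow> y j \<in> carrier M'"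
  shows "(\<lambda>x. \<Oplus>\<^bsub>M'\<^esub>j\<in>{..<N}. c j x \<odot>\<^bsub>M'\<^esub> y j) \<in> lin M M'"
proof -
  interpret A: vsp M by fact
  interpret B: vsp M' by fact
  show ?thesis
  proof (rule linI)
    fix x assume x: "x \<in> carrier M"
    show "(\<Oplus>\<^bsub>M'\<^esub>j\<in>{..<N}. c j x \<odot>\<^bsub>M'\<^esub> y j) \<in> carrier M'" by (rule B.finsum_closed) (use y in auto)
    show "(\<Oplus>\<^bsub>M'\<^esub>j\<in>{..<N}. c j (r \<odot>\<^bsub>M\<^esub> x) \<odot>\<^bsub>M'\<^esub> y j) = r \<odot>\<^bsub>M'\<^esub> (\<Oplus>\<^bsub>M'\<^esub>j\<in>{..<N}. c j x \<odot>\<^bsub>M'\<^esub> y j)" for r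
    proof -
      interpret r: linmap M' M' "\<lambda>x. r \<odot>\<^bsub>M'\<^esub> x"
        by unfold_locales (auto intro!: linI simp: B.smult_radd B.smult_smult mult.commute)
      have "(\<Oplus>\<^bsub>M'\<^esub>j\<in>{..<N}. c j (r \<odot>\<^bsub>M\<^esub> x) \<odot>\<^bsub>M'\<^esub> y j) = (\<Oplus>\<^bsub>M'\<^esub>j\<in>{..<N}. r \<odot>\<^bsub>M'\<^esub> (c j x \<odot>\<^bsub>M'\<^esub> y j))"
        by (rule B.finsum_cong') (use y in \<open>auto simp: A.functional_smult[OF c x] B.smult_smult\<close>)
      also have "\<dots> = r \<odot>\<^bsub>M'\<^esub> (\<Oplus>\<^bsub>M'\<^esub>j\<in>{..<N}. c j x \<odot>\<^bsub>M'\<^esub> y j)"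
        by (rule r.finsum[symmetric]) (use y in auto)
      finally show ?thesis .
    qed
    fix x' assume x': "x' \<in> carrier M"
    have "(\<Oplus>\<^bsub>M'\<^esub>j\<in>{..<N}. c j (x \<oplus>\<^bsub>M\<^esub> x') \<odot>\<^bsub>M'\<^esub> y j) = (\<Oplus>\<^bsub>M'\<^esub>j\<in>{..<N}. c j x \<odot>\<^bsub>M'\<^esub> y j \<oplus>\<^bsub>M'\<^esub> c j x' \<odot>\<^bsub>M'\<^esub> y j)"
      by (rule B.finsum_cong') (use y in \<open>auto simp: A.functional_add[OF c x x'] B.smult_ladd\<close>)
    also have "\<dots> = (\<Oplus>\<^bsub>M'\<^esub>j\<in>{..<N}. c j x \<odot>\<^bsub>M'\<^esub> y j) \<oplus>\<^bsub>M'\<^esub> (\<Oplus>\<^bsub>M'\<^esub>j\<in>{..<N}. c j x' \<odot>\<^bsub>M'\<^esub> y j)"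
      by (rule B.finsum_addf) (use y in auto)
    finally show "(\<Oplus>\<^bsub>M'\<^esub>j\<in>{..<N}. c j (x \<oplus>\<^bsub>M\<^esub> x') \<odot>\<^bsub>M'\<^esub> y j) = \<dots>" .
  qed
qed

section \<open>Linearity over \<open>\<S>\<close>\<close>

locale rvsp = vsp M for M :: "(real, 'a, 'm) module_scheme" (structure)

sublocale rvsp \<subseteq> S: vsp "S_vs M" by (rule vsp_S_vs) (rule is_vsp)
sublocale rvsp \<subseteq> C: vsp "cplx M" by (rule vsp_cplx) (rule is_vsp)
sublocale rvsp \<subseteq> CS: vsp "cplx (S_vs M)" by (rule vsp_cplx) (rule S.is_vsp)

lemma rvspI: "vsp M \<Longrightarrow> rvsp M" by (simp add: rvsp_def)

lemma cplx_finitely_generated: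
  fixes V :: "(real, 'a, 'm) module_scheme"
  assumes "vsp V" "finite A" "A \<subseteq> carrier V" "LinearCombinations.module.span class_ring V A = carrier V"
  shows "\<exists>G. finite G \<and> G \<subseteq> carrier (cplx V) \<and> LinearCombinations.module.span class_ring (cplx V) G = carrier (cplx V)"
proof -
  interpret rvsp V by (rule rvspI) fact
  let ?G = "(\<lambda>a. (a, \<zero>\<^bsub>V\<^esub>)) ` A"
  have G: "?G \<subseteq> carrier (cplx V)" using assms(3) by auto
  note SS = C.subspD[OF C.span_subsp[OF G]]
  let ?S = "LinearCombinations.module.span class_ring (cplx V) ?G"
  \<comment> \<open>real generators generate the complexification: the real vectors in their
    complex span form a real subspace\<close>
  have "subsp {v \<in> carrier V. (v, \<zero>\<^bsub>V\<^esub>) \<in> ?S} V"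
    unfolding subsp_iff
  proof (intro conjI ballI allI)
    show "{v \<in> carrier V. (v, \<zero>\<^bsub>V\<^esub>) \<in> ?S} \<subseteq> carrier V" by blast
    show "\<zero>\<^bsub>V\<^esub> \<in> {v \<in> carrier V. (v, \<zero>\<^bsub>V\<^esub>) \<in> ?S}" using SS(2) by simp
    fix x assume x: "x \<in> {v \<in> carrier V. (v, \<zero>\<^bsub>V\<^esub>) \<in> ?S}"
    show "r \<odot>\<^bsub>V\<^esub> x \<in> {v \<in> carrier V. (v, \<zero>\<^bsub>V\<^esub>) \<in> ?S}" for r
      using x SS(4)[of "(x, \<zero>\<^bsub>V\<^esub>)" "of_real r"] by simp
    fix y assume y: "y \<in> {v \<in> carrier V. (v, \<zero>\<^bsub>V\<^esub>) \<in> ?S}"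
    show "x \<oplus>\<^bsub>V\<^esub> y \<in> {v \<in> carrier V. (v, \<zero>\<^bsub>V\<^esub>) \<in> ?S}"
      using x y SS(3)[of "(x, \<zero>\<^bsub>V\<^esub>)" "(y, \<zero>\<^bsub>V\<^esub>)"] by simp
  qed
  moreover have "A \<subseteq> {v \<in> carrier V. (v, \<zero>\<^bsub>V\<^esub>) \<in> ?S}"
    using C.span_superset[OF G] assms(3) by blast
  ultimately have real: "(v, \<zero>\<^bsub>V\<^esub>) \<in> ?S" if "v \<in> carrier V" for v
    using span_least[of A] that assms(4) by blast
  have "(u, v) \<in> ?S" if "u \<in> carrier V" "v \<in> carrier V" for u v
  proof -
    have "(u, v) = (u, \<zero>\<^bsub>V\<^esub>) \<oplus>\<^bsub>cplx V\<^esub> (\<i> \<odot>\<^bsub>cplx V\<^esub> (v, \<zero>\<^bsub>V\<^esub>))" using that by (simp add: minus_eq)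
    then show ?thesis using SS(3)[OF real[OF that(1)] SS(4)[OF real[OF that(2)], of \<i>]] by (simp only:)
  qed
  then have "?S = carrier (cplx V)" using SS(1) by auto
  then show ?thesis using assms(2) G by blast
qed

definition shift :: "(real, 'a, 'm) module_scheme \<Rightarrow> (nat \<Rightarrow> 'a) \<Rightarrow> nat \<Rightarrow> 'a" where
  "shift M f k = (case k of 0 \<Rightarrow> \<zero>\<^bsub>M\<^esub> | Suc j \<Rightarrow> f j)"

text \<open>
  \<open>\<S>\<close>-linear maps: the ring \<open>\<S> = \<real>[x]\<close> is generated by \<open>x\<close>, which acts by the shift.
\<close>

definition S_lin :: "(real, 'a, 'm) module_scheme \<Rightarrow> (real, 'b, 'n) module_scheme \<Rightarrow> ((nat \<Rightarrow> 'a) \<Rightarrow> nat \<Rightarrow> 'b) set" where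
  "S_lin M M' = {h \<in> lin (S_vs M) (S_vs M'). \<forall>f\<in>carrier (S_vs M). h (shift M f) = shift M' (h f)}"

context rvsp begin

lemma shift_closed [simp, intro]: assumes "f \<in> carrier (S_vs M)" shows "shift M f \<in> carrier (S_vs M)"
proof -
  obtain N where "\<And>k. k \<ge> N \<Longrightarrow> f k = \<zero>" using S_vs_bound[OF assms] by metis
  then show ?thesis using assms by (intro S_vs_carrierI[of _ _ "Suc N"]) (auto simp: shift_def split: nat.split)
qed

lemma S_smult_0: "f \<in> carrier (S_vs M) \<Longrightarrow> 0 \<odot>\<^bsub>S_module M\<^esub> f = \<zero>\<^bsub>S_vs M\<^esub>"
  by (auto intro!: ext simp: S_vs_nth cong: finsum_cong')

lemma S_smult_pCons:
  assumes f: "f \<in> carrier (S_vs M)"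
  shows "pCons a s \<odot>\<^bsub>S_module M\<^esub> f = a \<odot>\<^bsub>S_vs M\<^esub> f \<oplus>\<^bsub>S_vs M\<^esub> shift M (s \<odot>\<^bsub>S_module M\<^esub> f)"
proof
  fix n show "(pCons a s \<odot>\<^bsub>S_module M\<^esub> f) n = (a \<odot>\<^bsub>S_vs M\<^esub> f \<oplus>\<^bsub>S_vs M\<^esub> shift M (s \<odot>\<^bsub>S_module M\<^esub> f)) n"
  proof (cases n)
    case 0 then show ?thesis using f by (simp add: shift_def S_vs_nth)
  next
    case (Suc m)
    have "(\<Oplus>k\<in>{..Suc m}. coeff (pCons a s) k \<odot> f (Suc m - k)) =
      (\<Oplus>k\<in>{..m}. coeff s k \<odot> f (m - k)) \<oplus> a \<odot> f (Suc m)"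
      using f by (subst finsum_Suc2) (auto simp: S_vs_nth)
    then show ?thesis using Suc f by (simp add: shift_def S_vs_nth a_comm finsum_closed Pi_def)
  qed
qed

lemma S_smult_closed [simp, intro]:
  "f \<in> carrier (S_vs M) \<Longrightarrow> s \<odot>\<^bsub>S_module M\<^esub> f \<in> carrier (S_vs M)"
proof (induction s)
  case 0 then show ?case using S_smult_0 S.zero_closed by metis
next
  case (pCons a s)
  then show ?case unfolding S_smult_pCons[OF pCons(3)] by (intro S.add.m_closed S.scl shift_closed)
qed

lemma S_smult_const: "f \<in> carrier (S_vs M) \<Longrightarrow> [:r:] \<odot>\<^bsub>S_module M\<^esub> f = r \<odot>\<^bsub>S_vs M\<^esub> f"
  unfolding S_smult_pCons S_smult_0 by (auto intro!: ext simp: shift_def S_vs_nth split: nat.split)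

lemma S_smult_x: "f \<in> carrier (S_vs M) \<Longrightarrow> [:0, 1:] \<odot>\<^bsub>S_module M\<^esub> f = shift M f"
  unfolding S_smult_pCons[of f 0 "[:1:]"] S_smult_const[of f 1] 
  by (auto intro!: ext simp: shift_def S_vs_nth split: nat.split)

lemma shift_tens: "v \<in> carrier M \<Longrightarrow> shift M (tens M v s) = tens M v (pCons 0 s)"
  by (auto intro!: ext simp: tens_def shift_def coeff_pCons split: nat.split)

lemma shift_lin: "shift M \<in> lin (S_vs M) (S_vs M)"
  by (rule linI) (auto intro!: ext simp: shift_def split: nat.split)

lemma S_smult_tens: "v \<in> carrier M \<Longrightarrow> s \<odot>\<^bsub>S_module M\<^esub> tens M v t = tens M v (s * t)"
proof (induction s)
  case 0 then show ?case using S_smult_0[OF tens_closed[OF is_vsp]] tens_zero_right[OF is_vsp] by simp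
next
  case (pCons a s)
  note [simp del] = S_vs_simps S_module_simps
  have "pCons a s \<odot>\<^bsub>S_module M\<^esub> tens M v t = tens M v (Polynomial.smult a t) \<oplus>\<^bsub>S_vs M\<^esub> tens M v (pCons 0 (s * t))"
    using pCons by (simp add: S_smult_pCons tens_closed is_vsp shift_tens tens_smult_right)
  then show ?case using pCons by (simp add: tens_add_right[OF is_vsp, symmetric])
qed

end

lemma S_hom_iff:
  assumes "vsp M" "vsp M'"
  shows "h \<in> lin (S_module M) (S_module M') \<longleftrightarrow> h \<in> S_lin M M'"
proof -
  interpret A: rvsp M using assms by (simp add: rvspI)
  interpret B: rvsp M' using assms by (simp add: rvspI)
  note [simp del] = S_vs_simps S_module_simps
  note simps = S_module_simps(1)
  have add: "add (S_module K) = add (S_vs K)" for K :: "(real, 'x, 'y) module_scheme" by (intro ext) (simp add: S_vs_simps S_module_simps)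
  show ?thesis
  proof
    assume h: "h \<in> lin (S_module M) (S_module M')"
    then have cl: "f \<in> carrier (S_vs M) \<Longrightarrow> h f \<in> carrier (S_vs M')" for f
      by (auto simp: LinearCombinations.module_hom_def simps)
    have sm: "f \<in> carrier (S_vs M) \<Longrightarrow> h (s \<odot>\<^bsub>S_module M\<^esub> f) = s \<odot>\<^bsub>S_module M'\<^esub> h f" for s f
      using h by (simp add: LinearCombinations.module_hom_def simps)
    have "h \<in> lin (S_vs M) (S_vs M')"
    proof (rule linI)
      show "h (f \<oplus>\<^bsub>S_vs M\<^esub> g) = h f \<oplus>\<^bsub>S_vs M'\<^esub> h g" if "f \<in> carrier (S_vs M)" "g \<in> carrier (S_vs M)" for f g
        using h that by (simp add: LinearCombinations.module_hom_def simps add)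
      show "h (c \<odot>\<^bsub>S_vs M\<^esub> f) = c \<odot>\<^bsub>S_vs M'\<^esub> h f" if "f \<in> carrier (S_vs M)" for c f
        using sm[OF that, of "[:c:]"] that cl by (simp add: A.S_smult_const B.S_smult_const)
    qed (rule cl)
    moreover have "h (shift M f) = shift M' (h f)" if "f \<in> carrier (S_vs M)" for f
      using sm[OF that, of "[:0, 1:]"] that cl by (simp add: A.S_smult_x B.S_smult_x)
    ultimately show "h \<in> S_lin M M'" by (simp add: S_lin_def)
  next
    assume h: "h \<in> S_lin M M'"
    then interpret h: linmap "S_vs M" "S_vs M'" h by unfold_locales (simp add: S_lin_def)
    have sm: "h (s \<odot>\<^bsub>S_module M\<^esub> f) = s \<odot>\<^bsub>S_module M'\<^esub> h f" if "f \<in> carrier (S_vs M)" for s f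
    proof (induction s)
      case 0 then show ?case using that by (simp add: A.S_smult_0 B.S_smult_0 h.zero)
    next
      case (pCons a s)
      then show ?case using h that
        by (simp add: A.S_smult_pCons B.S_smult_pCons h.add h.smult S_lin_def)
    qed
    show "h \<in> lin (S_module M) (S_module M')"
      by (rule linI) (auto simp: simps add sm h.add)
  qed
qed

text \<open>
  Every element of \<open>M[x]\<close> arises from constants by additions and shifts.
\<close>

lemma S_lin_eqI:
  assumes "vsp M" "vsp M'" "h \<in> S_lin M M'" "h' \<in> S_lin M M'"
    and eq: "\<And>v. v \<in> carrier M \<Longrightarrow> h (tens M v 1) = h' (tens M v 1)" and f: "f \<in> carrier (S_vs M)"
  shows "h f = h' f"
proof -
  interpret A: rvsp M using assms by (simp add: rvspI)
  interpret B: rvsp M' using assms by (simp add: rvspI)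
  interpret h: linmap "S_vs M" "S_vs M'" h using assms(3) by unfold_locales (simp add: S_lin_def)
  interpret h': linmap "S_vs M" "S_vs M'" h' using assms(4) by unfold_locales (simp add: S_lin_def)
  have "h f = h' f" if "f \<in> carrier (S_vs M)" "\<forall>k\<ge>N. f k = \<zero>\<^bsub>M\<^esub>" for N f
    using that
  proof (induction N arbitrary: f)
    case 0
    then have "f = \<zero>\<^bsub>S_vs M\<^esub>" by auto
    then show ?case using h.zero h'.zero by simp
  next
    case (Suc N)
    define g where "g = (\<lambda>k. f (Suc k))"
    have g: "g \<in> carrier (S_vs M)" using Suc by (intro S_vs_carrierI[of _ _ N]) (auto simp: g_def)
    have f: "f = tens M (f 0) 1 \<oplus>\<^bsub>S_vs M\<^esub> shift M g"
      using Suc(2) by (auto intro!: ext simp: tens_def shift_def g_def coeff_1 split: nat.split)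
    have "h (shift M g) = h' (shift M g)"
      using Suc(1)[OF g] Suc(3) assms(3,4) g by (simp add: S_lin_def g_def)
    then have "h (tens M (f 0) 1 \<oplus>\<^bsub>S_vs M\<^esub> shift M g) = h' (tens M (f 0) 1 \<oplus>\<^bsub>S_vs M\<^esub> shift M g)"
      using Suc(2) g by (simp add: h.add h'.add eq tens_closed A.is_vsp del: S_vs_simps)
    then show ?case using f by metis
  qed
  then show ?thesis using f S_vs_bound[OF f] by metis
qed

lemma S_lin_compose: "vsp M' \<Longrightarrow> g \<in> S_lin M' M'' \<Longrightarrow> f \<in> S_lin M M' \<Longrightarrow> (\<lambda>x. g (f x)) \<in> S_lin M M''"
  by (auto simp: S_lin_def lin_compose LinearCombinations.module_hom_def Pi_def)

lemma S_lin_of_lin: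
  assumes "vsp M" "vsp M'" "A \<in> lin M M'"
  shows "(\<lambda>f k. A (f k)) \<in> S_lin M M'"
proof -
  interpret A: linmap M M' A using assms by (simp add: linmap_def linmap_axioms_def)
  have "(\<lambda>k. A (f k)) \<in> carrier (S_vs M')" if f: "f \<in> carrier (S_vs M)" for f
  proof -
    obtain N where "\<And>k. k \<ge> N \<Longrightarrow> f k = \<zero>\<^bsub>M\<^esub>" using S_vs_bound[OF f] by metis
    then show ?thesis using f by (intro S_vs_carrierI[of _ _ N]) auto
  qed
  then show ?thesis unfolding S_lin_def 
    by (auto intro!: linI ext simp: A.add A.smult shift_def split: nat.split)
qed

lemma S_lin_add:
  assumes "vsp M" "vsp M'" "g \<in> S_lin M M'" "h \<in> S_lin M M'"
  shows "(\<lambda>f. g f \<oplus>\<^bsub>S_vs M'\<^esub> h f) \<in> S_lin M M'"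
proof -
  interpret A: rvsp M using assms by (simp add: rvspI)
  interpret B: rvsp M' using assms by (simp add: rvspI)
  interpret g: linmap "S_vs M" "S_vs M'" g using assms(3) by unfold_locales (simp add: S_lin_def)
  interpret h: linmap "S_vs M" "S_vs M'" h using assms(4) by unfold_locales (simp add: S_lin_def)
  interpret sh: linmap "S_vs M'" "S_vs M'" "shift M'" by unfold_locales (rule B.shift_lin)
  show ?thesis using assms(3,4) unfolding S_lin_def
    by (auto intro!: linI simp: g.add h.add g.smult h.smult B.S.a_ac B.S.smult_radd sh.add simp del: S_vs_simps)
qed

lemma S_lin_smult:
  assumes "vsp M" shows "(\<lambda>f. s \<odot>\<^bsub>S_module M\<^esub> f) \<in> S_lin M M"
proof (induction s)
  interpret A: rvsp M using assms by (simp add: rvspI)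
  interpret sh: linmap "S_vs M" "S_vs M" "shift M" by unfold_locales (rule A.shift_lin)
  note [simp del] = S_vs_simps S_module_simps
  { case 0 show ?case
      by (auto intro!: linI simp: S_lin_def A.S_smult_0 sh.zero) }
  { case (pCons a s)
    then interpret s: linmap "S_vs M" "S_vs M" "\<lambda>f. s \<odot>\<^bsub>S_module M\<^esub> f" by unfold_locales (simp add: S_lin_def)
    show ?case using pCons
      by (auto intro!: linI simp: S_lin_def A.S_smult_pCons sh.add sh.smult s.add s.smult A.S.a_ac A.S.smult_radd A.S.smult_smult mult.commute) }
qed

lemma S_lin_restrict: "vsp M \<Longrightarrow> h \<in> S_lin M M' \<Longrightarrow> restrict h (carrier (S_vs M)) \<in> S_lin M M'"
proof -
  assume "vsp M" and h: "h \<in> S_lin M M'"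
  interpret A: rvsp M by (rule rvspI) fact
  show ?thesis using h by (auto simp: S_lin_def LinearCombinations.module_hom_def simp del: S_vs_simps)
qed

section \<open>Filtrations on tensor products with \<open>\<S>\<close>\<close>

text \<open>
  The isomorphism of \<open>\<S> \<otimes> \<complex>\<close> with \<open>\<complex>[x]\<close>, and the multiplication that it induces on pairs.
\<close>

definition cpoly :: "real poly \<times> real poly \<Rightarrow> complex poly" where
  "cpoly w = map_poly complex_of_real (fst w) + Polynomial.smult \<i> (map_poly complex_of_real (snd w))"

definition cpmult :: "real poly \<times> real poly \<Rightarrow> real poly \<times> real poly \<Rightarrow> real poly \<times> real poly" where
  "cpmult w z = (fst w * fst z - snd w * snd z, fst w * snd z + snd w * fst z)"

lemma coeff_cpoly: "coeff (cpoly w) n = Complex (coeff (fst w) n) (coeff (snd w) n)"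
  by (simp add: cpoly_def coeff_map_poly complex_eq_iff)

lemma cpoly_mult: "cpoly (cpmult w z) = cpoly w * cpoly z"
  by (rule poly_eqI)
    (simp add: coeff_cpoly coeff_mult cpmult_def complex_eq_iff Re_sum Im_sum sum_subtractf sum.distrib)

lemma Ffil_S_ring: "w \<in> Ffil S_ring p \<longleftrightarrow> [:- \<i>, 1:] ^ nat p dvd cpoly w"
  by (cases w) (simp add: S_ring_def cpoly_def)

lemma Wfil_S_ring: "Wfil S_ring n = (if n \<ge> 0 then UNIV else {0})"
  by (simp add: S_ring_def)

lemma one_in_Ffil_S: "(1, 0) \<in> Ffil S_ring 0"
  by (simp add: Ffil_S_ring)

lemma cpmult_in_Ffil_S:
  assumes "w \<in> Ffil S_ring p" "z \<in> Ffil S_ring q" shows "cpmult w z \<in> Ffil S_ring (p + q)"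
proof -
  have "[:- \<i>, 1:] ^ (nat p + nat q) dvd cpoly w * cpoly z"
    using assms by (simp add: Ffil_S_ring power_add mult_dvd_mono)
  moreover have "nat (p + q) \<le> nat p + nat q" by simp
  ultimately show ?thesis unfolding Ffil_S_ring cpoly_mult by (meson dvd_trans le_imp_power_dvd)
qed

text \<open>
  Two filtrations by subspaces, without any finiteness, so that \<open>V\<close>, \<open>gr V\<close>, their tensor products
  with \<open>\<S>\<close>, and endomorphism spaces are all covered.
\<close>

locale fvs =
  fixes V :: "'a qmhs" (structure)
  assumes vs: "vsp V"
    and W_sub: "\<And>n. subsp (Wfil V n) V" and W_mono: "\<And>m n. m \<le> n \<Longrightarrow> Wfil V m \<subseteq> Wfil V n"
    and F_sub: "\<And>p. subsp (Ffil V p) (cplx V)"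

sublocale fvs \<subseteq> rvsp V by (rule rvspI) (rule vs)

context fvs begin

lemma Wfil_carrier: "v \<in> Wfil V n \<Longrightarrow> v \<in> carrier V"
  using subspD(6)[OF W_sub] .

lemma Ffil_carrier: "z \<in> Ffil V p \<Longrightarrow> z \<in> carrier (cplx V)"
  using C.subspD(6)[OF F_sub] .

lemma gen_sub: "(\<Union>a. {ctens V z w | z w. z \<in> Ffil V a \<and> w \<in> Ffil S_ring (p - a)}) \<subseteq> carrier (cplx (S_vs V))"
  using ctens_closed[OF vs Ffil_carrier] by blast

lemma Ffil_tensor_gen:
  assumes "z \<in> Ffil V a" "w \<in> Ffil S_ring (p - a)" shows "ctens V z w \<in> Ffil (tensor_S V) p"
  using CS.span_superset[OF gen_sub] assms unfolding Ffil_tensor_S by blast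

lemma Ffil_tensor_sub: "subsp (Ffil (tensor_S V) p) (cplx (S_vs V))"
  unfolding Ffil_tensor_S by (rule CS.span_subsp[OF gen_sub])

text \<open>
  \<open>F\<^sup>p(V \<otimes> \<S>)\<close> is a span, so a linear map is controlled on it by its values at pure tensors.
\<close>

lemma Ffil_tensor_image:
  assumes "vsp X" "h \<in> lin (cplx (S_vs V)) X" "subsp Y X"
    and "\<And>a z w. z \<in> Ffil V a \<Longrightarrow> w \<in> Ffil S_ring (p - a) \<Longrightarrow> h (ctens V z w) \<in> Y"
  shows "h ` Ffil (tensor_S V) p \<subseteq> Y"
proof -
  interpret h: linmap "cplx (S_vs V)" X h
    using assms(1,2) CS.is_vsp by (simp add: linmap_def linmap_axioms_def)
  show ?thesis unfolding Ffil_tensor_S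
    by (rule h.span_image_subset[OF gen_sub _ assms(3)]) (use assms(4) in blast)
qed

text \<open>
  On \<open>\<S>\<close> the weight filtration jumps only at \<open>0\<close>, so \<open>W\<^sub>n(V \<otimes> \<S>) = W\<^sub>n V \<otimes> \<S>\<close>.  For the inclusion from
  right to left, an element of \<open>V[x]\<close> is built up from constants and shifts.
\<close>

lemma Wfil_tensor: "Wfil (tensor_S V) n = {f \<in> carrier (S_vs V). \<forall>k. f k \<in> Wfil V n}" (is "?L = ?R")
proof
  let ?A = "\<Union>a. {tens V v s | v s. v \<in> Wfil V a \<and> s \<in> Wfil S_ring (n - a)}"
  note WW = subspD[OF W_sub]
  have R: "subsp ?R (S_vs V)"
    unfolding S.subsp_iff using WW by (auto intro: S.add.m_closed S.scl simp del: S_vs_simps) (auto simp: S_vs_simps)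
  have AR: "?A \<subseteq> ?R"
  proof safe
    fix a v s assume v: "v \<in> Wfil V a" and s: "s \<in> Wfil S_ring (n - a)"
    show "tens V v s \<in> carrier (S_vs V)" using v WW vs by blast
    show "tens V v s k \<in> Wfil V n" for k
    proof (cases "a \<le> n")
      case True then show ?thesis using W_mono[OF True] v WW by (auto simp: tens_def)
    next
      case False then show ?thesis using s v WW by (auto simp: tens_def Wfil_S_ring)
    qed
  qed
  show "?L \<subseteq> ?R" unfolding Wfil_tensor_S' by (rule S.span_least[OF AR R])
  have A: "?A \<subseteq> carrier (S_vs V)" using AR by blast
  note SS = S.subspD[OF S.span_subsp[OF A]]
  have mono: "tens V v s \<in> ?L" if "v \<in> Wfil V n" for v s
    using S.span_superset[OF A] that unfolding Wfil_tensor_S' by (force simp: Wfil_S_ring)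
  interpret sh: linmap "S_vs V" "S_vs V" "shift V" by unfold_locales (rule shift_lin)
  \<comment> \<open>multiplication by \<open>x\<close> preserves the generators and hence their
    span\<close>
  have sh: "shift V ` ?L \<subseteq> ?L" unfolding Wfil_tensor_S'
  proof (rule sh.span_image_subset[OF A _ S.span_subsp[OF A]])
    have "shift V ` ?A \<subseteq> ?A"
    proof safe
      fix a v s assume v: "v \<in> Wfil V a" and s: "s \<in> Wfil S_ring (n - a)"
      have "shift V (tens V v s) = tens V v (pCons 0 s)" using v WW by (intro shift_tens) blast
      moreover have "pCons 0 s \<in> Wfil S_ring (n - a)" using s by (auto simp: Wfil_S_ring split: if_splits)
      ultimately show "shift V (tens V v s) \<in> ?A" using v by blast
    qed
    then show "shift V ` ?A \<subseteq> LinearCombinations.module.span class_ring (S_vs V) ?A"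
      using S.span_superset[OF A] by (rule order.trans)
  qed
  show "?R \<subseteq> ?L"
  proof safe
    fix f assume f: "f \<in> carrier (S_vs V)" "\<forall>k. f k \<in> Wfil V n"
    have "f \<in> ?L" if "f \<in> carrier (S_vs V)" "\<forall>k. f k \<in> Wfil V n" "\<forall>k\<ge>N. f k = \<zero>" for N f
      using that
    proof (induction N arbitrary: f)
      case 0
      then have "f = \<zero>\<^bsub>S_vs V\<^esub>" by auto
      then show ?case using SS(2) unfolding Wfil_tensor_S' by simp
    next
      case (Suc N)
      define g where "g = (\<lambda>k. f (Suc k))"
      have "g \<in> carrier (S_vs V)" using Suc by (intro S_vs_carrierI[of _ _ N]) (auto simp: g_def)
      then have "g \<in> ?L" using Suc by (intro Suc.IH) (auto simp: g_def)
      moreover have f: "f = tens V (f 0) 1 \<oplus>\<^bsub>S_vs V\<^esub> shift V g"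
        using Suc(2) by (auto intro!: ext simp: tens_def shift_def g_def coeff_1 split: nat.split)
      ultimately show ?case using SS(3)[OF mono[unfolded Wfil_tensor_S', of "f 0" 1]] sh Suc(3)
        unfolding Wfil_tensor_S' by (metis (no_types, lifting) image_subset_iff)
    qed
    then show "f \<in> ?L" using f S_vs_bound[OF f(1)] by metis
  qed
qed

lemma tensor_fvs: "fvs (tensor_S V)"
proof -
  have vT: "vsp (tensor_S V)" by (rule vsp_tensor_S[OF vs])
  interpret T: vsp "tensor_S V" by (rule vT)
  show ?thesis
  proof (rule fvs.intro)
    show "vsp (tensor_S V)" by (rule vT)
    show "subsp (Wfil (tensor_S V) n) (tensor_S V)" for n
      unfolding T.subsp_iff Wfil_tensor using subspD[OF W_sub] 
      by (auto intro: S.add.m_closed S.scl simp del: S_vs_simps) (auto simp: S_vs_simps)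
    show "Wfil (tensor_S V) m \<subseteq> Wfil (tensor_S V) n" if "m \<le> n" for m n
      using W_mono[OF that] by (auto simp: Wfil_tensor)
    show "subsp (Ffil (tensor_S V) p) (cplx (tensor_S V))" for p
      using Ffil_tensor_sub by simp
  qed
qed

end

section \<open>Endomorphisms\<close>

lemma End_simps:
  "carrier (End_qmhs U) = lin U U \<inter> extensional (carrier U)"
  "\<zero>\<^bsub>End_qmhs U\<^esub> = (\<lambda>x\<in>carrier U. \<zero>\<^bsub>U\<^esub>)"
  "f \<oplus>\<^bsub>End_qmhs U\<^esub> g = (\<lambda>x\<in>carrier U. f x \<oplus>\<^bsub>U\<^esub> g x)"
  "r \<odot>\<^bsub>End_qmhs U\<^esub> f = (\<lambda>x\<in>carrier U. r \<odot>\<^bsub>U\<^esub> f x)"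
  "Wfil (End_qmhs U) n = {f \<in> lin U U \<inter> extensional (carrier U). \<forall>k. f ` Wfil U k \<subseteq> Wfil U (k + n)}"
  "Ffil (End_qmhs U) p = {(f, g). f \<in> lin U U \<inter> extensional (carrier U) \<and> g \<in> lin U U \<inter> extensional (carrier U) \<and>
          (\<forall>q. (\<lambda>(u, v). (f u \<ominus>\<^bsub>U\<^esub> g v, f v \<oplus>\<^bsub>U\<^esub> g u)) ` Ffil U q \<subseteq> Ffil U (q + p))}"
  by (auto simp: End_qmhs_def Let_def)

locale endo = rvsp U for U :: "'a qmhs" (structure)
begin

lemma End_app:
  assumes "A \<in> carrier (End_qmhs U)"
  shows End_closed: "x \<in> carrier U \<Longrightarrow> A x \<in> carrier U"
    and "x \<in> carrier U \<Longrightarrow> y \<in> carrier U \<Longrightarrow> A (x \<oplus> y) = A x \<oplus> A y"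
    and End_smult: "x \<in> carrier U \<Longrightarrow> A (r \<odot> x) = r \<odot> A x"
    and End_zero: "A \<zero> = \<zero>"
    and End_ext: "x \<notin> carrier U \<Longrightarrow> A x = undefined"
proof -
  interpret A: linmap U U A using assms by unfold_locales (simp add: End_simps)
  show "x \<in> carrier U \<Longrightarrow> A x \<in> carrier U" "x \<in> carrier U \<Longrightarrow> y \<in> carrier U \<Longrightarrow> A (x \<oplus> y) = A x \<oplus> A y"
   "x \<in> carrier U \<Longrightarrow> A (r \<odot> x) = r \<odot> A x" "A \<zero> = \<zero>"
    by (auto simp: A.add A.smult)
  show "x \<notin> carrier U \<Longrightarrow> A x = undefined" using assms by (auto simp: End_simps extensional_def)
qed

lemma EndI:
  assumes "\<And>x. x \<in> carrier U \<Longrightarrow> A x \<in> carrier U"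
    "\<And>x y. x \<in> carrier U \<Longrightarrow> y \<in> carrier U \<Longrightarrow> A (x \<oplus> y) = A x \<oplus> A y"
    "\<And>x r. x \<in> carrier U \<Longrightarrow> A (r \<odot> x) = r \<odot> A x"
  shows "(\<lambda>x\<in>carrier U. A x) \<in> carrier (End_qmhs U)"
  using assms by (auto intro!: linI simp: End_simps)

lemma vsp_End: "vsp (End_qmhs U)"
proof (rule vspI, goal_cases)
  case 1 show ?case unfolding End_simps(2) by (rule EndI) auto
next
  case (2 x y)
  show ?case unfolding End_simps(3)
    by (rule EndI) (auto simp: End_app[OF 2(1)] End_app[OF 2(2)] a_ac smult_radd)
next
  case (3 c x)
  show ?case unfolding End_simps(4)
    by (rule EndI) (auto simp: End_app[OF 3] smult_smult smult_radd mult.commute)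
qed (auto intro!: ext simp: End_simps(2-4) End_closed a_ac smult_smult smult_ladd smult_radd End_ext restrict_def)

end

sublocale endo \<subseteq> E: rvsp "End_qmhs U" by (rule rvspI) (rule vsp_End)

context endo begin

lemma act_closed:
  assumes e: "e \<in> carrier (S_vs (End_qmhs U))" and f: "f \<in> carrier (S_vs U)"
  shows "End_act U e f \<in> carrier (S_vs U)"
proof -
  obtain N where N: "\<And>k. k \<ge> N \<Longrightarrow> e k = \<zero>\<^bsub>End_qmhs U\<^esub>" using S_vs_bound[OF e] by metis
  obtain N' where N': "\<And>k. k \<ge> N' \<Longrightarrow> f k = \<zero>" using S_vs_bound[OF f] by metis
  have e': "e k \<in> carrier (End_qmhs U)" for k by (rule S_vs_nth[OF e])
  show ?thesis
  proof (rule S_vs_carrierI)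
    show "End_act U e f k \<in> carrier U" for k
      unfolding End_act_def by (intro finsum_closed Pi_I End_closed[OF e'] S_vs_nth[OF f])
    show "End_act U e f n = \<zero>" if n: "n \<ge> N + N'" for n
    proof -
      have "e k (f (n - k)) = \<zero>" if "k \<le> n" for k
      proof (cases "k \<ge> N")
        case True then show ?thesis using N[OF True] f by (simp add: End_simps S_vs_nth)
      next
        case False then show ?thesis using N'[of "n - k"] n by (simp add: End_zero[OF e'])
      qed
      then have "End_act U e f n = (\<Oplus>k\<in>{..n}. \<zero>)"
        unfolding End_act_def by (intro finsum_cong') auto
      then show ?thesis by simp
    qed
  qed
qed

lemma act_S_lin:
  assumes e: "e \<in> carrier (S_vs (End_qmhs U))"
  shows "End_act U e \<in> S_lin U U"
proof -
  have e': "e k \<in> carrier (End_qmhs U)" for k by (rule S_vs_nth[OF e])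
  note ee = End_app[OF e']
  show ?thesis unfolding S_lin_def
  proof (safe intro!: linI)
    fix f assume f: "f \<in> carrier (S_vs U)"
    show "End_act U e f \<in> carrier (S_vs U)" by (rule act_closed[OF e f])
    show "End_act U e (f \<oplus>\<^bsub>S_vs U\<^esub> g) = End_act U e f \<oplus>\<^bsub>S_vs U\<^esub> End_act U e g" if g: "g \<in> carrier (S_vs U)" for g
    proof (rule ext)
      fix n
      show "End_act U e (f \<oplus>\<^bsub>S_vs U\<^esub> g) n = (End_act U e f \<oplus>\<^bsub>S_vs U\<^esub> End_act U e g) n"
        unfolding End_act_def S_vs_simps ee(2)[OF S_vs_nth[OF f] S_vs_nth[OF g]]
        by (rule finsum_addf) (intro Pi_I ee(1) S_vs_nth[OF f] S_vs_nth[OF g])+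
    qed
    show "End_act U e (c \<odot>\<^bsub>S_vs U\<^esub> f) = c \<odot>\<^bsub>S_vs U\<^esub> End_act U e f" for c
    proof -
      interpret c: linmap U U "\<lambda>x. c \<odot> x"
        by unfold_locales (auto intro!: linI simp: smult_radd smult_smult mult.commute)
      show ?thesis
      proof (rule ext)
        fix n show "End_act U e (c \<odot>\<^bsub>S_vs U\<^esub> f) n = (c \<odot>\<^bsub>S_vs U\<^esub> End_act U e f) n"
          unfolding End_act_def S_vs_simps ee(3)[OF S_vs_nth[OF f]]
          by (rule c.finsum[symmetric]) (intro ee(1) S_vs_nth[OF f])
      qed
    qed
    show "End_act U e (shift U f) = shift U (End_act U e f)"
    proof (rule ext)
      fix n show "End_act U e (shift U f) n = shift U (End_act U e f) n"
      proof (cases n)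
        case 0 then show ?thesis by (simp add: End_act_def shift_def ee)
      next
        case (Suc m)
        have "(\<Oplus>k\<in>{..Suc m}. e k (shift U f (Suc m - k))) = e (Suc m) (shift U f (Suc m - Suc m)) \<oplus> (\<Oplus>k\<in>{..m}. e k (shift U f (Suc m - k)))"
          by (rule finsum_Suc) (intro Pi_I ee(1) S_vs_nth[OF shift_closed[OF f]])
        also have "\<dots> = (\<Oplus>k\<in>{..m}. e k (f (m - k)))"
        proof -
          have "(\<Oplus>k\<in>{..m}. e k (shift U f (Suc m - k))) = (\<Oplus>k\<in>{..m}. e k (f (m - k)))"
            by (rule finsum_cong') (simp_all add: shift_def Suc_diff_le ee(1) S_vs_nth[OF f])
          moreover have "(\<Oplus>k\<in>{..m}. e k (f (m - k))) \<in> carrier U"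
            by (intro finsum_closed Pi_I ee(1) S_vs_nth[OF f])
          moreover have "e (Suc m) (shift U f (Suc m - Suc m)) = \<zero>" by (simp add: shift_def ee(4))
          ultimately show ?thesis by (simp only: l_zero)
        qed
        finally show ?thesis using Suc by (simp add: End_act_def shift_def)
      qed
    qed
  qed
qed

lemma act_add:
  assumes "e \<in> carrier (S_vs (End_qmhs U))" "e' \<in> carrier (S_vs (End_qmhs U))" "f \<in> carrier (S_vs U)"
  shows "End_act U (e \<oplus>\<^bsub>S_vs (End_qmhs U)\<^esub> e') f = End_act U e f \<oplus>\<^bsub>S_vs U\<^esub> End_act U e' f"
proof -
  have "e k \<in> carrier (End_qmhs U)" "e' k \<in> carrier (End_qmhs U)" for k
    by (rule S_vs_nth[OF assms(1)], rule S_vs_nth[OF assms(2)])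
  note ee = this[THEN End_app(1)]
  show ?thesis
  proof (rule ext)
    fix n
    have "End_act U (e \<oplus>\<^bsub>S_vs (End_qmhs U)\<^esub> e') f n = (\<Oplus>k\<in>{..n}. e k (f (n - k)) \<oplus> e' k (f (n - k)))"
      unfolding End_act_def by (rule finsum_cong') (auto simp: End_simps(3) S_vs_nth[OF assms(3)] ee)
    also have "\<dots> = (End_act U e f \<oplus>\<^bsub>S_vs U\<^esub> End_act U e' f) n"
      unfolding End_act_def S_vs_simps
      by (rule finsum_addf) (intro Pi_I ee S_vs_nth[OF assms(3)])+
    finally show "End_act U (e \<oplus>\<^bsub>S_vs (End_qmhs U)\<^esub> e') f n = (End_act U e f \<oplus>\<^bsub>S_vs U\<^esub> End_act U e' f) n" .
  qed
qed

lemma act_smult: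
  assumes "e \<in> carrier (S_vs (End_qmhs U))" "f \<in> carrier (S_vs U)"
  shows "End_act U (c \<odot>\<^bsub>S_vs (End_qmhs U)\<^esub> e) f = c \<odot>\<^bsub>S_vs U\<^esub> End_act U e f"
proof -
  have "e k \<in> carrier (End_qmhs U)" for k by (rule S_vs_nth[OF assms(1)])
  note ee = this[THEN End_app(1)]
  interpret c: linmap U U "\<lambda>x. c \<odot> x"
    by unfold_locales (auto intro!: linI simp: smult_radd smult_smult mult.commute)
  show ?thesis
  proof (rule ext)
    fix n
    have "End_act U (c \<odot>\<^bsub>S_vs (End_qmhs U)\<^esub> e) f n = (\<Oplus>k\<in>{..n}. c \<odot> e k (f (n - k)))"
      unfolding End_act_def using S_vs_nth[OF assms(2)] ee by (intro finsum_cong') (auto simp: End_simps(4))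
    also have "\<dots> = c \<odot> End_act U e f n"
      unfolding End_act_def using S_vs_nth[OF assms(2)] ee by (intro c.finsum[symmetric]) blast
    finally show "End_act U (c \<odot>\<^bsub>S_vs (End_qmhs U)\<^esub> e) f n = (c \<odot>\<^bsub>S_vs U\<^esub> End_act U e f) n"
      by (simp only: S_vs_simps)
  qed
qed

lemma finsum_smult_const: "x \<in> carrier U \<Longrightarrow> (\<Oplus>k\<in>I. a k \<odot> x) = (\<Sum>k\<in>I. a k) \<odot> x"
proof (induction I rule: infinite_finite_induct)
  case (insert i I)
  have "(\<Oplus>k\<in>insert i I. a k \<odot> x) = a i \<odot> x \<oplus> (\<Oplus>k\<in>I. a k \<odot> x)"
    using insert by (intro finsum_insert) auto
  moreover have "(\<Oplus>k\<in>I. a k \<odot> x) = (\<Sum>k\<in>I. a k) \<odot> x" by (rule insert.IH) (rule insert.prems)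
  moreover have "(\<Sum>k\<in>insert i I. a k) = a i + (\<Sum>k\<in>I. a k)" using insert.hyps by simp
  ultimately show ?case by (simp only: smult_ladd[OF insert.prems])
next
  case (infinite I) then show ?case by simp
next
  case empty then show ?case by simp
qed

lemma act_tens:
  assumes A: "A \<in> carrier (End_qmhs U)" and v: "v \<in> carrier U"
  shows "End_act U (tens (End_qmhs U) A t) (tens U v s) = tens U (A v) (t * s)"
proof (rule ext)
  fix n
  have "End_act U (tens (End_qmhs U) A t) (tens U v s) n = (\<Oplus>k\<in>{..n}. (coeff t k * coeff s (n - k)) \<odot> A v)"
    unfolding End_act_def
  proof (rule finsum_cong')
    fix k
    have "tens (End_qmhs U) A t k (tens U v s (n - k)) = coeff t k \<odot> A (coeff s (n - k) \<odot> v)"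
      unfolding tens_def End_simps(4) using v by simp
    then show "tens (End_qmhs U) A t k (tens U v s (n - k)) = (coeff t k * coeff s (n - k)) \<odot> A v"
      using End_smult[OF A v] End_closed[OF A v] by (simp only: smult_smult)
  qed (rule refl, rule Pi_I, rule scl[OF End_closed[OF A v]])
  also have "\<dots> = coeff (t * s) n \<odot> A v"
    unfolding coeff_mult by (rule finsum_smult_const[OF End_closed[OF A v]])
  finally show "End_act U (tens (End_qmhs U) A t) (tens U v s) n = tens U (A v) (t * s) n"
    unfolding tens_def[of U "A v"] .
qed

end

section \<open>Unipotent automorphisms\<close>

definition S_hom :: "'a qmhs \<Rightarrow> 'b qmhs \<Rightarrow> ((nat \<Rightarrow> 'a) \<Rightarrow> nat \<Rightarrow> 'b) set" where
  "S_hom V U = {\<phi> \<in> S_lin V U \<inter> extensional (carrier (S_vs V)).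
     (\<forall>n. \<phi> ` Wfil (tensor_S V) n \<subseteq> Wfil (tensor_S U) n) \<and>
     (\<forall>p. map_prod \<phi> \<phi> ` Ffil (tensor_S V) p \<subseteq> Ffil (tensor_S U) p)}"

text \<open>
  The \<open>\<S>\<close>-linear endomorphisms of \<open>V \<otimes> \<S>\<close> that respect the filtrations and induce the identity on \<open>gr\<^sup>W\<close>.
\<close>

definition S_unip :: "'a qmhs \<Rightarrow> ((nat \<Rightarrow> 'a) \<Rightarrow> nat \<Rightarrow> 'a) set" where
  "S_unip V = {g \<in> S_hom V V. \<forall>n. \<forall>f\<in>Wfil (tensor_S V) n. g f \<ominus>\<^bsub>S_vs V\<^esub> f \<in> Wfil (tensor_S V) (n - 1)}"

lemma lin_tensor_S: "lin (tensor_S V) (tensor_S U) = lin (S_vs V) (S_vs U)"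
  by (simp add: LinearCombinations.module_hom_def)

lemma S_hom_eq: "S_hom V U = qmhs_hom (tensor_S V) (tensor_S U) \<inter> S_lin V U"
  by (auto simp: S_hom_def qmhs_hom_def lin_tensor_S S_lin_def)

lemma S_hom_lin: "\<phi> \<in> S_hom V U \<Longrightarrow> \<phi> \<in> lin (S_vs V) (S_vs U)"
  by (simp add: S_hom_def S_lin_def)

lemma S_hom_closed: "\<phi> \<in> S_hom V U \<Longrightarrow> f \<in> carrier (S_vs V) \<Longrightarrow> \<phi> f \<in> carrier (S_vs U)"
  using S_hom_lin[of \<phi> V U] by (auto simp: LinearCombinations.module_hom_def)

lemma S_hom_W: "\<phi> \<in> S_hom V U \<Longrightarrow> f \<in> Wfil (tensor_S V) n \<Longrightarrow> \<phi> f \<in> Wfil (tensor_S U) n"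
  by (auto simp: S_hom_def)

lemma S_hom_F: "\<phi> \<in> S_hom V U \<Longrightarrow> z \<in> Ffil (tensor_S V) p \<Longrightarrow> map_prod \<phi> \<phi> z \<in> Ffil (tensor_S U) p"
  unfolding S_hom_def by blast

lemma S_hom_compose:
  assumes "fvs V" "vsp U" "\<psi> \<in> S_hom U X" "\<phi> \<in> S_hom V U"
  shows "compose (carrier (S_vs V)) \<psi> \<phi> \<in> S_hom V X"
proof -
  interpret fvs V by fact
  have eq: "compose (carrier (S_vs V)) \<psi> \<phi> = restrict (\<lambda>f. \<psi> (\<phi> f)) (carrier (S_vs V))"
    by (simp add: compose_def)
  have "compose (carrier (S_vs V)) \<psi> \<phi> \<in> S_lin V X"
    unfolding eq using assms(3,4)
    by (intro S_lin_restrict[OF vs] S_lin_compose[OF assms(2), of \<psi> X \<phi> V]) (auto simp: S_hom_def)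
  moreover have "map_prod (compose (carrier (S_vs V)) \<psi> \<phi>) (compose (carrier (S_vs V)) \<psi> \<phi>) z =
     map_prod \<psi> \<psi> (map_prod \<phi> \<phi> z)" if "z \<in> Ffil (tensor_S V) p" for z p
    using CS.subspD(6)[OF Ffil_tensor_sub that] by (cases z) (simp add: compose_def)
  moreover have "compose (carrier (S_vs V)) \<psi> \<phi> f = \<psi> (\<phi> f)" if "f \<in> Wfil (tensor_S V) n" for f n
    using that by (simp add: compose_def Wfil_tensor)
  ultimately show ?thesis using S_hom_W[OF assms(3)] S_hom_W[OF assms(4)] S_hom_F[OF assms(3)] S_hom_F[OF assms(4)]
    by (auto simp: S_hom_def image_subset_iff simp del: map_prod_simp)
qed

context fvs begin

lemma W_tensor_sub: "subsp (Wfil (tensor_S V) n) (S_vs V)"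
  using fvs.W_sub[OF tensor_fvs, of n] vsp.subsp_iff[OF vsp_tensor_S[OF vs]] S.subsp_iff by simp

lemma W_tensor_mono: "m \<le> n \<Longrightarrow> Wfil (tensor_S V) m \<subseteq> Wfil (tensor_S V) n"
  using fvs.W_mono[OF tensor_fvs] .

lemma S_hom_id: "(\<lambda>f\<in>carrier (S_vs V). f) \<in> S_hom V V"
proof -
  have "(\<lambda>f. f) \<in> S_lin V V" by (auto simp: S_lin_def intro!: linI)
  then have "(\<lambda>f\<in>carrier (S_vs V). f) \<in> S_lin V V" by (rule S_lin_restrict[OF vs])
  moreover have "map_prod (\<lambda>f\<in>carrier (S_vs V). f) (\<lambda>f\<in>carrier (S_vs V). f) z = z" if "z \<in> Ffil (tensor_S V) p" for z p
    using CS.subspD(6)[OF Ffil_tensor_sub that] by (cases z) simp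
  ultimately show ?thesis by (auto simp: S_hom_def Wfil_tensor)
qed

lemma S_unip_id: "(\<lambda>f\<in>carrier (S_vs V). f) \<in> S_unip V"
proof -
  have "f \<ominus>\<^bsub>S_vs V\<^esub> f \<in> Wfil (tensor_S V) n" if "f \<in> carrier (S_vs V)" for f n
    unfolding S.minus_self[OF that] by (rule S.subspD(2)[OF W_tensor_sub])
  moreover have "f \<in> carrier (S_vs V)" if "f \<in> Wfil (tensor_S V) n" for f n
    using S.subspD(6)[OF W_tensor_sub that] .
  ultimately have "\<forall>n. \<forall>f\<in>Wfil (tensor_S V) n. (\<lambda>f\<in>carrier (S_vs V). f) f \<ominus>\<^bsub>S_vs V\<^esub> f \<in> Wfil (tensor_S V) (n - 1)"
    by (metis restrict_apply)
  then show ?thesis using S_hom_id by (simp only: S_unip_def mem_Collect_eq)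
qed

lemma S_unip_compose:
  assumes g: "g \<in> S_unip V" and h: "h \<in> S_unip V"
  shows "compose (carrier (S_vs V)) g h \<in> S_unip V"
proof -
  have gh: "g \<in> S_hom V V" "h \<in> S_hom V V" using g h by (auto simp: S_unip_def)
  have "g (h f) \<ominus>\<^bsub>S_vs V\<^esub> f \<in> Wfil (tensor_S V) (n - 1)" if f: "f \<in> Wfil (tensor_S V) n" for f n
  proof -
    have fc: "f \<in> carrier (S_vs V)" using S.subspD(6)[OF W_tensor_sub f] .
    note c = S_hom_closed[OF gh(2) fc] S_hom_closed[OF gh(1) S_hom_closed[OF gh(2) fc]]
    have "g (h f) \<ominus>\<^bsub>S_vs V\<^esub> h f \<in> Wfil (tensor_S V) (n - 1)"
      using S_hom_W[OF gh(2) f] g by (auto simp: S_unip_def)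
    moreover have "h f \<ominus>\<^bsub>S_vs V\<^esub> f \<in> Wfil (tensor_S V) (n - 1)" using f h by (auto simp: S_unip_def)
    ultimately have "(g (h f) \<ominus>\<^bsub>S_vs V\<^esub> h f) \<oplus>\<^bsub>S_vs V\<^esub> (h f \<ominus>\<^bsub>S_vs V\<^esub> f) \<in> Wfil (tensor_S V) (n - 1)"
      using S.subspD(3)[OF W_tensor_sub] by blast
    moreover have "(g (h f) \<ominus>\<^bsub>S_vs V\<^esub> h f) \<oplus>\<^bsub>S_vs V\<^esub> (h f \<ominus>\<^bsub>S_vs V\<^esub> f) = g (h f) \<ominus>\<^bsub>S_vs V\<^esub> f"
      using c fc by (simp add: S.minus_eq S.a_assoc S.r_neg1 S.r_neg2 del: S_vs_simps)
    ultimately show ?thesis by simp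
  qed
  moreover have "compose (carrier (S_vs V)) g h f = g (h f)" if "f \<in> Wfil (tensor_S V) n" for f n
    using S.subspD(6)[OF W_tensor_sub that] by (simp add: compose_def)
  ultimately show ?thesis using S_hom_compose[OF fvs_axioms vs gh] by (simp add: S_unip_def)
qed

text \<open>
  If \<open>g = 1 + e\<close>, this is \<open>1 - e\<close>: an inverse of \<open>g\<close> up to \<open>e\<^sup>2\<close>, which lowers weights further than \<open>e\<close>.
\<close>

lemma S_unip_reflect:
  assumes g: "g \<in> S_unip V"
  shows "(\<lambda>f\<in>carrier (S_vs V). f \<oplus>\<^bsub>S_vs V\<^esub> (f \<ominus>\<^bsub>S_vs V\<^esub> g f)) \<in> S_unip V" (is "?h \<in> _")
proof -
  have gh: "g \<in> S_hom V V" using g by (auto simp: S_unip_def)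
  have gl: "g \<in> S_lin V V" using gh by (simp add: S_hom_def)
  interpret g: linmap "S_vs V" "S_vs V" g by unfold_locales (rule S_hom_lin[OF gh])
  interpret sh: linmap "S_vs V" "S_vs V" "shift V" by unfold_locales (rule shift_lin)
  note gW = S_hom_W[OF gh]
  note [simp del] = S_vs_simps
  have "(\<lambda>f. f \<oplus>\<^bsub>S_vs V\<^esub> (f \<ominus>\<^bsub>S_vs V\<^esub> g f)) \<in> S_lin V V"
    using gl by (auto simp: S_lin_def g.add g.smult g.minus sh.add sh.minus S.minus_smult S.smult_radd S.smult_smult S.a_ac sh.smult mult.commute intro!: linI)
  then have "?h \<in> S_lin V V" by (rule S_lin_restrict[OF vs])
  moreover have "?h f \<in> Wfil (tensor_S V) n" if "f \<in> Wfil (tensor_S V) n" for f n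
    using that gW[OF that] S.subspD[OF W_tensor_sub[of n]] by simp
  moreover have "map_prod ?h ?h z \<in> Ffil (tensor_S V) p" if z: "z \<in> Ffil (tensor_S V) p" for z p
  proof -
    note FF = CS.subspD[OF Ffil_tensor_sub[of p]]
    obtain u v where uv: "z = (u, v)" "u \<in> carrier (S_vs V)" "v \<in> carrier (S_vs V)"
      using FF(6)[OF z] by (cases z) auto
    have "map_prod ?h ?h z = z \<oplus>\<^bsub>cplx (S_vs V)\<^esub> (z \<ominus>\<^bsub>cplx (S_vs V)\<^esub> map_prod g g z)"
      using uv by (simp add: cplx_minus[OF S.is_vsp])
    then show ?thesis using FF(3)[OF z FF(5)[OF z S_hom_F[OF gh z]]] by simp
  qed
  moreover have "?h f \<ominus>\<^bsub>S_vs V\<^esub> f \<in> Wfil (tensor_S V) (n - 1)" if f: "f \<in> Wfil (tensor_S V) n" for f n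
  proof -
    have fc: "f \<in> carrier (S_vs V)" using S.subspD(6)[OF W_tensor_sub f] .
    have "?h f \<ominus>\<^bsub>S_vs V\<^esub> f = f \<ominus>\<^bsub>S_vs V\<^esub> g f" using fc by simp
    also have "\<dots> = (-1) \<odot>\<^bsub>S_vs V\<^esub> (g f \<ominus>\<^bsub>S_vs V\<^esub> f)"
      using fc by (simp add: S.minus_smult S.smult_radd S.smult_smult S.a_ac)
    finally have "?h f \<ominus>\<^bsub>S_vs V\<^esub> f = (-1) \<odot>\<^bsub>S_vs V\<^esub> (g f \<ominus>\<^bsub>S_vs V\<^esub> f)" .
    moreover have "g f \<ominus>\<^bsub>S_vs V\<^esub> f \<in> Wfil (tensor_S V) (n - 1)" using f g by (auto simp: S_unip_def)
    ultimately show ?thesis using S.subspD(4)[OF W_tensor_sub] by simp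
  qed
  ultimately show ?thesis by (auto simp: S_unip_def S_hom_def image_subset_iff simp del: map_prod_simp)
qed

end

locale bounded_fvs = fvs +
  assumes W_bot_ex: "\<exists>lo. Wfil V lo = {\<zero>}" and W_top_ex: "\<exists>hi. Wfil V hi = carrier V"
begin

text \<open>
  Let \<open>g = 1 + e\<close> where \<open>e\<close> lowers weights by \<open>d \<ge> 1\<close>.  Then \<open>(1 - e)(1 + e) = 1 - e\<^sup>2\<close> is again of this form
  with \<open>e\<^sup>2\<close> lowering weights by \<open>2d\<close>.  As \<open>W\<close> is finite, iteration ends at the identity, and the
  product of the factors \<open>1 - e\<close> is the inverse.  It respects \<open>F\<close> since each factor does.
\<close>

lemma S_unip_left_inverse:
  assumes g: "g \<in> S_unip V"
  shows "\<exists>h\<in>S_unip V. \<forall>f\<in>carrier (S_vs V). h (g f) = f"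
proof -
  obtain lo hi where lo: "Wfil V lo = {\<zero>}" and hi: "Wfil V hi = carrier V"
    using W_bot_ex W_top_ex by blast
  let ?W = "Wfil (tensor_S V)"
  have Wlo: "f \<in> ?W lo \<Longrightarrow> f = \<zero>\<^bsub>S_vs V\<^esub>" for f by (auto simp: Wfil_tensor lo)
  have Whi: "f \<in> carrier (S_vs V) \<Longrightarrow> f \<in> ?W hi" for f by (simp add: Wfil_tensor hi)
  note [simp del] = S_vs_simps
  have "\<exists>h\<in>S_unip V. \<forall>f\<in>carrier (S_vs V). h (g f) = f"
    if "g \<in> S_unip V" "d \<ge> 1" "\<And>n f. f \<in> ?W n \<Longrightarrow> g f \<ominus>\<^bsub>S_vs V\<^esub> f \<in> ?W (n - d)" for d g
    using that
  proof (induction "nat (hi - lo - d)" arbitrary: d g rule: less_induct)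
    case (less d g)
    have gh: "g \<in> S_hom V V" using less(2) by (auto simp: S_unip_def)
    interpret g: linmap "S_vs V" "S_vs V" g by unfold_locales (rule S_hom_lin[OF gh])
    show ?case
    proof (cases "hi - lo \<le> d")
      case True
      have "g f = f" if f: "f \<in> carrier (S_vs V)" for f
      proof -
        have "g f \<ominus>\<^bsub>S_vs V\<^esub> f \<in> ?W lo" using less(4)[OF Whi[OF f]] W_tensor_mono[of "hi - d" lo] True by auto
        from Wlo[OF this] show ?thesis using S.minus_eq_zero[of "g f" f] f by simp
      qed
      then show ?thesis by (intro bexI[OF _ S_unip_id]) simp
    next
      case False
      define h where "h = (\<lambda>f\<in>carrier (S_vs V). f \<oplus>\<^bsub>S_vs V\<^esub> (f \<ominus>\<^bsub>S_vs V\<^esub> g f))"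
      have h: "h \<in> S_unip V" unfolding h_def by (rule S_unip_reflect[OF less(2)])
      let ?k = "compose (carrier (S_vs V)) h g"
      have k: "?k \<in> S_unip V" by (rule S_unip_compose[OF h less(2)])
      have "?k f \<ominus>\<^bsub>S_vs V\<^esub> f \<in> ?W (n - (d + 1))" if f: "f \<in> ?W n" for n f
      proof -
        have fc: "f \<in> carrier (S_vs V)" using S.subspD(6)[OF W_tensor_sub f] .
        let ?e = "g f \<ominus>\<^bsub>S_vs V\<^esub> f"
        have "?k f \<ominus>\<^bsub>S_vs V\<^esub> f = (-1) \<odot>\<^bsub>S_vs V\<^esub> (g ?e \<ominus>\<^bsub>S_vs V\<^esub> ?e)"
          using fc by (simp add: compose_def h_def g.minus g.add g.smult S.minus_smult S.smult_radd S.smult_smult S.a_ac)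
        moreover have "g ?e \<ominus>\<^bsub>S_vs V\<^esub> ?e \<in> ?W (n - d - d)" by (rule less(4)[OF less(4)[OF f]])
        ultimately have "?k f \<ominus>\<^bsub>S_vs V\<^esub> f \<in> ?W (n - d - d)" using S.subspD(4)[OF W_tensor_sub] by simp
        then show ?thesis using W_tensor_mono[of "n - d - d" "n - (d + 1)"] less(3) by auto
      qed
      then obtain h' where h': "h' \<in> S_unip V" "\<And>f. f \<in> carrier (S_vs V) \<Longrightarrow> h' (?k f) = f"
        using less(1)[of "d + 1" ?k] k less(3) False by auto
      have "\<forall>f\<in>carrier (S_vs V). compose (carrier (S_vs V)) h' h (g f) = f"
        using h'(2) by (simp add: compose_def)
      then show ?thesis using S_unip_compose[OF h'(1) h] by blast
    qed
  qed
  from this[OF g, of 1] show ?thesis using g by (auto simp: S_unip_def)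
qed

end

section \<open>Endomorphisms of \<open>U \<otimes> \<S>\<close> as elements of \<open>End U \<otimes> \<S>\<close>\<close>

text \<open>
  The action of \<open>f + \<i>g\<close>, given as the pair \<open>P = (f, g)\<close>, on the complexification.
\<close>

definition capp :: "('a, 'm) ring_scheme \<Rightarrow> ('b \<Rightarrow> 'a) \<times> ('b \<Rightarrow> 'a) \<Rightarrow> 'b \<times> 'b \<Rightarrow> 'a \<times> 'a" where
  "capp U P z = (fst P (fst z) \<ominus>\<^bsub>U\<^esub> snd P (snd z), fst P (snd z) \<oplus>\<^bsub>U\<^esub> snd P (fst z))"

text \<open>
  The coefficient of \<open>x\<^sup>k\<close> of an element of \<open>(V \<otimes> \<S>) \<otimes> \<complex>\<close>, as an element of \<open>V \<otimes> \<complex>\<close>.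
\<close>

definition ccoef :: "nat \<Rightarrow> (nat \<Rightarrow> 'a) \<times> (nat \<Rightarrow> 'a) \<Rightarrow> 'a \<times> 'a" where
  "ccoef k Z = (fst Z k, snd Z k)"

context rvsp begin

lemma S_vs_apply:
  "(f \<oplus>\<^bsub>S_vs M\<^esub> g) k = f k \<oplus> g k" "(r \<odot>\<^bsub>S_vs M\<^esub> f) k = r \<odot> f k"
  "f \<in> carrier (S_vs M) \<Longrightarrow> g \<in> carrier (S_vs M) \<Longrightarrow> (f \<ominus>\<^bsub>S_vs M\<^esub> g) k = f k \<ominus> g k"
  by (simp_all add: S_vs_minus[OF is_vsp])

lemma ccoef_lin: "ccoef k \<in> lin (cplx (S_vs M)) (cplx M)"
  by (rule linI) (auto simp: ccoef_def S_vs_apply simp del: S_vs_simps)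

lemma ccoef_ctens: "y \<in> carrier (cplx M) \<Longrightarrow>
    ccoef k (ctens M y w) = Complex (coeff (fst w) k) (coeff (snd w) k) \<odot>\<^bsub>cplx M\<^esub> y"
  using tens_closed[OF is_vsp]
  by (cases y; cases w) (auto simp: ccoef_def ctens_def S_vs_apply simp del: S_vs_simps, auto simp: tens_def a_comm)

end

lemma Ffil_End: "Ffil (End_qmhs U) p = {P \<in> carrier (cplx (End_qmhs U)). \<forall>q. capp U P ` Ffil U q \<subseteq> Ffil U (q + p)}"
proof -
  have *: "(\<lambda>(u, v). (f u \<ominus>\<^bsub>U\<^esub> g v, f v \<oplus>\<^bsub>U\<^esub> g u)) = capp U (f, g)" for f g
    by (auto simp: capp_def)
  have "P \<in> Ffil (End_qmhs U) p \<longleftrightarrow> P \<in> {P \<in> carrier (cplx (End_qmhs U)). \<forall>q. capp U P ` Ffil U q \<subseteq> Ffil U (q + p)}" for P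
    by (cases P) (simp add: End_simps(1,6) * conj_assoc)
  then show ?thesis by blast
qed

context endo begin

lemma End_apply:
  assumes "A \<in> carrier (End_qmhs U)" "B \<in> carrier (End_qmhs U)" "x \<in> carrier U"
  shows "(A \<oplus>\<^bsub>End_qmhs U\<^esub> B) x = A x \<oplus> B x" "(r \<odot>\<^bsub>End_qmhs U\<^esub> A) x = r \<odot> A x"
    "(A \<ominus>\<^bsub>End_qmhs U\<^esub> B) x = A x \<ominus> B x"
  using assms E.scl[OF assms(2)] by (auto simp: E.minus_smult minus_smult End_simps(3,4) End_closed)

lemma capp_closed:
  assumes "P \<in> carrier (cplx (End_qmhs U))" "z \<in> carrier (cplx U)"
  shows "capp U P z \<in> carrier (cplx U)"
proof -
  obtain A B u v where "P = (A, B)" "z = (u, v)" "A \<in> carrier (End_qmhs U)" "B \<in> carrier (End_qmhs U)" "u \<in> carrier U" "v \<in> carrier U"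
    using assms by auto
  then show ?thesis by (simp add: capp_def End_closed)
qed

lemma capp_lin:
  assumes z: "z \<in> carrier (cplx U)" shows "(\<lambda>P. capp U P z) \<in> lin (cplx (End_qmhs U)) (cplx U)"
proof -
  obtain u v where uv: "z = (u, v)" "u \<in> carrier U" "v \<in> carrier U" using z by auto
  show ?thesis
  proof (rule linI)
    fix P assume P: "P \<in> carrier (cplx (End_qmhs U))"
    then obtain A B where AB: "P = (A, B)" "A \<in> carrier (End_qmhs U)" "B \<in> carrier (End_qmhs U)" by auto
    show "capp U P z \<in> carrier (cplx U)" by (rule capp_closed[OF P z])
    show "capp U (c \<odot>\<^bsub>cplx (End_qmhs U)\<^esub> P) z = c \<odot>\<^bsub>cplx U\<^esub> capp U P z" for c
      using AB uv by (simp add: capp_def End_apply End_closed minus_smult smult_smult smult_radd a_ac)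
    fix Q assume Q: "Q \<in> carrier (cplx (End_qmhs U))"
    then obtain C D where CD: "Q = (C, D)" "C \<in> carrier (End_qmhs U)" "D \<in> carrier (End_qmhs U)" by auto
    show "capp U (P \<oplus>\<^bsub>cplx (End_qmhs U)\<^esub> Q) z = capp U P z \<oplus>\<^bsub>cplx U\<^esub> capp U Q z"
      using AB CD uv by (simp add: capp_def End_apply End_closed minus_smult smult_smult smult_radd a_ac)
  qed
qed

end

locale endo_fvs = fvs U for U :: "'a qmhs" (structure)
sublocale endo_fvs \<subseteq> endo U ..

context endo_fvs begin

lemma End_fvs: "fvs (End_qmhs U)"
proof (rule fvs.intro)
  show "vsp (End_qmhs U)" by (rule vsp_End)
  show "subsp (Wfil (End_qmhs U) n) (End_qmhs U)" for n
  proof -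
    have "Wfil (End_qmhs U) n = {A \<in> carrier (End_qmhs U). \<forall>k. \<forall>x\<in>Wfil U k. A x \<in> Wfil U (k + n)}"
      unfolding End_simps by blast
    then show ?thesis unfolding E.subsp_iff
      using subspD[OF W_sub] by (auto simp: Wfil_carrier simp del: End_simps) (auto simp: End_simps(2-4) Wfil_carrier)
  qed
  show "Wfil (End_qmhs U) m \<subseteq> Wfil (End_qmhs U) n" if "m \<le> n" for m n
  proof -
    have "Wfil U (k + m) \<subseteq> Wfil U (k + n)" for k using that by (intro W_mono) simp
    then show ?thesis unfolding End_simps by blast
  qed
  show "subsp (Ffil (End_qmhs U) p) (cplx (End_qmhs U))" for p
  proof -
    have "subsp {P \<in> carrier (cplx (End_qmhs U)). capp U P z \<in> Ffil U (q + p)} (cplx (End_qmhs U))"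
      if z: "z \<in> Ffil U q" for z q
    proof -
      interpret c: linmap "cplx (End_qmhs U)" "cplx U" "\<lambda>P. capp U P z"
        by unfold_locales (rule capp_lin[OF Ffil_carrier[OF z]])
      show ?thesis by (rule c.vimage_subsp[OF F_sub])
    qed
    note * = E.C.subspD[OF this]
    show ?thesis unfolding E.C.subsp_iff Ffil_End
      using *(2) *(3) *(4) by (simp add: image_subset_iff del: cplx_simps)
  qed
qed

end

context endo begin

text \<open>
  The action of \<open>(End U \<otimes> \<S>) \<otimes> \<complex>\<close> on \<open>(U \<otimes> \<S>) \<otimes> \<complex>\<close>; on pure tensors it is the tensor product of the
  action of \<open>End U\<close> on \<open>U\<close> with multiplication (\<open>cact_ctens\<close>).
\<close>

definition cact :: "(nat \<Rightarrow> 'a \<Rightarrow> 'a) \<times> (nat \<Rightarrow> 'a \<Rightarrow> 'a) \<Rightarrow> (nat \<Rightarrow> 'a) \<times> (nat \<Rightarrow> 'a) \<Rightarrow> (nat \<Rightarrow> 'a) \<times> (nat \<Rightarrow> 'a)" where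
  "cact e z = (End_act U (fst e) (fst z) \<ominus>\<^bsub>S_vs U\<^esub> End_act U (snd e) (snd z),
     End_act U (fst e) (snd z) \<oplus>\<^bsub>S_vs U\<^esub> End_act U (snd e) (fst z))"

lemma cact_lin:
  assumes z: "z \<in> carrier (cplx (S_vs U))"
  shows "(\<lambda>e. cact e z) \<in> lin (cplx (S_vs (End_qmhs U))) (cplx (S_vs U))"
proof -
  note [simp del] = S_vs_simps
  obtain u v where uv: "z = (u, v)" "u \<in> carrier (S_vs U)" "v \<in> carrier (S_vs U)" using z by auto
  show ?thesis
  proof (rule linI)
    fix P assume P: "P \<in> carrier (cplx (S_vs (End_qmhs U)))"
    then obtain A B where AB: "P = (A, B)" "A \<in> carrier (S_vs (End_qmhs U))" "B \<in> carrier (S_vs (End_qmhs U))" by auto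
    show "cact P z \<in> carrier (cplx (S_vs U))" using AB uv by (simp add: cact_def act_closed)
    show "cact (c \<odot>\<^bsub>cplx (S_vs (End_qmhs U))\<^esub> P) z = c \<odot>\<^bsub>cplx (S_vs U)\<^esub> cact P z" for c
      using AB uv by (simp add: cact_def E.S.minus_smult act_closed act_add act_smult S.minus_smult S.smult_smult S.smult_radd S.a_ac)
    fix Q assume Q: "Q \<in> carrier (cplx (S_vs (End_qmhs U)))"
    then obtain C D where CD: "Q = (C, D)" "C \<in> carrier (S_vs (End_qmhs U))" "D \<in> carrier (S_vs (End_qmhs U))" by auto
    show "cact (P \<oplus>\<^bsub>cplx (S_vs (End_qmhs U))\<^esub> Q) z = cact P z \<oplus>\<^bsub>cplx (S_vs U)\<^esub> cact Q z"
      using AB CD uv by (simp add: cact_def act_closed act_add act_smult S.minus_smult S.smult_smult S.smult_radd S.a_ac)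
  qed
qed

lemma cact_ctens:
  assumes P: "P \<in> carrier (cplx (End_qmhs U))" and z: "z \<in> carrier (cplx U)"
  shows "cact (ctens (End_qmhs U) P t) (ctens U z s) = ctens U (capp U P z) (cpmult t s)"
proof -
  note [simp del] = S_vs_simps
  obtain A B where AB: "P = (A, B)" "A \<in> carrier (End_qmhs U)" "B \<in> carrier (End_qmhs U)" using P by auto
  obtain u v where uv: "z = (u, v)" "u \<in> carrier U" "v \<in> carrier U" using z by auto
  obtain t1 t2 s1 s2 where ts: "t = (t1, t2)" "s = (s1, s2)" by (cases t; cases s)
  note cl = End_closed[OF AB(2) uv(2)] End_closed[OF AB(2) uv(3)] End_closed[OF AB(3) uv(2)] End_closed[OF AB(3) uv(3)]
  note [simp] = tens_closed[OF is_vsp] tens_closed[OF E.is_vsp]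
  have r: "End_act U e (f \<oplus>\<^bsub>S_vs U\<^esub> g) = End_act U e f \<oplus>\<^bsub>S_vs U\<^esub> End_act U e g"
    if "e \<in> carrier (S_vs (End_qmhs U))" "f \<in> carrier (S_vs U)" "g \<in> carrier (S_vs U)" for e f g
    using act_S_lin[OF that(1)] that(2,3) by (auto simp: S_lin_def LinearCombinations.module_hom_def)
  have r': "End_act U e (c \<odot>\<^bsub>S_vs U\<^esub> f) = c \<odot>\<^bsub>S_vs U\<^esub> End_act U e f"
    if "e \<in> carrier (S_vs (End_qmhs U))" "f \<in> carrier (S_vs U)" for e f c
    using act_S_lin[OF that(1)] that(2) by (auto simp: S_lin_def LinearCombinations.module_hom_def)
  show ?thesis unfolding AB(1) uv(1) ts
    by (simp add: cact_def ctens_def capp_def cpmult_def E.S.minus_smult S.minus_smult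
        act_add act_smult r r' act_tens AB uv cl S.smult_radd S.smult_smult
        tens_add_left[OF is_vsp] tens_diff_left[OF is_vsp] tens_add_right[OF is_vsp] tens_diff_right[OF is_vsp] S.a_ac)
qed

lemma act_const:
  assumes e: "e \<in> carrier (S_vs (End_qmhs U))" and v: "v \<in> carrier U"
  shows "End_act U e (tens U v 1) = (\<lambda>n. e n v)"
proof (rule ext)
  fix n
  have e': "e k \<in> carrier (End_qmhs U)" for k by (rule S_vs_nth[OF e])
  have "End_act U e (tens U v 1) n = (\<Oplus>k\<in>{..n}. if n = k then e k v else \<zero>)"
    unfolding End_act_def
    by (rule finsum_cong') (auto simp: tens_def coeff_1 v End_zero[OF e'] End_closed[OF e' v])
  also have "\<dots> = e n v" by (rule finsum_singleton) (use End_closed[OF e' v] in auto)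
  finally show "End_act U e (tens U v 1) n = e n v" .
qed

end

lemma ccoef_eqI: "(\<And>k. ccoef k Z = ccoef k Z') \<Longrightarrow> Z = Z'"
  by (cases Z; cases Z') (auto simp: ccoef_def)

context endo_fvs begin

lemma End_W: "A \<in> Wfil (End_qmhs U) n \<Longrightarrow> x \<in> Wfil U k \<Longrightarrow> A x \<in> Wfil U (k + n)"
  by (auto simp: End_simps)

lemma act_W:
  assumes e: "e \<in> Wfil (tensor_S (End_qmhs U)) n" and f: "f \<in> Wfil (tensor_S U) m"
  shows "End_act U e f \<in> Wfil (tensor_S U) (m + n)"
proof -
  have e': "e \<in> carrier (S_vs (End_qmhs U))" "\<And>k. e k \<in> Wfil (End_qmhs U) n"
    using e by (auto simp: fvs.Wfil_tensor[OF End_fvs])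
  have f': "f \<in> carrier (S_vs U)" "\<And>k. f k \<in> Wfil U m" using f by (auto simp: Wfil_tensor)
  have "End_act U e f k \<in> Wfil U (m + n)" for k
    unfolding End_act_def by (rule subsp_finsum[OF W_sub]) (rule End_W[OF e'(2) f'(2)])
  then show ?thesis using act_closed[OF e'(1) f'(1)] by (simp add: Wfil_tensor)
qed

text \<open>
  The action is bilinear, so the claim may be checked for a pure tensor \<open>P \<otimes> t\<close> in place of \<open>e\<close> and a pure
  tensor \<open>z \<otimes> s\<close> in place of \<open>Z\<close>.  There the degrees of \<open>P\<close> and \<open>z\<close> add up, and so do those of \<open>t\<close>
  and \<open>s\<close>.
\<close>

lemma act_F:
  assumes e: "e \<in> gam 0 (tensor_S (End_qmhs U))" and Z: "Z \<in> Ffil (tensor_S U) p"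
  shows "map_prod (End_act U e) (End_act U e) Z \<in> Ffil (tensor_S U) p"
proof -
  have e': "e \<in> carrier (S_vs (End_qmhs U))" "(e, \<zero>\<^bsub>S_vs (End_qmhs U)\<^esub>) \<in> Ffil (tensor_S (End_qmhs U)) 0"
    using e by (auto simp: gam_def)
  interpret e: linmap "S_vs U" "S_vs U" "End_act U e"
    using act_S_lin[OF e'(1)] by unfold_locales (simp add: S_lin_def)
  have zero: "End_act U \<zero>\<^bsub>S_vs (End_qmhs U)\<^esub> f = \<zero>\<^bsub>S_vs U\<^esub>" if f: "f \<in> carrier (S_vs U)" for f
    using act_smult[OF e'(1) f, of 0] e'(1) f act_closed[OF e'(1) f] by (simp del: S_vs_simps)
  have cact_e: "cact (e, \<zero>\<^bsub>S_vs (End_qmhs U)\<^esub>) Z = map_prod (End_act U e) (End_act U e) Z"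
    if "Z \<in> carrier (cplx (S_vs U))" for Z
    using that by (cases Z) (simp add: cact_def zero S.r_zero del: S_vs_simps)
  have "map_prod (End_act U e) (End_act U e) ` Ffil (tensor_S U) p \<subseteq> Ffil (tensor_S U) p"
  proof (rule Ffil_tensor_image[OF CS.is_vsp map_prod_lin[OF S.is_vsp S.is_vsp e.lin] Ffil_tensor_sub])
    fix a z s assume z: "z \<in> Ffil U a" and s: "s \<in> Ffil S_ring (p - a)"
    have zs: "ctens U z s \<in> carrier (cplx (S_vs U))" by (rule ctens_closed[OF vs Ffil_carrier[OF z]])
    have "(\<lambda>e. cact e (ctens U z s)) ` Ffil (tensor_S (End_qmhs U)) 0 \<subseteq> Ffil (tensor_S U) p"
    proof (rule fvs.Ffil_tensor_image[OF End_fvs CS.is_vsp cact_lin[OF zs] Ffil_tensor_sub])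
      fix a' P t assume P: "P \<in> Ffil (End_qmhs U) a'" and t: "t \<in> Ffil S_ring (0 - a')"
      have PC: "P \<in> carrier (cplx (End_qmhs U))" using P unfolding Ffil_End by blast
      have "capp U P z \<in> Ffil U (a + a')" using P z unfolding Ffil_End by blast
      moreover have "cpmult t s \<in> Ffil S_ring (p - (a + a'))"
        using cpmult_in_Ffil_S[OF t s] by (simp add: algebra_simps)
      ultimately show "cact (ctens (End_qmhs U) P t) (ctens U z s) \<in> Ffil (tensor_S U) p"
        unfolding cact_ctens[OF PC Ffil_carrier[OF z]] by (rule Ffil_tensor_gen)
    qed
    then show "map_prod (End_act U e) (End_act U e) (ctens U z s) \<in> Ffil (tensor_S U) p"
      using e'(2) cact_e[OF zs] by (auto simp del: S_vs_simps)
  qed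
  then show ?thesis using Z by blast
qed

lemma id_plus_act_unip:
  assumes e: "e \<in> Wfil (tensor_S (End_qmhs U)) (- 1) \<inter> gam 0 (tensor_S (End_qmhs U))"
  shows "(\<lambda>f\<in>carrier (S_vs U). f \<oplus>\<^bsub>S_vs U\<^esub> End_act U e f) \<in> S_unip U" (is "?g \<in> _")
proof -
  note [simp del] = S_vs_simps
  have eC: "e \<in> carrier (S_vs (End_qmhs U))" using e by (auto simp: gam_def)
  have "(\<lambda>f. f) \<in> S_lin U U" by (auto simp: S_lin_def intro!: linI)
  from S_lin_restrict[OF vs S_lin_add[OF vs vs this act_S_lin[OF eC]]]
  have gl: "?g \<in> S_lin U U" .
  have eW: "End_act U e f \<in> Wfil (tensor_S U) (n - 1)" if "f \<in> Wfil (tensor_S U) n" for f n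
    using act_W[of e "-1", OF _ that] e by simp
  have Wc: "f \<in> carrier (S_vs U)" if "f \<in> Wfil (tensor_S U) n" for f n using that by (simp add: Wfil_tensor)
  have "?g f \<in> Wfil (tensor_S U) n" if f: "f \<in> Wfil (tensor_S U) n" for f n
    using S.subspD(3)[OF W_tensor_sub f subsetD[OF W_tensor_mono eW[OF f]]] Wc[OF f] by simp
  moreover have "?g f \<ominus>\<^bsub>S_vs U\<^esub> f \<in> Wfil (tensor_S U) (n - 1)" if f: "f \<in> Wfil (tensor_S U) n" for f n
    using eW[OF f] Wc[OF f] Wc[OF eW[OF f]] by simp
  moreover have "map_prod ?g ?g Z \<in> Ffil (tensor_S U) p" if Z: "Z \<in> Ffil (tensor_S U) p" for Z p
  proof -
    note FF = CS.subspD[OF Ffil_tensor_sub]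
    have "map_prod ?g ?g Z = Z \<oplus>\<^bsub>cplx (S_vs U)\<^esub> map_prod (End_act U e) (End_act U e) Z"
      using FF(6)[OF Z] by (cases Z) simp
    then show ?thesis using FF(3)[OF Z act_F[OF _ Z]] e by simp
  qed
  ultimately show ?thesis using gl by (auto simp: S_unip_def S_hom_def image_subset_iff simp del: map_prod_simp)
qed

end

text \<open>
  The part of a \<open>biframe\<close> of \<open>V \<otimes> \<complex>\<close> that concerns \<open>F\<close>.
\<close>

definition frame :: "'a qmhs \<Rightarrow> nat \<Rightarrow> (nat \<Rightarrow> 'a \<times> 'a) \<Rightarrow> (nat \<Rightarrow> 'a \<times> 'a \<Rightarrow> complex) \<Rightarrow> (nat \<Rightarrow> int) \<Rightarrow> bool" where
  "frame V N b c d \<longleftrightarrow> (\<forall>j<N. b j \<in> Ffil V (d j) \<and> functional (cplx V) (c j)) \<and>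
     (\<forall>z\<in>carrier (cplx V). z = (\<Oplus>\<^bsub>cplx V\<^esub>j\<in>{..<N}. c j z \<odot>\<^bsub>cplx V\<^esub> b j)) \<and>
     (\<forall>p. \<forall>z\<in>Ffil V p. \<forall>j<N. d j < p \<longrightarrow> c j z = 0)"

context endo_fvs begin

text \<open>
  The endomorphism \<open>c \<otimes> y\<close> of \<open>U \<otimes> \<complex>\<close>, given by its real and imaginary part (\<open>capp_rank_one\<close>).
\<close>

definition rank_one :: "('a \<times> 'a \<Rightarrow> complex) \<Rightarrow> 'a \<times> 'a \<Rightarrow> ('a \<Rightarrow> 'a) \<times> ('a \<Rightarrow> 'a)" where
  "rank_one c y = (\<lambda>v\<in>carrier U. fst (c (v, \<zero>) \<odot>\<^bsub>cplx U\<^esub> y), \<lambda>v\<in>carrier U. snd (c (v, \<zero>) \<odot>\<^bsub>cplx U\<^esub> y))"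

lemma rank_one_closed:
  assumes c: "functional (cplx U) c" and y: "y \<in> carrier (cplx U)"
  shows "rank_one c y \<in> carrier (cplx (End_qmhs U))"
proof -
  obtain y1 y2 where yy: "y = (y1, y2)" "y1 \<in> carrier U" "y2 \<in> carrier U" using y by auto
  have a: "c (u \<oplus> v, \<zero>) = c (u, \<zero>) + c (v, \<zero>)" if "u \<in> carrier U" "v \<in> carrier U" for u v
    using C.functional_add[OF c, of "(u, \<zero>)" "(v, \<zero>)"] that by simp
  have s: "c (r \<odot> u, \<zero>) = of_real r * c (u, \<zero>)" if "u \<in> carrier U" for u r
    using C.functional_smult[OF c, of "(u, \<zero>)" "of_real r"] that by simp
  show ?thesis unfolding rank_one_def
    using yy by (auto intro!: EndI simp: a s smult_ladd smult_radd minus_smult smult_smult smult_lminus ring_distribs ac_simps a_ac)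
qed

lemma capp_rank_one:
  assumes c: "functional (cplx U) c" and y: "y \<in> carrier (cplx U)" and z: "z \<in> carrier (cplx U)"
  shows "capp U (rank_one c y) z = c z \<odot>\<^bsub>cplx U\<^esub> y"
proof -
  obtain u v where uv: "z = (u, v)" "u \<in> carrier U" "v \<in> carrier U" using z by auto
  obtain y1 y2 where yy: "y = (y1, y2)" "y1 \<in> carrier U" "y2 \<in> carrier U" using y by auto
  have "z = (u, \<zero>) \<oplus>\<^bsub>cplx U\<^esub> (\<i> \<odot>\<^bsub>cplx U\<^esub> (v, \<zero>))" using uv by (simp add: minus_eq)
  then have "c z = c (u, \<zero>) + \<i> * c (v, \<zero>)"
    using uv C.functional_add[OF c, of "(u, \<zero>)" "\<i> \<odot>\<^bsub>cplx U\<^esub> (v, \<zero>)"] C.functional_smult[OF c, of "(v, \<zero>)" \<i>]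
    by (metis (no_types, lifting) C.scl SigmaI cplx_simps(1) zero_closed)
  then show ?thesis using uv yy
    by (simp add: capp_def rank_one_def minus_smult smult_ladd smult_lminus smult_radd smult_smult a_ac)
qed

text \<open>
  For \<open>q > d\<close> the subspace \<open>F\<^sup>q\<close> is mapped to \<open>0\<close>; for \<open>q \<le> d\<close> the image lies in the line of \<open>y\<close>, and
  \<open>F\<^sup>a \<subseteq> F\<^sup>q\<^sup>+\<^sup>a\<^sup>-\<^sup>d\<close>.
\<close>

lemma rank_one_Ffil:
  assumes c: "functional (cplx U) c" and d: "\<And>p z. z \<in> Ffil U p \<Longrightarrow> d < p \<Longrightarrow> c z = 0"
    and y: "y \<in> Ffil U a" and anti: "\<And>p q. p \<le> q \<Longrightarrow> Ffil U q \<subseteq> Ffil U p"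
  shows "rank_one c y \<in> Ffil (End_qmhs U) (a - d)"
proof -
  note yC = Ffil_carrier[OF y]
  have "capp U (rank_one c y) z \<in> Ffil U (q + (a - d))" if z: "z \<in> Ffil U q" for z q
  proof (cases "d < q")
    case True
    then show ?thesis unfolding capp_rank_one[OF c yC Ffil_carrier[OF z]] 
      using d[OF z] C.subspD(2)[OF F_sub] yC by simp
  next
    case False
    then have "y \<in> Ffil U (q + (a - d))" using anti[of "q + (a - d)" a] y by auto
    then show ?thesis unfolding capp_rank_one[OF c yC Ffil_carrier[OF z]] by (rule C.subspD(4)[OF F_sub])
  qed
  then show ?thesis using rank_one_closed[OF c yC] unfolding Ffil_End by blast
qed

text \<open>
  The extension of \<open>y \<mapsto> c \<otimes> y\<close> to a map from \<open>(U \<otimes> \<S>) \<otimes> \<complex>\<close> to \<open>(End U \<otimes> \<S>) \<otimes> \<complex>\<close>.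
\<close>

definition rank_one_ext :: "('a \<times> 'a \<Rightarrow> complex) \<Rightarrow> (nat \<Rightarrow> 'a) \<times> (nat \<Rightarrow> 'a) \<Rightarrow> (nat \<Rightarrow> 'a \<Rightarrow> 'a) \<times> (nat \<Rightarrow> 'a \<Rightarrow> 'a)" where
  "rank_one_ext c Z = (\<lambda>k. fst (rank_one c (ccoef k Z)), \<lambda>k. snd (rank_one c (ccoef k Z)))"

lemma ccoef_rank_one_ext: "ccoef k (rank_one_ext c Z) = rank_one c (ccoef k Z)"
  by (simp add: rank_one_ext_def ccoef_def[of k "(_, _)"])

lemma ccoef_closed: "Z \<in> carrier (cplx (S_vs U)) \<Longrightarrow> ccoef k Z \<in> carrier (cplx U)"
  by (auto simp: ccoef_def)

lemma rank_one_lin: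
  assumes c: "functional (cplx U) c"
  shows "rank_one c \<in> lin (cplx U) (cplx (End_qmhs U))"
proof (rule linI)
  show "rank_one c y \<in> carrier (cplx (End_qmhs U))" if "y \<in> carrier (cplx U)" for y
    by (rule rank_one_closed[OF c that])
  show "rank_one c (x \<oplus>\<^bsub>cplx U\<^esub> y) = rank_one c x \<oplus>\<^bsub>cplx (End_qmhs U)\<^esub> rank_one c y"
    if "x \<in> carrier (cplx U)" "y \<in> carrier (cplx U)" for x y
    using that by (auto intro!: ext simp: rank_one_def End_simps(3) smult_radd minus_smult smult_smult a_ac)
  show "rank_one c (r \<odot>\<^bsub>cplx U\<^esub> y) = r \<odot>\<^bsub>cplx (End_qmhs U)\<^esub> rank_one c y"
    if y: "y \<in> carrier (cplx U)" for r y
  proof -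
    obtain y1 y2 where yy: "y = (y1, y2)" "y1 \<in> carrier U" "y2 \<in> carrier U" using y by auto
    obtain A B where AB: "rank_one c y = (A, B)" "A \<in> carrier (End_qmhs U)" "B \<in> carrier (End_qmhs U)"
      using rank_one_closed[OF c y] by (cases "rank_one c y") auto
    have A: "A v = fst (c (v, \<zero>) \<odot>\<^bsub>cplx U\<^esub> y)" and B: "B v = snd (c (v, \<zero>) \<odot>\<^bsub>cplx U\<^esub> y)"
      if "v \<in> carrier U" for v using AB(1) that by (auto simp: rank_one_def)
    have undef: "(A' \<ominus>\<^bsub>End_qmhs U\<^esub> B') v = undefined" if "A' \<in> carrier (End_qmhs U)" "B' \<in> carrier (End_qmhs U)" "v \<notin> carrier U" for A' B' v
      using that by (intro End_ext) auto
    show ?thesis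
    proof (rule prod_eqI; rule HOL.ext)
      fix v
      show "fst (rank_one c (r \<odot>\<^bsub>cplx U\<^esub> y)) v = fst (r \<odot>\<^bsub>cplx (End_qmhs U)\<^esub> rank_one c y) v"
      proof (cases "v \<in> carrier U")
        case True
        have "fst (rank_one c (r \<odot>\<^bsub>cplx U\<^esub> y)) v = Re r \<odot> A v \<ominus> Im r \<odot> B v"
          unfolding A[OF True] B[OF True] using yy True
          by (simp add: rank_one_def smult_radd minus_smult smult_smult a_ac mult.commute)
        then show ?thesis using AB True by (simp add: End_apply)
      next
        case False then show ?thesis using AB by (simp add: undef rank_one_def)
      qed
      show "snd (rank_one c (r \<odot>\<^bsub>cplx U\<^esub> y)) v = snd (r \<odot>\<^bsub>cplx (End_qmhs U)\<^esub> rank_one c y) v"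
      proof (cases "v \<in> carrier U")
        case True
        have "snd (rank_one c (r \<odot>\<^bsub>cplx U\<^esub> y)) v = Re r \<odot> B v \<oplus> Im r \<odot> A v"
          unfolding A[OF True] B[OF True] using yy True
          by (simp add: rank_one_def smult_radd minus_smult smult_smult a_ac mult.commute)
        then show ?thesis using AB True by (simp add: End_apply)
      next
        case False then show ?thesis using AB by (simp add: rank_one_def End_simps(3))
      qed
    qed
  qed
qed

lemma rank_one_ext_lin:
  assumes c: "functional (cplx U) c"
  shows "rank_one_ext c \<in> lin (cplx (S_vs U)) (cplx (S_vs (End_qmhs U)))"
proof -
  interpret r: linmap "cplx U" "cplx (End_qmhs U)" "rank_one c" by unfold_locales (rule rank_one_lin[OF c])
  interpret k: linmap "cplx (S_vs U)" "cplx U" "ccoef k" for k by unfold_locales (rule ccoef_lin)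
  interpret Ek: linmap "cplx (S_vs (End_qmhs U))" "cplx (End_qmhs U)" "ccoef k" for k by unfold_locales (rule E.ccoef_lin)
  have cl: "rank_one_ext c Z \<in> carrier (cplx (S_vs (End_qmhs U)))" if Z: "Z \<in> carrier (cplx (S_vs U))" for Z
  proof -
    obtain f g where fg: "Z = (f, g)" "f \<in> carrier (S_vs U)" "g \<in> carrier (S_vs U)" using Z by auto
    obtain N where N: "\<And>k. k \<ge> N \<Longrightarrow> f k = \<zero>" using S_vs_bound[OF fg(2)] by metis
    obtain N' where N': "\<And>k. k \<ge> N' \<Longrightarrow> g k = \<zero>" using S_vs_bound[OF fg(3)] by metis
    have *: "rank_one c (ccoef k Z) \<in> carrier (cplx (End_qmhs U))" for k by (rule r.closed) (rule k.closed[OF Z])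
    have **: "rank_one c (ccoef k Z) = \<zero>\<^bsub>cplx (End_qmhs U)\<^esub>" if "k \<ge> max N N'" for k
      using that r.zero by (simp add: ccoef_def fg N N')
    have "fst (rank_one_ext c Z) \<in> carrier (S_vs (End_qmhs U))"
      unfolding rank_one_ext_def fst_conv
      by (rule S_vs_carrierI[of _ _ "max N N'"]) (use * ** in \<open>simp_all add: mem_Times_iff\<close>)
    moreover have "snd (rank_one_ext c Z) \<in> carrier (S_vs (End_qmhs U))"
      unfolding rank_one_ext_def snd_conv
      by (rule S_vs_carrierI[of _ _ "max N N'"]) (use * ** in \<open>simp_all add: mem_Times_iff\<close>)
    ultimately show ?thesis by (simp add: mem_Times_iff)
  qed
  show ?thesis
    by (rule linI; (rule ccoef_eqI)?) (simp_all add: cl ccoef_rank_one_ext k.add k.smult Ek.add Ek.smult r.add r.smult del: cplx_simps)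
qed

lemma rank_one_ext_ctens:
  assumes c: "functional (cplx U) c" and y: "y \<in> carrier (cplx U)"
  shows "rank_one_ext c (ctens U y w) = ctens (End_qmhs U) (rank_one c y) w"
proof -
  interpret r: linmap "cplx U" "cplx (End_qmhs U)" "rank_one c" by unfold_locales (rule rank_one_lin[OF c])
  show ?thesis
    by (rule ccoef_eqI) (simp only: ccoef_rank_one_ext ccoef_ctens[OF y] E.ccoef_ctens[OF rank_one_closed[OF c y]] r.smult[OF y])
qed

end

context endo_fvs begin

lemma frameD:
  assumes "frame U N b c d"
  shows "j < N \<Longrightarrow> b j \<in> Ffil U (d j)" "j < N \<Longrightarrow> b j \<in> carrier (cplx U)"
    "j < N \<Longrightarrow> functional (cplx U) (c j)"
    "z \<in> carrier (cplx U) \<Longrightarrow> z = (\<Oplus>\<^bsub>cplx U\<^esub>j\<in>{..<N}. c j z \<odot>\<^bsub>cplx U\<^esub> b j)"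
    "j < N \<Longrightarrow> z \<in> Ffil U p \<Longrightarrow> d j < p \<Longrightarrow> c j z = 0"
  using assms Ffil_carrier[of "b j" "d j"] unfolding frame_def by blast+

lemma frame_determines_endomorphism:
  assumes fr: "frame U N b c d" and v: "v \<in> carrier U" and A: "A \<in> lin U U"
  shows "(A v, \<zero>) = (\<Oplus>\<^bsub>cplx U\<^esub>j\<in>{..<N}. c j (v, \<zero>) \<odot>\<^bsub>cplx U\<^esub> map_prod A A (b j))"
proof -
  interpret A: linmap U U A by unfold_locales (rule A)
  interpret AA: linmap "cplx U" "cplx U" "map_prod A A"
    by unfold_locales (rule map_prod_lin[OF vs vs A])
  have bC: "b j \<in> carrier (cplx U)" if "j < N" for j by (rule frameD(2)[OF fr that])
  have vz: "(v, \<zero>) \<in> carrier (cplx U)" using v by simp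
  have "(v, \<zero>) = (\<Oplus>\<^bsub>cplx U\<^esub>j\<in>{..<N}. c j (v, \<zero>) \<odot>\<^bsub>cplx U\<^esub> b j)"
    by (rule frameD(4)[OF fr vz])
  then have "map_prod A A (v, \<zero>) = map_prod A A (\<Oplus>\<^bsub>cplx U\<^esub>j\<in>{..<N}. c j (v, \<zero>) \<odot>\<^bsub>cplx U\<^esub> b j)"
    by (rule arg_cong[of _ _ "map_prod A A"])
  also have "\<dots> = (\<Oplus>\<^bsub>cplx U\<^esub>j\<in>{..<N}. map_prod A A (c j (v, \<zero>) \<odot>\<^bsub>cplx U\<^esub> b j))"
    by (rule AA.finsum) (use bC in \<open>simp del: cplx_simps\<close>)
  also have "\<dots> = (\<Oplus>\<^bsub>cplx U\<^esub>j\<in>{..<N}. c j (v, \<zero>) \<odot>\<^bsub>cplx U\<^esub> map_prod A A (b j))"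
    by (rule C.finsum_cong') (use bC in \<open>auto simp: AA.smult simp del: cplx_simps map_prod_simp\<close>)
  finally show ?thesis by simp
qed

text \<open>
  The coefficients of \<open>g - 1\<close> at constants give \<open>e\<close>.  Only finitely many are nonzero, since an
  endomorphism is determined by its values at the finitely many \<open>b j\<close>.  To see that \<open>e\<close> has degree \<open>0\<close>
  for \<open>F\<close>, expand it as \<open>e = \<Sum>\<^sub>j c\<^sub>j \<otimes> e(b\<^sub>j)\<close>.  Since \<open>g\<close> respects \<open>F\<close>, the element \<open>e(b\<^sub>j)\<close> of \<open>U \<otimes> \<S>\<close> has
  degree \<open>d\<^sub>j\<close>, and \<open>y \<mapsto> c\<^sub>j \<otimes> y\<close> lowers degrees by \<open>d\<^sub>j\<close> (\<open>rank_one_Ffil\<close>).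
\<close>

lemma unip_is_act:
  assumes anti: "\<And>p q. p \<le> q \<Longrightarrow> Ffil U q \<subseteq> Ffil U p"
    and fr: "frame U N b c d" and g: "g \<in> S_unip U"
  obtains e where "e \<in> Wfil (tensor_S (End_qmhs U)) (- 1) \<inter> gam 0 (tensor_S (End_qmhs U))"
    "g = (\<lambda>f\<in>carrier (S_vs U). f \<oplus>\<^bsub>S_vs U\<^esub> End_act U e f)"
proof -
  let ?E = "End_qmhs U"
  have gh: "g \<in> S_hom U U" using g by (simp add: S_unip_def)
  have gl: "g \<in> S_lin U U" using gh by (simp add: S_hom_def)
  interpret g: linmap "S_vs U" "S_vs U" g by unfold_locales (rule S_hom_lin[OF gh])
  define ev where "ev v = g (tens U v 1) \<ominus>\<^bsub>S_vs U\<^esub> tens U v 1" for v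
  have tc: "tens U v s \<in> carrier (S_vs U)" if "v \<in> carrier U" for v s by (rule tens_closed[OF vs that])
  have ev: "ev v \<in> carrier (S_vs U)" if "v \<in> carrier U" for v
    unfolding ev_def by (intro S.minus_closed g.closed tc that)
  \<comment> \<open>\<open>g - 1\<close> on constants is \<open>ev\<close>, with coefficients
    \<open>e k\<close>\<close>
  define e where "e k = (\<lambda>v\<in>carrier U. ev v k)" for k
  have e_app: "e k v = ev v k" if "v \<in> carrier U" for k v using that by (simp add: e_def)
  have ev_lin: "ev \<in> lin U (S_vs U)"
    by (rule linI, erule ev)
      (simp_all add: ev_def tens_add_left[OF vs] tens_smult_left[OF vs] g.add g.smult tc
        S.minus_smult S.smult_radd S.smult_smult S.a_ac mult.commute del: S_vs_simps)
  interpret ev: linmap U "S_vs U" ev by unfold_locales (rule ev_lin)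
  have eE: "e k \<in> carrier ?E" for k
    unfolding e_def by (rule EndI) (use ev in \<open>simp_all add: ev.add ev.smult\<close>)
  have eL: "e k \<in> lin U U" for k using eE by (simp add: End_simps)
  have bC: "b j \<in> carrier (cplx U)" if "j < N" for j by (rule frameD(2)[OF fr that])
  have cj: "functional (cplx U) (c j)" if "j < N" for j by (rule frameD(3)[OF fr that])
  have "\<exists>K. \<forall>j<N. \<forall>k\<ge>K. map_prod (e k) (e k) (b j) = \<zero>\<^bsub>cplx U\<^esub>"
  proof -
    have "\<exists>K. \<forall>k\<ge>K. map_prod (e k) (e k) (b j) = \<zero>\<^bsub>cplx U\<^esub>" if j: "j < N" for j
    proof -
      obtain u v where uv: "b j = (u, v)" "u \<in> carrier U" "v \<in> carrier U" using bC[OF j] by auto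
      obtain K where K: "\<And>k. k \<ge> K \<Longrightarrow> ev u k = \<zero>" using S_vs_bound[OF ev[OF uv(2)]] by metis
      obtain K' where K': "\<And>k. k \<ge> K' \<Longrightarrow> ev v k = \<zero>" using S_vs_bound[OF ev[OF uv(3)]] by metis
      show ?thesis by (rule exI[of _ "max K K'"]) (simp add: uv e_app K K')
    qed
    then obtain K where "\<And>j k. j < N \<Longrightarrow> k \<ge> K j \<Longrightarrow> map_prod (e k) (e k) (b j) = \<zero>\<^bsub>cplx U\<^esub>" by metis
    moreover have "K j \<le> Max (insert 0 (K ` {..<N}))" if "j < N" for j using that by (intro Max_ge) auto
    ultimately show ?thesis by (intro exI[of _ "Max (insert 0 (K ` {..<N}))"]) (meson le_trans)
  qed
  then obtain K where K: "\<And>j k. j < N \<Longrightarrow> k \<ge> K \<Longrightarrow> map_prod (e k) (e k) (b j) = \<zero>\<^bsub>cplx U\<^esub>" by blast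
  have eC: "e \<in> carrier (S_vs ?E)"
  proof (rule S_vs_carrierI[OF eE])
    fix k assume k: "K \<le> k"
    have "e k v = \<zero>" if v: "v \<in> carrier U" for v
    proof -
      have "(e k v, \<zero>) = (\<Oplus>\<^bsub>cplx U\<^esub>j\<in>{..<N}. c j (v, \<zero>) \<odot>\<^bsub>cplx U\<^esub> map_prod (e k) (e k) (b j))"
        by (rule frame_determines_endomorphism[OF fr v eL])
      also have "\<dots> = (\<Oplus>\<^bsub>cplx U\<^esub>j\<in>{..<N}. \<zero>\<^bsub>cplx U\<^esub>)"
        by (rule C.finsum_cong') (use K[OF _ k] C.zero_closed C.smult_zero in \<open>auto simp del: cplx_simps map_prod_simp\<close>)
      also have "\<dots> = \<zero>\<^bsub>cplx U\<^esub>" by (rule C.finsum_zero)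
      finally show ?thesis by simp
    qed
    then show "e k = \<zero>\<^bsub>?E\<^esub>" by (auto intro!: HOL.ext simp: End_simps(2) e_def)
  qed
  have geq: "g = (\<lambda>f\<in>carrier (S_vs U). f \<oplus>\<^bsub>S_vs U\<^esub> End_act U e f)"
  proof (rule HOL.ext)
    fix f
    have "(\<lambda>f. f) \<in> S_lin U U" by (auto simp: S_lin_def intro!: linI)
    note h = S_lin_add[OF vs vs this act_S_lin[OF eC]]
    have "g f = f \<oplus>\<^bsub>S_vs U\<^esub> End_act U e f" if f: "f \<in> carrier (S_vs U)"
    proof (rule S_lin_eqI[OF vs vs gl h _ f])
      fix v assume v: "v \<in> carrier U"
      have "End_act U e (tens U v 1) = ev v" unfolding act_const[OF eC v] e_app[OF v] ..
      then show "g (tens U v 1) = tens U v 1 \<oplus>\<^bsub>S_vs U\<^esub> End_act U e (tens U v 1)"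
        using tc[OF v] by (simp add: ev_def del: S_vs_simps)
    qed
    moreover have "g f = undefined" if "f \<notin> carrier (S_vs U)" using gh that by (auto simp: S_hom_def extensional_def)
    ultimately show "g f = (\<lambda>f\<in>carrier (S_vs U). f \<oplus>\<^bsub>S_vs U\<^esub> End_act U e f) f" by (simp del: S_vs_simps)
  qed
  have "e k \<in> Wfil ?E (- 1)" for k
  proof -
    have "e k v \<in> Wfil U (n - 1)" if v: "v \<in> Wfil U n" for v n
    proof -
      have "tens U v 1 \<in> Wfil (tensor_S U) n"
      proof -
        have "tens U v 1 k \<in> Wfil U n" for k unfolding tens_def by (rule subspD(4)[OF W_sub v])
        then show ?thesis using tc[OF Wfil_carrier[OF v]] by (simp add: Wfil_tensor)
      qed
      then have "ev v \<in> Wfil (tensor_S U) (n - 1)" using g by (auto simp: S_unip_def ev_def)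
      then show ?thesis using e_app Wfil_carrier[OF v] by (simp add: Wfil_tensor)
    qed
    then show ?thesis using eE by (auto simp: End_simps)
  qed
  then have eW: "e \<in> Wfil (tensor_S ?E) (- 1)" using eC by (simp add: fvs.Wfil_tensor[OF End_fvs])
  have EF: "subsp (Ffil (tensor_S ?E) 0) (cplx (S_vs ?E))" by (rule fvs.Ffil_tensor_sub[OF End_fvs])
  let ?X = "\<lambda>j. map_prod ev ev (b j)"
  have XF: "?X j \<in> Ffil (tensor_S U) (d j)" if j: "j < N" for j
  proof -
    obtain u v where uv: "b j = (u, v)" "u \<in> carrier U" "v \<in> carrier U" using bC[OF j] by auto
    have "ctens U (b j) (1, 0) \<in> Ffil (tensor_S U) (d j)"
      using one_in_Ffil_S by (intro Ffil_tensor_gen[OF frameD(1)[OF fr j]]) simp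
    moreover have "ctens U (b j) (1, 0) = (tens U u 1, tens U v 1)"
      using uv by (simp add: ctens_def tens_zero_right[OF vs] tc del: S_vs_simps)
    ultimately have *: "(tens U u 1, tens U v 1) \<in> Ffil (tensor_S U) (d j)" by simp
    have "?X j = map_prod g g (tens U u 1, tens U v 1) \<ominus>\<^bsub>cplx (S_vs U)\<^esub> (tens U u 1, tens U v 1)"
      using uv tc by (simp add: ev_def cplx_minus[OF S.is_vsp])
    then show ?thesis using CS.subspD(5)[OF Ffil_tensor_sub S_hom_F[OF gh *] *] by simp
  qed
  have RF: "rank_one_ext (c j) (?X j) \<in> Ffil (tensor_S ?E) 0" if j: "j < N" for j
  proof -
    have "rank_one_ext (c j) ` Ffil (tensor_S U) (d j) \<subseteq> Ffil (tensor_S ?E) 0"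
    proof (rule Ffil_tensor_image[OF E.CS.is_vsp rank_one_ext_lin[OF cj[OF j]] EF])
      fix a y w assume y: "y \<in> Ffil U a" and w: "w \<in> Ffil S_ring (d j - a)"
      have "rank_one (c j) y \<in> Ffil ?E (a - d j)"
        by (rule rank_one_Ffil[OF cj[OF j] frameD(5)[OF fr j] y anti])
      moreover have "w \<in> Ffil S_ring (0 - (a - d j))" using w by simp
      ultimately show "rank_one_ext (c j) (ctens U y w) \<in> Ffil (tensor_S ?E) 0"
        unfolding rank_one_ext_ctens[OF cj[OF j] Ffil_carrier[OF y]]
        by (rule fvs.Ffil_tensor_gen[OF End_fvs])
    qed
    then show ?thesis using XF[OF j] by blast
  qed
  have XC: "?X j \<in> carrier (cplx (S_vs U))" if "j < N" for j using CS.subspD(6)[OF Ffil_tensor_sub XF[OF that]] .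
  let ?Y = "\<Oplus>\<^bsub>cplx (S_vs ?E)\<^esub>j\<in>{..<N}. rank_one_ext (c j) (?X j)"
  have RC: "rank_one_ext (c j) (?X j) \<in> carrier (cplx (S_vs ?E))" if "j < N" for j
    using E.CS.subspD(6)[OF EF RF[OF that]] .
  have YF: "?Y \<in> Ffil (tensor_S ?E) 0" by (rule E.CS.subsp_finsum[OF EF]) (use RF in simp)
  have YC: "?Y \<in> carrier (cplx (S_vs ?E))" using E.CS.subspD(6)[OF EF YF] .
  \<comment> \<open>\<open>?Y\<close> is the expansion of \<open>e\<close>; both sides are
    compared by their values at each real vector \<open>v\<close>.\<close>
  have "?Y = (e, \<zero>\<^bsub>S_vs ?E\<^esub>)"
  proof (rule ccoef_eqI)
    fix k
    interpret k: linmap "cplx (S_vs ?E)" "cplx ?E" "ccoef k" by unfold_locales (rule E.ccoef_lin)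
    have 1: "ccoef k ?Y = (\<Oplus>\<^bsub>cplx ?E\<^esub>j\<in>{..<N}. rank_one (c j) (ccoef k (?X j)))" (is "_ = ?S")
      by (subst k.finsum) (use RC in \<open>auto simp: ccoef_rank_one_ext simp del: cplx_simps\<close>)
    have rC: "rank_one (c j) (ccoef k (?X j)) \<in> carrier (cplx ?E)" if "j < N" for j
      by (rule rank_one_closed[OF cj[OF that] ccoef_closed[OF XC[OF that]]])
    have SC: "?S \<in> carrier (cplx ?E)" by (rule E.C.finsum_closed) (use rC in auto)
    have 2: "capp U ?S (v, \<zero>) = (e k v, \<zero>)" if v: "v \<in> carrier U" for v
    proof -
      have vz: "(v, \<zero>) \<in> carrier (cplx U)" using v by simp
      interpret a: linmap "cplx ?E" "cplx U" "\<lambda>P. capp U P (v, \<zero>)" by unfold_locales (rule capp_lin[OF vz])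
      have "capp U ?S (v, \<zero>) = (\<Oplus>\<^bsub>cplx U\<^esub>j\<in>{..<N}. capp U (rank_one (c j) (ccoef k (?X j))) (v, \<zero>))"
        by (rule a.finsum) (use rC in simp)
      also have "\<dots> = (\<Oplus>\<^bsub>cplx U\<^esub>j\<in>{..<N}. c j (v, \<zero>) \<odot>\<^bsub>cplx U\<^esub> map_prod (e k) (e k) (b j))"
      proof (rule C.finsum_cong')
        fix j assume "j \<in> {..<N}"
        then have j: "j < N" by simp
        obtain u w where uw: "b j = (u, w)" "u \<in> carrier U" "w \<in> carrier U" using bC[OF j] by auto
        have "ccoef k (?X j) = map_prod (e k) (e k) (b j)" using uw by (simp add: ccoef_def e_app)
        then show "capp U (rank_one (c j) (ccoef k (?X j))) (v, \<zero>) = c j (v, \<zero>) \<odot>\<^bsub>cplx U\<^esub> map_prod (e k) (e k) (b j)"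
          using capp_rank_one[OF cj[OF j] ccoef_closed[OF XC[OF j]] vz, of k] by metis
      next
        show "(\<lambda>j. c j (v, \<zero>) \<odot>\<^bsub>cplx U\<^esub> map_prod (e k) (e k) (b j)) \<in> {..<N} \<rightarrow> carrier (cplx U)"
        proof
          fix j assume "j \<in> {..<N}"
          then have "map_prod (e k) (e k) (b j) \<in> carrier (cplx U)"
            using bC[of j] End_closed[OF eE] by (cases "b j") auto
          then show "c j (v, \<zero>) \<odot>\<^bsub>cplx U\<^esub> map_prod (e k) (e k) (b j) \<in> carrier (cplx U)" by (rule C.scl)
        qed
      qed simp
      also have "\<dots> = (e k v, \<zero>)" by (rule frame_determines_endomorphism[OF fr v eL, symmetric])
      finally show ?thesis .
    qed
    obtain A B where AB: "?S = (A, B)" "A \<in> carrier ?E" "B \<in> carrier ?E" using SC by auto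
    have "A = e k"
    proof (rule HOL.ext)
      fix v show "A v = e k v"
      proof (cases "v \<in> carrier U")
        case True
        have "capp U (A, B) (v, \<zero>) = (A v, B v)"
          using End_closed[OF AB(2) True] End_closed[OF AB(3) True] by (simp add: capp_def End_zero[OF AB(2)] End_zero[OF AB(3)])
        then show ?thesis using 2[OF True] unfolding AB(1) by simp
      next
        case False then show ?thesis using End_ext[OF AB(2)] End_ext[OF eE] by simp
      qed
    qed
    moreover have "B = \<zero>\<^bsub>?E\<^esub>"
    proof (rule HOL.ext)
      fix v show "B v = \<zero>\<^bsub>?E\<^esub> v"
      proof (cases "v \<in> carrier U")
        case True
        have "capp U (A, B) (v, \<zero>) = (A v, B v)"
          using End_closed[OF AB(2) True] End_closed[OF AB(3) True] by (simp add: capp_def End_zero[OF AB(2)] End_zero[OF AB(3)])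
        then show ?thesis using 2[OF True] True unfolding AB(1) by (simp add: End_simps(2))
      next
        case False then show ?thesis using End_ext[OF AB(3)] by (simp add: End_simps(2))
      qed
    qed
    ultimately show "ccoef k ?Y = ccoef k (e, \<zero>\<^bsub>S_vs ?E\<^esub>)" using 1 AB(1) by (simp add: ccoef_def[of k "(e, _)"])
  qed
  then have "e \<in> gam 0 (tensor_S ?E)" using YF eC by (simp add: gam_def)
  then show ?thesis using that eW geq by blast
qed

end

section \<open>Real polynomials approximating \<open>\<i>\<close>, and extension of complex filtered maps\<close>

text \<open>
  The pair \<open>(s, - 1)\<close> stands for \<open>s - \<i>\<close>.  Starting from \<open>s = x\<close>, apply Newton's iteration for \<open>s\<^sup>2 + 1 = 0\<close>
  with the factor \<open>1 / (2s)\<close> replaced by its approximation \<open>- s / 2\<close>: the identity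
  \<open>(s\<^sup>3 + 3s) / 2 - \<i> = (s - \<i>)\<^sup>2 (s + 2\<i>) / 2\<close> shows that each step doubles the order of vanishing at \<open>\<i>\<close>.
\<close>

lemma real_poly_approximates_i: "\<exists>s. [:- \<i>, 1:] ^ n dvd cpoly (s, - 1)"
proof (induction n)
  case 0 then show ?case by simp
next
  case (Suc n)
  show ?case
  proof (cases n)
    case 0
    have "cpoly ([:0, 1:], - 1) = [:- \<i>, 1:]"
      by (rule poly_eqI) (auto simp: coeff_cpoly coeff_pCons complex_eq_iff split: nat.split)
    then show ?thesis using 0 by (metis One_nat_def dvd_refl power_one_right)
  next
    case (Suc m)
    obtain s where s: "[:- \<i>, 1:] ^ n dvd cpoly (s, - 1)" using Suc.IH by blast
    let ?R = "map_poly complex_of_real s"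
    define t where "t = Polynomial.smult (1/2) (s ^ 3) + Polynomial.smult (3/2) s"
    have mult: "map_poly complex_of_real (p * q) = map_poly complex_of_real p * map_poly complex_of_real q" for p q
      using cpoly_mult[of "(p, 0)" "(q, 0)"] by (simp add: cpoly_def cpmult_def)
    have add: "map_poly complex_of_real (p + q) = map_poly complex_of_real p + map_poly complex_of_real q" for p q
      by (rule poly_eqI) (simp add: coeff_map_poly)
    have sm: "map_poly complex_of_real (Polynomial.smult r p) = Polynomial.smult (of_real r) (map_poly complex_of_real p)" for r p
      by (rule poly_eqI) (simp add: coeff_map_poly)
    have c: "cpoly (p, - 1) = map_poly complex_of_real p - [:\<i>:]" for p
      by (rule poly_eqI) (simp add: coeff_cpoly coeff_map_poly coeff_pCons complex_eq_iff split: nat.split)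
    have "cpoly (t, - 1) = cpoly (s, - 1) * cpoly (s, - 1) * Polynomial.smult (1/2) (?R + [:2 * \<i>:])"
      unfolding c t_def add sm power3_eq_cube mult
    proof (rule poly_eq_poly_eq_iff[THEN iffD1], rule ext)
      fix x
      define y where "y = poly ?R x"
      have ii: "\<i> * \<i> = - 1" by simp
      have "(y - j) * (y - j) * (y + 2 * j) = y * y * y - 3 * (j * j) * y + 2 * (j * j) * j" for j
        by (simp add: algebra_simps)
      from this[of \<i>] have "y * y * y + 3 * y - 2 * \<i> = (y - \<i>) * (y - \<i>) * (y + 2 * \<i>)"
        by (simp only: ii) simp
      then have "(1/2) * (y * y * y + 3 * y - 2 * \<i>) = (1/2) * ((y - \<i>) * (y - \<i>) * (y + 2 * \<i>))"
        by (rule arg_cong)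
      then have "(1/2) * (y * y * y) + (3/2) * y - \<i> = (y - \<i>) * (y - \<i>) * ((1/2) * (y + 2 * \<i>))"
        by (simp only: distrib_left right_diff_distrib mult.left_commute[of "1/2"]) simp
      moreover have "complex_of_real (1/2) = 1/2" "complex_of_real (3/2) = 3/2" by simp_all
      moreover have "poly [:\<i>:] x = \<i>" "poly [:2 * \<i>:] x = 2 * \<i>" by simp_all
      ultimately show "poly (Polynomial.smult (complex_of_real (1/2)) (?R * ?R * ?R) + Polynomial.smult (complex_of_real (3/2)) ?R - [:\<i>:]) x
          = poly ((?R - [:\<i>:]) * (?R - [:\<i>:]) * Polynomial.smult (1/2) (?R + [:2 * \<i>:])) x"
        by (simp only: y_def poly_add poly_diff poly_mult poly_smult)
    qed
    moreover have "[:- \<i>, 1:] ^ (n + n) dvd cpoly (s, - 1) * cpoly (s, - 1)"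
      unfolding power_add using s by (rule mult_dvd_mono) (rule s)
    ultimately have "[:- \<i>, 1:] ^ (n + n) dvd cpoly (t, - 1)" by (simp only: dvd_mult2)
    moreover have "[:- \<i>, 1:] ^ Suc n dvd [:- \<i>, 1:] ^ (n + n)" using Suc by (intro le_imp_power_dvd) simp
    ultimately have "[:- \<i>, 1:] ^ Suc n dvd cpoly (t, - 1)" by (rule dvd_trans[rotated])
    then show ?thesis by (rule exI)
  qed
qed

definition re_part :: "('a, 'm) ring_scheme \<Rightarrow> ('a \<times> 'a \<Rightarrow> 'b \<times> 'b) \<Rightarrow> 'a \<Rightarrow> 'b" where
  "re_part V \<tau> v = fst (\<tau> (v, \<zero>\<^bsub>V\<^esub>))"
definition im_part :: "('a, 'm) ring_scheme \<Rightarrow> ('a \<times> 'a \<Rightarrow> 'b \<times> 'b) \<Rightarrow> 'a \<Rightarrow> 'b" where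
  "im_part V \<tau> v = snd (\<tau> (v, \<zero>\<^bsub>V\<^esub>))"

text \<open>
  For a complex linear map \<open>\<tau> = A + \<i>B\<close> with \<open>A\<close> and \<open>B\<close> real, this is \<open>A + sB\<close>.
\<close>

definition S_extension :: "'a qmhs \<Rightarrow> 'b qmhs \<Rightarrow> real poly \<Rightarrow> ('a \<times> 'a \<Rightarrow> 'b \<times> 'b) \<Rightarrow> (nat \<Rightarrow> 'a) \<Rightarrow> nat \<Rightarrow> 'b" where
  "S_extension V U s \<tau> = (\<lambda>f\<in>carrier (S_vs V). (\<lambda>k. re_part V \<tau> (f k)) \<oplus>\<^bsub>S_vs U\<^esub>
      s \<odot>\<^bsub>S_module U\<^esub> (\<lambda>k. im_part V \<tau> (f k)))"

text \<open>
  The bounds \<open>hi\<close> and \<open>lo\<close> say how far up \<open>F\<close> reaches in \<open>V\<close> and from where on it is everything in \<open>U\<close>; a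
  factor that vanishes to order \<open>hi - lo\<close> at \<open>\<i>\<close> makes up for any difference of degrees between the two.
\<close>

locale S_ext = V: fvs V + U: fvs U for V :: "'a qmhs" and U :: "'b qmhs" +
  fixes \<tau> s hi lo
  assumes \<tau>: "\<tau> \<in> lin (cplx V) (cplx U)"
    and \<tau>_F: "\<And>p z. z \<in> Ffil V p \<Longrightarrow> \<tau> z \<in> Ffil U p"
    and \<tau>_W: "\<And>n z. z \<in> Wfil V n \<times> Wfil V n \<Longrightarrow> \<tau> z \<in> Wfil U n \<times> Wfil U n"
    and V_anti: "\<And>p q. p \<le> q \<Longrightarrow> Ffil V q \<subseteq> Ffil V p" and V_top: "Ffil V hi = {\<zero>\<^bsub>cplx V\<^esub>}"
    and U_low: "Ffil U lo = carrier (cplx U)"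
    and s: "[:- \<i>, 1:] ^ nat (hi - lo) dvd cpoly (s, - 1)"
begin

interpretation \<tau>: linmap "cplx V" "cplx U" \<tau> by unfold_locales (rule \<tau>)

abbreviation "A \<equiv> re_part V \<tau>"
abbreviation "B \<equiv> im_part V \<tau>"

lemma \<tau>_real: "v \<in> carrier V \<Longrightarrow> \<tau> (v, \<zero>\<^bsub>V\<^esub>) = (A v, B v)"
  by (simp add: re_part_def im_part_def)

lemma A_lin: "A \<in> lin V U" and B_lin: "B \<in> lin V U"
proof -
  have a: "\<tau> (u \<oplus>\<^bsub>V\<^esub> v, \<zero>\<^bsub>V\<^esub>) = \<tau> (u, \<zero>\<^bsub>V\<^esub>) \<oplus>\<^bsub>cplx U\<^esub> \<tau> (v, \<zero>\<^bsub>V\<^esub>)" if "u \<in> carrier V" "v \<in> carrier V" for u v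
    using \<tau>.add[of "(u, \<zero>\<^bsub>V\<^esub>)" "(v, \<zero>\<^bsub>V\<^esub>)"] that by simp
  have c: "\<tau> (r \<odot>\<^bsub>V\<^esub> v, \<zero>\<^bsub>V\<^esub>) = of_real r \<odot>\<^bsub>cplx U\<^esub> \<tau> (v, \<zero>\<^bsub>V\<^esub>)" if "v \<in> carrier V" for v r
    using \<tau>.smult[of "(v, \<zero>\<^bsub>V\<^esub>)" "of_real r"] that by simp
  have cl: "A v \<in> carrier U \<and> B v \<in> carrier U" if "v \<in> carrier V" for v
    using \<tau>.closed[of "(v, \<zero>\<^bsub>V\<^esub>)"] that by (simp add: \<tau>_real)
  have ab: "(A (u \<oplus>\<^bsub>V\<^esub> v), B (u \<oplus>\<^bsub>V\<^esub> v)) = (A u \<oplus>\<^bsub>U\<^esub> A v, B u \<oplus>\<^bsub>U\<^esub> B v)" if "u \<in> carrier V" "v \<in> carrier V" for u v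
    using a[OF that] that by (simp add: \<tau>_real)
  have cd: "(A (r \<odot>\<^bsub>V\<^esub> v), B (r \<odot>\<^bsub>V\<^esub> v)) = (r \<odot>\<^bsub>U\<^esub> A v, r \<odot>\<^bsub>U\<^esub> B v)" if "v \<in> carrier V" for v r
    using c[OF that] that cl[OF that] by (simp add: \<tau>_real)
  show "A \<in> lin V U" "B \<in> lin V U" by (rule linI; use cl ab cd in simp)+
qed

interpretation A: linmap V U A by unfold_locales (rule A_lin)
interpretation B: linmap V U B by unfold_locales (rule B_lin)

lemma \<tau>_pair:
  assumes "u \<in> carrier V" "v \<in> carrier V"
  shows "\<tau> (u, v) = (A u \<ominus>\<^bsub>U\<^esub> B v, A v \<oplus>\<^bsub>U\<^esub> B u)"
proof -
  have "(u, v) = (u, \<zero>\<^bsub>V\<^esub>) \<oplus>\<^bsub>cplx V\<^esub> (\<i> \<odot>\<^bsub>cplx V\<^esub> (v, \<zero>\<^bsub>V\<^esub>))" using assms by (simp add: V.minus_eq)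
  then have "\<tau> (u, v) = \<tau> (u, \<zero>\<^bsub>V\<^esub>) \<oplus>\<^bsub>cplx U\<^esub> \<i> \<odot>\<^bsub>cplx U\<^esub> \<tau> (v, \<zero>\<^bsub>V\<^esub>)"
    using \<tau>.add[of "(u, \<zero>\<^bsub>V\<^esub>)" "\<i> \<odot>\<^bsub>cplx V\<^esub> (v, \<zero>\<^bsub>V\<^esub>)"] \<tau>.smult[of "(v, \<zero>\<^bsub>V\<^esub>)" \<i>] assms
      V.C.scl[of "(v, \<zero>\<^bsub>V\<^esub>)" \<i>] by (metis SigmaI V.zero_closed cplx_simps(1))
  then show ?thesis using assms by (simp add: \<tau>_real U.minus_eq U.a_ac)
qed

abbreviation "\<phi> \<equiv> S_extension V U s \<tau>"

lemma AB_closed: "f \<in> carrier (S_vs V) \<Longrightarrow> (\<lambda>k. A (f k)) \<in> carrier (S_vs U)"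
  "f \<in> carrier (S_vs V) \<Longrightarrow> (\<lambda>k. B (f k)) \<in> carrier (S_vs U)"
  using S_lin_of_lin[OF V.vs U.vs A_lin] S_lin_of_lin[OF V.vs U.vs B_lin]
  by (auto simp: S_lin_def LinearCombinations.module_hom_def simp del: S_vs_simps)

lemma \<phi>_S_lin: "\<phi> \<in> S_lin V U"
  unfolding S_extension_def
  by (intro S_lin_restrict[OF V.vs] S_lin_add[OF V.vs U.vs] S_lin_of_lin[OF V.vs U.vs A_lin]
     S_lin_compose[OF U.vs S_lin_smult[OF U.vs] S_lin_of_lin[OF V.vs U.vs B_lin]])

lemma smult_W: "f \<in> Wfil (tensor_S U) n \<Longrightarrow> t \<odot>\<^bsub>S_module U\<^esub> f \<in> Wfil (tensor_S U) n"
proof -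
  assume f: "f \<in> Wfil (tensor_S U) n"
  have "(t \<odot>\<^bsub>S_module U\<^esub> f) k \<in> Wfil U n" for k
    unfolding S_module_simps
    by (rule U.subsp_finsum[OF U.W_sub], rule U.subspD(4)[OF U.W_sub]) (use f in \<open>simp add: U.Wfil_tensor\<close>)
  moreover have "f \<in> carrier (S_vs U)" using f by (simp add: U.Wfil_tensor)
  ultimately show ?thesis unfolding U.Wfil_tensor using U.S_smult_closed by blast
qed

lemma AB_W: assumes "v \<in> Wfil V n" shows "A v \<in> Wfil U n" "B v \<in> Wfil U n"
proof -
  have "(v, \<zero>\<^bsub>V\<^esub>) \<in> Wfil V n \<times> Wfil V n" using assms V.subspD(2)[OF V.W_sub] by simp
  from \<tau>_W[OF this] show "A v \<in> Wfil U n" "B v \<in> Wfil U n"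
    using V.Wfil_carrier[OF assms] by (auto simp: \<tau>_real)
qed

text \<open>
  A way to compute \<open>\<phi>\<close> modulo lower weights: multiplication by \<open>s\<close> respects \<open>W\<close>, so if \<open>B\<close> lowers
  weights, then \<open>\<phi>\<close> is congruent to \<open>A\<close>.
\<close>

lemma \<phi>_congruent:
  assumes f: "f \<in> carrier (S_vs V)" and g: "g \<in> carrier (S_vs U)"
    and A: "\<And>k. A (f k) \<ominus>\<^bsub>U\<^esub> g k \<in> Wfil U m" and B: "\<And>k. B (f k) \<in> Wfil U m"
  shows "\<phi> f \<ominus>\<^bsub>S_vs U\<^esub> g \<in> Wfil (tensor_S U) m"
proof -
  note [simp del] = S_vs_simps S_module_simps
  let ?a = "\<lambda>k. A (f k)" and ?b = "\<lambda>k. B (f k)"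
  have "?a \<ominus>\<^bsub>S_vs U\<^esub> g \<in> Wfil (tensor_S U) m"
    using A AB_closed(1)[OF f] g by (simp add: U.Wfil_tensor U.S_vs_apply)
  moreover have "s \<odot>\<^bsub>S_module U\<^esub> ?b \<in> Wfil (tensor_S U) m"
    by (rule smult_W) (use B AB_closed(2)[OF f] in \<open>simp add: U.Wfil_tensor\<close>)
  ultimately have "(?a \<ominus>\<^bsub>S_vs U\<^esub> g) \<oplus>\<^bsub>S_vs U\<^esub> s \<odot>\<^bsub>S_module U\<^esub> ?b \<in> Wfil (tensor_S U) m"
    by (rule U.S.subspD(3)[OF U.W_tensor_sub])
  moreover have "\<phi> f \<ominus>\<^bsub>S_vs U\<^esub> g = (?a \<ominus>\<^bsub>S_vs U\<^esub> g) \<oplus>\<^bsub>S_vs U\<^esub> s \<odot>\<^bsub>S_module U\<^esub> ?b"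
    using f g AB_closed[OF f] U.S_smult_closed[OF AB_closed(2)[OF f]]
    by (simp add: S_extension_def U.S.minus_smult U.S.a_ac)
  ultimately show ?thesis by simp
qed

lemma \<phi>_tens: "v \<in> carrier V \<Longrightarrow> \<phi> (tens V v t) = tens U (A v) t \<oplus>\<^bsub>S_vs U\<^esub> tens U (B v) (s * t)"
proof -
  assume v: "v \<in> carrier V"
  have "(\<lambda>k. A (tens V v t k)) = tens U (A v) t" "(\<lambda>k. B (tens V v t k)) = tens U (B v) t"
    using v by (auto simp: tens_def A.smult B.smult)
  then show ?thesis using tens_closed[OF V.vs v, of t] U.S_smult_tens[OF B.closed[OF v]]
    by (simp add: S_extension_def del: S_vs_simps S_module_simps)
qed

text \<open>
  On a pure tensor, \<open>\<phi>(z \<otimes> w) = \<tau>(z) \<otimes> w + B(z) \<otimes> (s - \<i>)w\<close>.  The first summand has the right degree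
  because \<open>\<tau>\<close> respects \<open>F\<close>, the second because of the zero of \<open>s - \<i>\<close> at \<open>\<i>\<close>.
\<close>

lemma \<phi>_F: "map_prod \<phi> \<phi> ` Ffil (tensor_S V) p \<subseteq> Ffil (tensor_S U) p"
proof (rule V.Ffil_tensor_image[OF U.CS.is_vsp map_prod_lin[OF V.S.is_vsp U.S.is_vsp] U.Ffil_tensor_sub])
  show "\<phi> \<in> lin (S_vs V) (S_vs U)" using \<phi>_S_lin by (simp add: S_lin_def)
  note [simp del] = S_vs_simps S_module_simps
  fix a z w assume z: "z \<in> Ffil V a" and w: "w \<in> Ffil S_ring (p - a)"
  obtain u v where uv: "z = (u, v)" "u \<in> carrier V" "v \<in> carrier V" using V.Ffil_carrier[OF z] by auto
  obtain w1 w2 where ww: "w = (w1, w2)" by (cases w)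
  let ?Bz = "(B u, B v)" and ?w = "cpmult (s, - 1) w"
  note cl = A.closed[OF uv(2)] A.closed[OF uv(3)] B.closed[OF uv(2)] B.closed[OF uv(3)]
  note [simp] = tens_closed[OF U.vs] tens_closed[OF V.vs]
  have eq: "map_prod \<phi> \<phi> (ctens V z w) = ctens U (\<tau> z) w \<oplus>\<^bsub>cplx (S_vs U)\<^esub> ctens U ?Bz ?w"
  proof -
    interpret \<phi>: linmap "S_vs V" "S_vs U" \<phi> using \<phi>_S_lin by unfold_locales (simp add: S_lin_def)
    have c: "x \<oplus>\<^bsub>S_vs U\<^esub> (y \<oplus>\<^bsub>S_vs U\<^esub> (- 1) \<odot>\<^bsub>S_vs U\<^esub> x) = y" if "x \<in> carrier (S_vs U)" "y \<in> carrier (S_vs U)" for x y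
      using that by (simp add: U.S.minus_smult[symmetric])
    have neg: "tens U x (- t) = (- 1) \<odot>\<^bsub>S_vs U\<^esub> tens U x t" if "x \<in> carrier U" for x t
      using tens_smult_right[OF U.vs that, of "-1" t] by simp
    have 1: "\<phi> (fst (ctens V z w)) = fst (ctens U (\<tau> z) w) \<oplus>\<^bsub>S_vs U\<^esub> fst (ctens U ?Bz ?w)"
    proof -
      have "fst (ctens U (\<tau> z) w) \<oplus>\<^bsub>S_vs U\<^esub> fst (ctens U ?Bz ?w) =
        (tens U (A u) w1 \<oplus>\<^bsub>S_vs U\<^esub> (-1) \<odot>\<^bsub>S_vs U\<^esub> tens U (A v) w2 \<oplus>\<^bsub>S_vs U\<^esub>
         (tens U (B u) (s * w1) \<oplus>\<^bsub>S_vs U\<^esub> (-1) \<odot>\<^bsub>S_vs U\<^esub> tens U (B v) (s * w2)))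
        \<oplus>\<^bsub>S_vs U\<^esub> ((tens U (B u) w2 \<ominus>\<^bsub>S_vs U\<^esub> tens U (B u) w2) \<oplus>\<^bsub>S_vs U\<^esub> (tens U (B v) w1 \<ominus>\<^bsub>S_vs U\<^esub> tens U (B v) w1))"
        using cl by (simp del: U.S.minus_self add: uv ww \<tau>_pair ctens_def cpmult_def tens_add_left[OF U.vs] tens_diff_left[OF U.vs]
          tens_add_right[OF U.vs] tens_diff_right[OF U.vs] neg U.S.minus_smult U.S.smult_radd U.S.smult_smult U.S.a_ac)
      also have "\<dots> = \<phi> (fst (ctens V z w))"
        using uv cl by (simp add: ww ctens_def \<phi>.minus \<phi>_tens U.S.minus_smult U.S.smult_radd U.S.a_ac)
      finally show ?thesis ..
    qed
    have 2: "\<phi> (snd (ctens V z w)) = snd (ctens U (\<tau> z) w) \<oplus>\<^bsub>S_vs U\<^esub> snd (ctens U ?Bz ?w)"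
    proof -
      have "snd (ctens U (\<tau> z) w) \<oplus>\<^bsub>S_vs U\<^esub> snd (ctens U ?Bz ?w) =
        (tens U (A u) w2 \<oplus>\<^bsub>S_vs U\<^esub> tens U (A v) w1 \<oplus>\<^bsub>S_vs U\<^esub>
         (tens U (B u) (s * w2) \<oplus>\<^bsub>S_vs U\<^esub> tens U (B v) (s * w1)))
        \<oplus>\<^bsub>S_vs U\<^esub> ((tens U (B u) w1 \<ominus>\<^bsub>S_vs U\<^esub> tens U (B u) w1) \<oplus>\<^bsub>S_vs U\<^esub> (tens U (B v) w2 \<ominus>\<^bsub>S_vs U\<^esub> tens U (B v) w2))"
        using cl by (simp del: U.S.minus_self add: uv ww \<tau>_pair ctens_def cpmult_def tens_add_left[OF U.vs] tens_diff_left[OF U.vs]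
          tens_add_right[OF U.vs] tens_diff_right[OF U.vs] neg U.S.minus_smult U.S.smult_radd U.S.smult_smult U.S.a_ac)
      also have "\<dots> = \<phi> (snd (ctens V z w))"
        using uv cl by (simp add: ww ctens_def \<phi>.add \<phi>_tens U.S.minus_smult U.S.smult_radd U.S.a_ac)
      finally show ?thesis ..
    qed
    show ?thesis using 1 2 by (cases "ctens V z w"; cases "ctens U (\<tau> z) w"; cases "ctens U ?Bz ?w") simp
  qed
  have "ctens U (\<tau> z) w \<in> Ffil (tensor_S U) p" by (rule U.Ffil_tensor_gen[OF \<tau>_F[OF z] w])
  moreover have "ctens U ?Bz ?w \<in> Ffil (tensor_S U) p"
  proof (cases "z = \<zero>\<^bsub>cplx V\<^esub>")
    case True
    then have "?Bz = \<zero>\<^bsub>cplx U\<^esub>" using uv B.zero by simp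
    then have "ctens U ?Bz ?w = \<zero>\<^bsub>cplx (S_vs U)\<^esub>"
      by (cases ?w) (simp add: ctens_def tens_zero_left[OF U.vs U.zero_closed])
    then show ?thesis using U.CS.subspD(2)[OF U.Ffil_tensor_sub] by simp
  next
    case False
    then have "a < hi" using V_anti[of hi a] z V_top by (cases "a < hi") auto
    \<comment> \<open>\<open>B(z)\<close> lies in \<open>F\<^sup>l\<^sup>o\<close>, so \<open>(s -
      \<i>)w\<close> has to vanish at \<open>\<i>\<close> to order \<open>p - lo\<close>; it does,
      since \<open>a < hi\<close>.\<close>
    have "?w \<in> Ffil S_ring ((hi - lo) + (p - a))"
      by (rule cpmult_in_Ffil_S[OF _ w]) (simp add: Ffil_S_ring s)
    moreover have "[:- \<i>, 1:] ^ nat (p - lo) dvd [:- \<i>, 1:] ^ nat ((hi - lo) + (p - a))"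
      using \<open>a < hi\<close> by (intro le_imp_power_dvd) simp
    ultimately have "?w \<in> Ffil S_ring (p - lo)" unfolding Ffil_S_ring by (rule dvd_trans[rotated])
    moreover have "?Bz \<in> Ffil U lo" using cl U_low by simp
    ultimately show ?thesis by (intro U.Ffil_tensor_gen)
  qed
  ultimately show "map_prod \<phi> \<phi> (ctens V z w) \<in> Ffil (tensor_S U) p"
    unfolding eq by (rule U.CS.subspD(3)[OF U.Ffil_tensor_sub])
qed

lemma \<phi>_S_hom: "\<phi> \<in> S_hom V U"
proof -
  have "\<phi> f \<in> Wfil (tensor_S U) n" if f: "f \<in> Wfil (tensor_S V) n" for f n
  proof -
    have f': "f \<in> carrier (S_vs V)" "\<And>k. f k \<in> Wfil V n" using f by (auto simp: V.Wfil_tensor)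
    have "\<phi> f \<ominus>\<^bsub>S_vs U\<^esub> \<zero>\<^bsub>S_vs U\<^esub> \<in> Wfil (tensor_S U) n"
    proof (rule \<phi>_congruent[OF f'(1) U.S.zero_closed])
      show "A (f k) \<ominus>\<^bsub>U\<^esub> \<zero>\<^bsub>S_vs U\<^esub> k \<in> Wfil U n" for k
        using AB_W(1)[OF f'(2)[of k]] U.Wfil_carrier[OF AB_W(1)[OF f'(2)[of k]]] by simp
    qed (rule AB_W(2)[OF f'(2)])
    moreover have "\<phi> f \<in> carrier (S_vs U)"
      using \<phi>_S_lin f'(1) by (auto simp: S_lin_def LinearCombinations.module_hom_def simp del: S_vs_simps)
    ultimately show ?thesis by (simp del: S_vs_simps)
  qed
  then show ?thesis using \<phi>_S_lin \<phi>_F by (auto simp: S_hom_def S_extension_def image_subset_iff simp del: map_prod_simp)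
qed

end

section \<open>The associated graded space\<close>

context vsp begin

lemma coset_eq_iff:
  assumes B: "subsp B M" and x: "x \<in> carrier M" and y: "y \<in> carrier M"
  shows "B +> x = B +> y \<longleftrightarrow> x \<ominus> y \<in> B"
proof
  note BB = subspD[OF B]
  assume "B +> x = B +> y"
  moreover have "x \<in> B +> x" using BB(2) x by (force simp: a_r_coset_def')
  ultimately obtain h where "h \<in> B" "x = h \<oplus> y" by (auto simp: a_r_coset_def')
  then show "x \<ominus> y \<in> B" using y BB(6) by (simp add: a_comm[of h y])
next
  note BB = subspD[OF B]
  have sub: "B +> x \<subseteq> B +> y" if "x \<in> carrier M" "y \<in> carrier M" "x \<ominus> y \<in> B" for x y
  proof
    fix z assume "z \<in> B +> x"
    then obtain h where h: "h \<in> B" "z = h \<oplus> x" by (auto simp: a_r_coset_def')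
    then have "z = (h \<oplus> (x \<ominus> y)) \<oplus> y" using that BB(6) by (simp add: a_assoc)
    then show "z \<in> B +> y" using BB(3)[OF h(1) that(3)] by (auto simp: a_r_coset_def')
  qed
  assume xy: "x \<ominus> y \<in> B"
  then have "(-1) \<odot> (x \<ominus> y) \<in> B" by (rule BB(4))
  moreover have "(-1) \<odot> (x \<ominus> y) = y \<ominus> x" using x y by (simp add: minus_smult smult_radd smult_smult a_comm)
  ultimately show "B +> x = B +> y" using sub[OF x y xy] sub[OF y x] by auto
qed

lemma coset_add:
  assumes B: "subsp B M" and x: "x \<in> carrier M" and y: "y \<in> carrier M"
  shows "(B +> x) <+> (B +> y) = B +> (x \<oplus> y)"
proof -
  note BB = subspD[OF B]
  have 1: "(h \<oplus> x) \<oplus> (k \<oplus> y) = (h \<oplus> k) \<oplus> (x \<oplus> y)" if "h \<in> B" "k \<in> B" for h k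
    using that x y BB(6) by (simp add: a_ac)
  show ?thesis
  proof
    show "(B +> x) <+> (B +> y) \<subseteq> B +> (x \<oplus> y)"
      using 1 BB(3) by (fastforce simp: a_r_coset_def' set_add_def')
    show "B +> (x \<oplus> y) \<subseteq> (B +> x) <+> (B +> y)"
    proof
      fix z assume "z \<in> B +> (x \<oplus> y)"
      then obtain h where h: "h \<in> B" "z = h \<oplus> (x \<oplus> y)" by (auto simp: a_r_coset_def')
      then have "z = (h \<oplus> x) \<oplus> (\<zero> \<oplus> y)" using x y BB(6) by (simp add: a_assoc)
      then show "z \<in> (B +> x) <+> (B +> y)" using h BB(2) by (auto simp: a_r_coset_def' set_add_def')
    qed
  qed
qed

lemma coset_smult:
  assumes B: "subsp B M" and x: "x \<in> carrier M"
  shows "(\<Union>z\<in>B +> x. B +> (c \<odot> z)) = B +> (c \<odot> x)"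
proof -
  note BB = subspD[OF B]
  have ne: "x \<in> B +> x" using BB(2) x by (force simp: a_r_coset_def')
  have "B +> (c \<odot> z) = B +> (c \<odot> x)" if "z \<in> B +> x" for z
  proof -
    obtain h where h: "h \<in> B" "z = h \<oplus> x" using \<open>z \<in> B +> x\<close> by (auto simp: a_r_coset_def')
    then have hz: "z \<in> carrier M" "z \<ominus> x = h" using x BB(6) by (simp_all add: a_comm[of h x])
    have "c \<odot> z \<ominus> c \<odot> x = c \<odot> (z \<ominus> x)" using x hz(1) by (simp add: smult_rminus)
    also have "\<dots> \<in> B" unfolding hz(2) by (rule BB(4)[OF h(1)])
    finally show ?thesis by (rule iffD2[OF coset_eq_iff[OF B scl[OF hz(1)] scl[OF x]]])
  qed
  then show ?thesis by (intro UN_constant_eq[OF ne] ballI)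
qed

lemma coset_zero: assumes "subsp B M" shows "B +> \<zero> = B"
proof -
  have "h \<oplus> \<zero> = h" if "h \<in> B" for h using subspD(6)[OF assms that] by simp
  then show ?thesis by (auto simp: a_r_coset_def')
qed

end

lemma gr_W_simps:
  "carrier (gr_W V n) = (\<lambda>x. Wfil V (n - 1) +>\<^bsub>V\<^esub> x) ` Wfil V n"
  "\<zero>\<^bsub>gr_W V n\<^esub> = Wfil V (n - 1)"
  "X \<oplus>\<^bsub>gr_W V n\<^esub> Y = X <+>\<^bsub>V\<^esub> Y"
  "c \<odot>\<^bsub>gr_W V n\<^esub> X = (\<Union>x\<in>X. Wfil V (n - 1) +>\<^bsub>V\<^esub> (c \<odot>\<^bsub>V\<^esub> x))"
  "Wfil (gr_W V n) m = (\<lambda>x. Wfil V (n - 1) +>\<^bsub>V\<^esub> x) ` (Wfil V m \<inter> Wfil V n)"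
  "Ffil (gr_W V n) p = (\<lambda>(u, v). (Wfil V (n - 1) +>\<^bsub>V\<^esub> u, Wfil V (n - 1) +>\<^bsub>V\<^esub> v)) ` (Ffil V p \<inter> Wfil V n \<times> Wfil V n)"
  by (simp_all add: gr_W_def Let_def module.extend_def qmhs.fields_def quot_space_def quot_fil_def)

lemma gr_carrier: "g \<in> carrier (gr V) \<longleftrightarrow> (\<forall>n. g n \<in> carrier (gr_W V n)) \<and> finite {n. g n \<noteq> \<zero>\<^bsub>gr_W V n\<^esub>}"
  by (simp add: gr_def qmhs_sum_def Let_def)

lemma gr_simps:
  "\<zero>\<^bsub>gr V\<^esub> = (\<lambda>n. \<zero>\<^bsub>gr_W V n\<^esub>)"
  "g \<oplus>\<^bsub>gr V\<^esub> h = (\<lambda>n. g n \<oplus>\<^bsub>gr_W V n\<^esub> h n)"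
  "r \<odot>\<^bsub>gr V\<^esub> g = (\<lambda>n. r \<odot>\<^bsub>gr_W V n\<^esub> g n)"
  "Wfil (gr V) m = {g \<in> carrier (gr V). \<forall>n. g n \<in> Wfil (gr_W V n) m}"
  "Ffil (gr V) p = {(g, h). g \<in> carrier (gr V) \<and> h \<in> carrier (gr V) \<and> (\<forall>n. (g n, h n) \<in> Ffil (gr_W V n) p)}"
  by (simp_all add: gr_def qmhs_sum_def Let_def)

context fvs begin

definition proj :: "int \<Rightarrow> 'a \<Rightarrow> 'a set" where "proj n v = Wfil V (n - 1) +> v"

text \<open>
  The class of \<open>v\<close> in \<open>gr\<^sup>W\<^sub>n V \<subseteq> gr\<^sup>W V\<close>.
\<close>

definition gsym :: "int \<Rightarrow> 'a \<Rightarrow> int \<Rightarrow> 'a set" where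
  "gsym n v = (\<lambda>m. if m = n then proj n v else \<zero>\<^bsub>gr_W V m\<^esub>)"

lemma proj_eq_iff: "x \<in> carrier V \<Longrightarrow> y \<in> carrier V \<Longrightarrow> proj n x = proj n y \<longleftrightarrow> x \<ominus> y \<in> Wfil V (n - 1)"
  unfolding proj_def by (rule coset_eq_iff[OF W_sub])

lemma proj_closed: "x \<in> Wfil V n \<Longrightarrow> proj n x \<in> carrier (gr_W V n)"
  by (simp add: proj_def gr_W_simps)

lemma proj_add: "x \<in> carrier V \<Longrightarrow> y \<in> carrier V \<Longrightarrow> proj n (x \<oplus> y) = proj n x \<oplus>\<^bsub>gr_W V n\<^esub> proj n y"
  by (simp add: proj_def gr_W_simps coset_add[OF W_sub])

lemma proj_smult: "x \<in> carrier V \<Longrightarrow> proj n (r \<odot> x) = r \<odot>\<^bsub>gr_W V n\<^esub> proj n x"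
  by (simp add: proj_def gr_W_simps coset_smult[OF W_sub])

lemma proj_zero: "x \<in> Wfil V (n - 1) \<Longrightarrow> proj n x = \<zero>\<^bsub>gr_W V n\<^esub>"
  using proj_eq_iff[of x \<zero> n] Wfil_carrier[of x "n - 1"] by (simp add: proj_def gr_W_simps coset_zero[OF W_sub])

lemma vsp_gr_W: "vsp (gr_W V n)"
proof -
  note W = subspD[OF W_sub[of n]]
  have vsW: "vsp (V\<lparr>carrier := Wfil V n\<rparr>)"
    unfolding vsp_def using VectorSpace.vectorspace.subspace_is_vs[OF vectorspace W_sub] .
  show ?thesis
  proof (rule vsp_transport[OF vsW, of "proj n"])
    show "proj n ` carrier (V\<lparr>carrier := Wfil V n\<rparr>) = carrier (gr_W V n)" by (simp add: proj_def gr_W_simps)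
    show "proj n \<zero>\<^bsub>V\<lparr>carrier := Wfil V n\<rparr>\<^esub> = \<zero>\<^bsub>gr_W V n\<^esub>" using subspD(2)[OF W_sub] by (simp add: proj_zero)
  qed (use W(6) in \<open>simp_all add: proj_add proj_smult\<close>)
qed

lemma vsp_gr: "vsp (gr V)"
proof -
  interpret G: vsp "gr_W V n" for n by (rule vsp_gr_W)
  show ?thesis
  proof (rule vspI, goal_cases)
    case 1 show ?case by (simp add: gr_carrier gr_simps)
  next
    case (2 x y)
    have "{n. x n \<oplus>\<^bsub>gr_W V n\<^esub> y n \<noteq> \<zero>\<^bsub>gr_W V n\<^esub>} \<subseteq> {n. x n \<noteq> \<zero>\<^bsub>gr_W V n\<^esub>} \<union> {n. y n \<noteq> \<zero>\<^bsub>gr_W V n\<^esub>}"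
      by auto
    then have "finite {n. x n \<oplus>\<^bsub>gr_W V n\<^esub> y n \<noteq> \<zero>\<^bsub>gr_W V n\<^esub>}"
      by (rule finite_subset) (use 2 in \<open>simp add: gr_carrier\<close>)
    moreover have "x n \<oplus>\<^bsub>gr_W V n\<^esub> y n \<in> carrier (gr_W V n)" for n
      using 2 by (intro G.add.m_closed) (simp_all only: gr_carrier)
    ultimately show ?case unfolding gr_carrier gr_simps(2) by (intro conjI allI)
  next
    case (3 c x)
    have "c \<odot>\<^bsub>gr_W V n\<^esub> x n = \<zero>\<^bsub>gr_W V n\<^esub>" if "x n = \<zero>\<^bsub>gr_W V n\<^esub>" for n
      unfolding that by (rule G.smult_zero)
    then have "{n. c \<odot>\<^bsub>gr_W V n\<^esub> x n \<noteq> \<zero>\<^bsub>gr_W V n\<^esub>} \<subseteq> {n. x n \<noteq> \<zero>\<^bsub>gr_W V n\<^esub>}" by blast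
    then have "finite {n. c \<odot>\<^bsub>gr_W V n\<^esub> x n \<noteq> \<zero>\<^bsub>gr_W V n\<^esub>}"
      by (rule finite_subset) (use 3 in \<open>simp add: gr_carrier\<close>)
    moreover have "c \<odot>\<^bsub>gr_W V n\<^esub> x n \<in> carrier (gr_W V n)" for n
      using 3 by (intro G.scl) (simp only: gr_carrier)
    ultimately show ?case unfolding gr_carrier gr_simps(3) by (intro conjI allI)
  qed (simp_all add: gr_carrier gr_simps fun_eq_iff G.a_ac G.smult_smult G.smult_ladd G.smult_radd)
qed

lemma proj_surj: "X \<in> carrier (gr_W V n) \<Longrightarrow> \<exists>v\<in>Wfil V n. X = proj n v"
  by (auto simp: gr_W_simps proj_def)

text \<open>
  The weight filtration induced on \<open>gr\<^sup>W\<^sub>n V\<close> has its only jump at \<open>n\<close>.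
\<close>

lemma Wfil_gr: "Wfil (gr V) m = {g \<in> carrier (gr V). \<forall>n>m. g n = \<zero>\<^bsub>gr_W V n\<^esub>}"
proof -
  have small: "Wfil (gr_W V n) m = carrier (gr_W V n)" if "n \<le> m" for n
    using W_mono[OF that] by (simp add: gr_W_simps Int_absorb1)
  have large: "Wfil (gr_W V n) m = {\<zero>\<^bsub>gr_W V n\<^esub>}" if "m < n" for n
  proof -
    have "Wfil V m \<inter> Wfil V n = Wfil V m" using W_mono[of m n] that by auto
    moreover have "proj n x = \<zero>\<^bsub>gr_W V n\<^esub>" if "x \<in> Wfil V m" for x
      using W_mono[of m "n - 1"] \<open>m < n\<close> that by (intro proj_zero) auto
    moreover have "\<zero> \<in> Wfil V m" by (rule subspD(2)[OF W_sub])
    ultimately have "proj n ` (Wfil V m \<inter> Wfil V n) = {\<zero>\<^bsub>gr_W V n\<^esub>}" by auto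
    then show ?thesis by (simp add: gr_W_simps(5) proj_def)
  qed
  have "g n \<in> Wfil (gr_W V n) m \<longleftrightarrow> (m < n \<longrightarrow> g n = \<zero>\<^bsub>gr_W V n\<^esub>)" if "g \<in> carrier (gr V)" for g n
    using small[of n] large[of n] that by (cases "m < n") (auto simp: gr_carrier)
  then show ?thesis by (auto simp: gr_simps(4))
qed

lemma Ffil_gr_W: "Ffil (gr_W V n) p = map_prod (proj n) (proj n) ` (Ffil V p \<inter> Wfil V n \<times> Wfil V n)"
  by (simp add: gr_W_simps(6) proj_def[abs_def] map_prod_def)

lemma proj_pair_lin:
  assumes "z \<in> Wfil V n \<times> Wfil V n" "z' \<in> Wfil V n \<times> Wfil V n"
  shows "map_prod (proj n) (proj n) (z \<oplus>\<^bsub>cplx V\<^esub> z') = map_prod (proj n) (proj n) z \<oplus>\<^bsub>cplx (gr_W V n)\<^esub> map_prod (proj n) (proj n) z'"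
    and "map_prod (proj n) (proj n) (r \<odot>\<^bsub>cplx V\<^esub> z) = r \<odot>\<^bsub>cplx (gr_W V n)\<^esub> map_prod (proj n) (proj n) z"
proof -
  interpret G: vsp "gr_W V n" by (rule vsp_gr_W)
  note c = Wfil_carrier[of _ n] proj_closed[of _ n]
  show "map_prod (proj n) (proj n) (z \<oplus>\<^bsub>cplx V\<^esub> z') = map_prod (proj n) (proj n) z \<oplus>\<^bsub>cplx (gr_W V n)\<^esub> map_prod (proj n) (proj n) z'"
    using assms c by (auto simp: proj_add)
  show "map_prod (proj n) (proj n) (r \<odot>\<^bsub>cplx V\<^esub> z) = r \<odot>\<^bsub>cplx (gr_W V n)\<^esub> map_prod (proj n) (proj n) z"
    using assms c by (auto simp: proj_add proj_smult minus_smult G.minus_smult)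
qed

lemma gr_apply:
  assumes "g \<in> carrier (gr V)" "h \<in> carrier (gr V)"
  shows "(g \<oplus>\<^bsub>gr V\<^esub> h) n = g n \<oplus>\<^bsub>gr_W V n\<^esub> h n" "(r \<odot>\<^bsub>gr V\<^esub> g) n = r \<odot>\<^bsub>gr_W V n\<^esub> g n"
    "(g \<ominus>\<^bsub>gr V\<^esub> h) n = g n \<ominus>\<^bsub>gr_W V n\<^esub> h n" "g n \<in> carrier (gr_W V n)"
proof -
  interpret G: vsp "gr_W V n" by (rule vsp_gr_W)
  interpret U: vsp "gr V" by (rule vsp_gr)
  show c: "g n \<in> carrier (gr_W V n)" using assms(1) unfolding gr_carrier by blast
  have "h n \<in> carrier (gr_W V n)" using assms(2) unfolding gr_carrier by blast
  then show "(g \<ominus>\<^bsub>gr V\<^esub> h) n = g n \<ominus>\<^bsub>gr_W V n\<^esub> h n"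
    unfolding U.minus_smult[OF assms] gr_simps(2,3) by (rule G.minus_smult[OF c, symmetric])
qed (simp_all only: gr_simps(2,3))

lemma gr_component_lin: "(\<lambda>z. (fst z n, snd z n)) \<in> lin (cplx (gr V)) (cplx (gr_W V n))"
proof -
  interpret U: vsp "gr V" by (rule vsp_gr)
  show ?thesis
    by (rule linI) (auto simp: gr_apply U.scl)
qed

lemma gr_fvs: "fvs (gr V)"
proof (rule fvs.intro)
  interpret G: vsp "gr_W V n" for n by (rule vsp_gr_W)
  interpret U: rvsp "gr V" by (rule rvspI[OF vsp_gr])
  show "vsp (gr V)" by (rule vsp_gr)
  show "subsp (Wfil (gr V) n) (gr V)" for n
    unfolding U.subsp_iff
  proof (intro conjI ballI allI)
    show "Wfil (gr V) n \<subseteq> carrier (gr V)" unfolding Wfil_gr by blast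
    show "\<zero>\<^bsub>gr V\<^esub> \<in> Wfil (gr V) n" unfolding Wfil_gr using U.zero_closed by (simp add: gr_simps(1))
    show "x \<oplus>\<^bsub>gr V\<^esub> y \<in> Wfil (gr V) n" if "x \<in> Wfil (gr V) n" "y \<in> Wfil (gr V) n" for x y
    proof -
      have xy: "x \<in> carrier (gr V)" "y \<in> carrier (gr V)" using that by (simp_all add: Wfil_gr)
      then have "x \<oplus>\<^bsub>gr V\<^esub> y \<in> carrier (gr V)" by (rule U.add.m_closed)
      then show ?thesis using that gr_apply(1)[OF xy] by (simp add: Wfil_gr)
    qed
    show "r \<odot>\<^bsub>gr V\<^esub> x \<in> Wfil (gr V) n" if "x \<in> Wfil (gr V) n" for x r
    proof -
      have x: "x \<in> carrier (gr V)" using that by (simp add: Wfil_gr)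
      then have "r \<odot>\<^bsub>gr V\<^esub> x \<in> carrier (gr V)" by (rule U.scl)
      then show ?thesis using that gr_apply(2)[OF x x] by (simp add: Wfil_gr)
    qed
  qed
  show "Wfil (gr V) m \<subseteq> Wfil (gr V) n" if "m \<le> n" for m n using that by (auto simp: Wfil_gr)
  show "subsp (Ffil (gr V) p) (cplx (gr V))" for p
  proof -
    have sub: "subsp (Ffil (gr_W V n) p) (cplx (gr_W V n))" for n
    proof -
      interpret CG: vsp "cplx (gr_W V n)" by (rule vsp_cplx[OF vsp_gr_W])
      let ?N = "Ffil V p \<inter> Wfil V n \<times> Wfil V n"
      have N: "subsp ?N (cplx V)" by (rule C.subsp_Int[OF F_sub subsp_cplx[OF vs W_sub]])
      show ?thesis unfolding Ffil_gr_W
      proof (rule subsp_image_on[OF C.is_vsp CG.is_vsp N])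
        fix z assume z: "z \<in> ?N"
        show "map_prod (proj n) (proj n) z \<in> carrier (cplx (gr_W V n))" using z proj_closed by auto
        show "map_prod (proj n) (proj n) (r \<odot>\<^bsub>cplx V\<^esub> z) = r \<odot>\<^bsub>cplx (gr_W V n)\<^esub> map_prod (proj n) (proj n) z" for r
          using z by (intro proj_pair_lin(2)[of z n z]) blast+
        fix z' assume z': "z' \<in> ?N"
        show "map_prod (proj n) (proj n) (z \<oplus>\<^bsub>cplx V\<^esub> z') =
          map_prod (proj n) (proj n) z \<oplus>\<^bsub>cplx (gr_W V n)\<^esub> map_prod (proj n) (proj n) z'"
          using z z' by (intro proj_pair_lin(1)) blast+
      qed
    qed
    have mem: "z \<in> Ffil (gr V) p \<longleftrightarrow> z \<in> carrier (cplx (gr V)) \<and> (\<forall>n. (fst z n, snd z n) \<in> Ffil (gr_W V n) p)" for z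
      by (cases z) (simp add: gr_simps(5) conj_assoc)
    interpret k: linmap "cplx (gr V)" "cplx (gr_W V n)" "\<lambda>z. (fst z n, snd z n)" for n
      using gr_component_lin[of n] vsp_cplx[OF vsp_gr_W, of n] U.C.is_vsp by (simp add: linmap_def linmap_axioms_def)
    note * = U.C.subspD[OF k.vimage_subsp[OF sub]]
    show ?thesis unfolding U.C.subsp_iff
    proof (intro conjI ballI allI)
      show "Ffil (gr V) p \<subseteq> carrier (cplx (gr V))" using mem by blast
      show "\<zero>\<^bsub>cplx (gr V)\<^esub> \<in> Ffil (gr V) p" unfolding mem using *(2) by blast
      show "x \<oplus>\<^bsub>cplx (gr V)\<^esub> y \<in> Ffil (gr V) p" if "x \<in> Ffil (gr V) p" "y \<in> Ffil (gr V) p" for x y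
        using that *(3)[of x _ y] unfolding mem by blast
      show "r \<odot>\<^bsub>cplx (gr V)\<^esub> x \<in> Ffil (gr V) p" if "x \<in> Ffil (gr V) p" for x r
        using that *(4)[of x _ r] unfolding mem by blast
    qed
  qed
qed

end

section \<open>Bigraded comparison of \<open>V\<close> and \<open>gr V\<close>\<close>

text \<open>
  The component in degree \<open>m\<close> of an element of \<open>gr V \<otimes> \<complex>\<close>.
\<close>

definition gcomp :: "int \<Rightarrow> (int \<Rightarrow> 'a) \<times> (int \<Rightarrow> 'a) \<Rightarrow> 'a \<times> 'a" where
  "gcomp m u = (fst u m, snd u m)"

lemma gcomp_eqI: "(\<And>m. gcomp m u = gcomp m v) \<Longrightarrow> u = v"
  by (cases u; cases v) (auto simp: gcomp_def)

locale biframed = fvs V for V :: "'a qmhs" (structure) +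
  fixes N b c d n lo hi lo' hi'
  assumes F_anti: "\<And>p q. p \<le> q \<Longrightarrow> Ffil V q \<subseteq> Ffil V p"
    and fr: "biframe (cplx V) (Ffil V) (\<lambda>m. Wfil V m \<times> Wfil V m) (carrier (cplx V)) N b c d n"
    and W_bot: "Wfil V lo = {\<zero>}" and W_top: "Wfil V hi = carrier V"
    and F_top: "Ffil V hi' = {\<zero>\<^bsub>cplx V\<^esub>}" and F_low: "Ffil V lo' = carrier (cplx V)"
begin

abbreviation "U \<equiv> gr V"

interpretation G: vsp "gr_W V m" for m by (rule vsp_gr_W)
interpretation CG: vsp "cplx (gr_W V m)" for m by (rule vsp_cplx[OF vsp_gr_W])
interpretation U: fvs U by (rule gr_fvs)

lemma W2: "subsp (Wfil V m \<times> Wfil V m) (cplx V)" by (rule subsp_cplx[OF vs W_sub])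
lemma UW2: "subsp (Wfil U m \<times> Wfil U m) (cplx U)" by (rule subsp_cplx[OF U.vs U.W_sub])

lemma b_F: "j < N \<Longrightarrow> b j \<in> Ffil V (d j)"
  and b_W: "j < N \<Longrightarrow> b j \<in> Wfil V (n j) \<times> Wfil V (n j)"
  and b_closed: "j < N \<Longrightarrow> b j \<in> carrier (cplx V)"
  and c_functional: "j < N \<Longrightarrow> functional (cplx V) (c j)"
  and expand: "z \<in> carrier (cplx V) \<Longrightarrow> z = (\<Oplus>\<^bsub>cplx V\<^esub>j\<in>{..<N}. c j z \<odot>\<^bsub>cplx V\<^esub> b j)"
  and c_F: "z \<in> Ffil V p \<Longrightarrow> j < N \<Longrightarrow> d j < p \<Longrightarrow> c j z = 0"
  and c_W: "z \<in> Wfil V m \<times> Wfil V m \<Longrightarrow> j < N \<Longrightarrow> m < n j \<Longrightarrow> c j z = 0"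
  using fr Ffil_carrier[of z p] C.subspD(6)[OF W2, of z m] unfolding biframe_def by blast+

abbreviation "pp m \<equiv> map_prod (proj m) (proj m)"

definition b' :: "nat \<Rightarrow> (int \<Rightarrow> 'a set) \<times> (int \<Rightarrow> 'a set)" where
  "b' j = map_prod (gsym (n j)) (gsym (n j)) (b j)"

definition rep :: "int \<Rightarrow> 'a set \<Rightarrow> 'a" where
  "rep m X = (SOME v. v \<in> Wfil V m \<and> X = proj m v)"

text \<open>
  \<open>c j\<close> vanishes on \<open>W (n j - 1)\<close>, so it induces a functional on \<open>gr V\<close>; representatives are chosen to
  evaluate it, and \<open>c'_eq\<close> shows that the choice does not matter.
\<close>

definition c' :: "nat \<Rightarrow> (int \<Rightarrow> 'a set) \<times> (int \<Rightarrow> 'a set) \<Rightarrow> complex" where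
  "c' j u = c j (rep (n j) (fst u (n j)), rep (n j) (snd u (n j)))"

lemma rep: assumes "X \<in> carrier (gr_W V m)" shows "rep m X \<in> Wfil V m" "X = proj m (rep m X)"
proof -
  have "\<exists>v. v \<in> Wfil V m \<and> X = proj m v" using proj_surj[OF assms] by blast
  from someI_ex[OF this] show "rep m X \<in> Wfil V m" "X = proj m (rep m X)" unfolding rep_def by blast+
qed

lemma gcomp_closed: "u \<in> carrier (cplx U) \<Longrightarrow> gcomp m u \<in> carrier (cplx (gr_W V m))"
  by (auto simp: gcomp_def gr_carrier)

lemma gcomp_rep: assumes "u \<in> carrier (cplx U)"
  obtains z where "z \<in> Wfil V m \<times> Wfil V m" "gcomp m u = pp m z"
proof -
  have "fst u m \<in> carrier (gr_W V m)" "snd u m \<in> carrier (gr_W V m)"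
    using gcomp_closed[OF assms, of m] by (auto simp: gcomp_def)
  note r = rep[OF this(1)] rep[OF this(2)]
  have "gcomp m u = pp m (rep m (fst u m), rep m (snd u m))"
    using r(2,4) by (simp add: gcomp_def)
  then show ?thesis using that r(1,3) by blast
qed

lemma gcomp_lin: "gcomp m \<in> lin (cplx U) (cplx (gr_W V m))"
  using gr_component_lin[of m] by (simp add: gcomp_def[abs_def])

interpretation k: linmap "cplx U" "cplx (gr_W V m)" "gcomp m" for m
  by unfold_locales (rule gcomp_lin)

lemma pp_zero: "z \<in> Wfil V (m - 1) \<times> Wfil V (m - 1) \<Longrightarrow> pp m z = \<zero>\<^bsub>cplx (gr_W V m)\<^esub>"
  by (auto simp: proj_zero)

lemma pp_closed: "z \<in> Wfil V m \<times> Wfil V m \<Longrightarrow> pp m z \<in> carrier (cplx (gr_W V m))"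
  using proj_closed by auto

lemma c'_eq:
  assumes j: "j < N" and z: "z \<in> Wfil V (n j) \<times> Wfil V (n j)" and u: "gcomp (n j) u = pp (n j) z"
  shows "c' j u = c j z"
proof -
  let ?m = "n j"
  obtain x y where xy: "z = (x, y)" "x \<in> Wfil V ?m" "y \<in> Wfil V ?m" using z by auto
  have eqs: "fst u ?m = proj ?m x" "snd u ?m = proj ?m y" using u xy(1) by (auto simp: gcomp_def)
  let ?x = "rep ?m (fst u ?m)" and ?y = "rep ?m (snd u ?m)"
  have X: "?x \<in> Wfil V ?m" "fst u ?m = proj ?m ?x"
    by (rule rep; simp add: eqs(1) proj_closed[OF xy(2)])+
  have Y: "?y \<in> Wfil V ?m" "snd u ?m = proj ?m ?y"
    by (rule rep; simp add: eqs(2) proj_closed[OF xy(3)])+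
  note car = Wfil_carrier[OF X(1)] Wfil_carrier[OF Y(1)] Wfil_carrier[OF xy(2)] Wfil_carrier[OF xy(3)]
  have "?x \<ominus> x \<in> Wfil V (?m - 1)" "?y \<ominus> y \<in> Wfil V (?m - 1)"
    using X(2) Y(2) eqs proj_eq_iff[OF car(1,3)] proj_eq_iff[OF car(2,4)] by metis+
  then have "c j ((?x, ?y) \<ominus>\<^bsub>cplx V\<^esub> z) = 0"
    using cplx_minus[OF vs car(1,2,3,4)] xy(1) by (intro c_W[OF _ j]) auto
  moreover have "c j ((?x, ?y) \<ominus>\<^bsub>cplx V\<^esub> z) = c j (?x, ?y) - c j z"
    by (rule C.functional_minus[OF c_functional[OF j]]) (use car xy in auto)
  ultimately show ?thesis by (simp add: c'_def)
qed

lemma c'_functional: assumes j: "j < N" shows "functional (cplx U) (c' j)"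
proof (rule functionalI)
  let ?m = "n j"
  note cf = C.functionalD[OF c_functional[OF j]]
  note WW = C.subspD[OF W2]
  fix x assume x: "x \<in> carrier (cplx U)"
  obtain z where z: "z \<in> Wfil V ?m \<times> Wfil V ?m" "gcomp ?m x = pp ?m z" using gcomp_rep[OF x] .
  show "c' j (r \<odot>\<^bsub>cplx U\<^esub> x) = r * c' j x" for r
  proof -
    have "gcomp ?m (r \<odot>\<^bsub>cplx U\<^esub> x) = pp ?m (r \<odot>\<^bsub>cplx V\<^esub> z)"
      unfolding k.smult[OF x] z(2) by (rule proj_pair_lin(2)[OF z(1) z(1), symmetric])
    from c'_eq[OF j WW(4)[OF z(1)] this] c'_eq[OF j z] show ?thesis using cf(2)[OF WW(6)[OF z(1)]] by simp
  qed
  fix y assume y: "y \<in> carrier (cplx U)"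
  obtain z' where z': "z' \<in> Wfil V ?m \<times> Wfil V ?m" "gcomp ?m y = pp ?m z'" using gcomp_rep[OF y] .
  have "gcomp ?m (x \<oplus>\<^bsub>cplx U\<^esub> y) = pp ?m (z \<oplus>\<^bsub>cplx V\<^esub> z')"
    unfolding k.add[OF x y] z(2) z'(2) by (rule proj_pair_lin(1)[OF z(1) z'(1), symmetric])
  from c'_eq[OF j WW(3)[OF z(1) z'(1)] this] c'_eq[OF j z] c'_eq[OF j z']
  show "c' j (x \<oplus>\<^bsub>cplx U\<^esub> y) = c' j x + c' j y" using cf(1)[OF WW(6)[OF z(1)] WW(6)[OF z'(1)]] by simp
qed

lemma gsym_W: assumes v: "v \<in> Wfil V m" shows "gsym m v \<in> Wfil U m"
proof -
  have "gsym m v i \<in> carrier (gr_W V i)" for i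
    using proj_closed[OF v] G.zero_closed by (simp add: gsym_def)
  moreover have "{i. gsym m v i \<noteq> \<zero>\<^bsub>gr_W V i\<^esub>} \<subseteq> {m}" by (auto simp: gsym_def)
  then have "finite {i. gsym m v i \<noteq> \<zero>\<^bsub>gr_W V i\<^esub>}" by (rule finite_subset) simp
  ultimately show ?thesis by (simp add: Wfil_gr gr_carrier) (simp add: gsym_def)
qed

lemma gcomp_gsym: "gcomp m (map_prod (gsym i) (gsym i) z) = (if i = m then pp m z else \<zero>\<^bsub>cplx (gr_W V m)\<^esub>)"
  by (cases z) (auto simp: gcomp_def gsym_def)

lemma Ffil_U: "u \<in> Ffil U p \<longleftrightarrow> u \<in> carrier (cplx U) \<and> (\<forall>m. \<exists>z \<in> Ffil V p \<inter> Wfil V m \<times> Wfil V m. gcomp m u = pp m z)"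
proof -
  have "u \<in> Ffil U p \<longleftrightarrow> u \<in> carrier (cplx U) \<and> (\<forall>m. gcomp m u \<in> Ffil (gr_W V m) p)"
    by (cases u) (simp add: gr_simps(5) conj_assoc gcomp_def)
  then show ?thesis unfolding Ffil_gr_W image_iff .
qed

lemma b'_W: "j < N \<Longrightarrow> b' j \<in> Wfil U (n j) \<times> Wfil U (n j)"
  using b_W[of j] gsym_W by (cases "b j") (auto simp: b'_def)

lemma b'_closed: "j < N \<Longrightarrow> b' j \<in> carrier (cplx U)"
  using U.C.subspD(6)[OF UW2 b'_W] .

lemma b'_F: assumes j: "j < N" shows "b' j \<in> Ffil U (d j)"
  unfolding Ffil_U
proof (intro conjI allI)
  show "b' j \<in> carrier (cplx U)" by (rule b'_closed[OF j])
  fix m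
  show "\<exists>z \<in> Ffil V (d j) \<inter> Wfil V m \<times> Wfil V m. gcomp m (b' j) = pp m z"
  proof (cases "n j = m")
    case True
    then show ?thesis using b_F[OF j] b_W[OF j] by (intro bexI[of _ "b j"]) (auto simp: b'_def gcomp_gsym)
  next
    case False
    have "\<zero>\<^bsub>cplx V\<^esub> \<in> Ffil V (d j) \<inter> Wfil V m \<times> Wfil V m"
      using C.subspD(2)[OF F_sub] C.subspD(2)[OF W2] by blast
    moreover have "pp m \<zero>\<^bsub>cplx V\<^esub> = gcomp m (b' j)"
      using False pp_zero[OF C.subspD(2)[OF W2], of m] by (simp only: b'_def gcomp_gsym if_False)
    ultimately show ?thesis by (metis (no_types))
  qed
qed

lemma c'_F: assumes u: "u \<in> Ffil U p" and j: "j < N" "d j < p" shows "c' j u = 0"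
proof -
  obtain z where z: "z \<in> Ffil V p" "z \<in> Wfil V (n j) \<times> Wfil V (n j)" "gcomp (n j) u = pp (n j) z"
    using u unfolding Ffil_U by blast
  show ?thesis unfolding c'_eq[OF j(1) z(2,3)] by (rule c_F[OF z(1) j])
qed

lemma c'_zero: assumes j: "j < N" and u: "gcomp (n j) u = \<zero>\<^bsub>cplx (gr_W V (n j))\<^esub>" shows "c' j u = 0"
proof -
  have "gcomp (n j) u = pp (n j) \<zero>\<^bsub>cplx V\<^esub>"
    unfolding u by (rule pp_zero[OF C.subspD(2)[OF W2], symmetric])
  from c'_eq[OF j C.subspD(2)[OF W2] this] show ?thesis
    using C.functional_zero[OF c_functional[OF j]] by simp
qed

lemma gcomp_above: "u \<in> Wfil U m \<times> Wfil U m \<Longrightarrow> m < i \<Longrightarrow> gcomp i u = \<zero>\<^bsub>cplx (gr_W V i)\<^esub>"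
  by (auto simp: Wfil_gr gcomp_def)

lemma c'_W: "u \<in> Wfil U m \<times> Wfil U m \<Longrightarrow> j < N \<Longrightarrow> m < n j \<Longrightarrow> c' j u = 0"
  using c'_zero[of j u] gcomp_above[of u m "n j"] by blast

lemma pp_finsum:
  assumes "\<And>j. j \<in> I \<Longrightarrow> x j \<in> Wfil V m \<times> Wfil V m"
  shows "pp m (\<Oplus>\<^bsub>cplx V\<^esub>j\<in>I. x j) = (\<Oplus>\<^bsub>cplx (gr_W V m)\<^esub>j\<in>I. pp m (x j))"
  using assms
proof (induction I rule: infinite_finite_induct)
  case (infinite I)
  then show ?case using pp_zero[OF C.subspD(2)[OF W2]] by (simp only: C.finsum_infinite CG.finsum_infinite not_False_eq_True)
next
  case empty
  show ?case using pp_zero[OF C.subspD(2)[OF W2]] by (simp only: C.finsum_empty CG.finsum_empty)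
next
  case (insert i I)
  have xC: "x j \<in> carrier (cplx V)" if "j \<in> insert i I" for j using C.subspD(6)[OF W2 insert.prems[OF that]] .
  have "(\<Oplus>\<^bsub>cplx V\<^esub>j\<in>insert i I. x j) = x i \<oplus>\<^bsub>cplx V\<^esub> (\<Oplus>\<^bsub>cplx V\<^esub>j\<in>I. x j)"
    by (rule C.finsum_insert) (use insert.hyps xC in auto)
  moreover have "(\<Oplus>\<^bsub>cplx V\<^esub>j\<in>I. x j) \<in> Wfil V m \<times> Wfil V m"
    by (rule C.subsp_finsum[OF W2]) (use insert.prems in blast)
  moreover have "(\<Oplus>\<^bsub>cplx (gr_W V m)\<^esub>j\<in>insert i I. pp m (x j)) = pp m (x i) \<oplus>\<^bsub>cplx (gr_W V m)\<^esub> (\<Oplus>\<^bsub>cplx (gr_W V m)\<^esub>j\<in>I. pp m (x j))"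
    by (rule CG.finsum_insert) (use insert.hyps pp_closed[OF insert.prems] in auto)
  moreover have "pp m (\<Oplus>\<^bsub>cplx V\<^esub>j\<in>I. x j) = (\<Oplus>\<^bsub>cplx (gr_W V m)\<^esub>j\<in>I. pp m (x j))"
    by (rule insert.IH) (use insert.prems in blast)
  ultimately show ?case using proj_pair_lin(1)[OF insert.prems[of i]] by (metis insertI1)
qed

abbreviation "gpart m r j \<equiv>
  (if n j = m then r \<odot>\<^bsub>cplx (gr_W V m)\<^esub> pp m (b j) else \<zero>\<^bsub>cplx (gr_W V m)\<^esub>)"

text \<open>
  Modulo \<open>W (m - 1)\<close> the terms of weight less than \<open>m\<close> disappear from the expansion of \<open>z\<close>, and terms of
  weight greater than \<open>m\<close> do not occur in it.
\<close>

lemma pp_expand: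
  assumes z: "z \<in> Wfil V m \<times> Wfil V m"
  shows "pp m z = (\<Oplus>\<^bsub>cplx (gr_W V m)\<^esub>j\<in>{..<N}. gpart m (c j z) j)"
proof -
  note WW = C.subspD[OF W2]
  have mono: "Wfil V i \<times> Wfil V i \<subseteq> Wfil V m \<times> Wfil V m" if "i \<le> m" for i m using W_mono[OF that] by blast
  have x: "c j z \<odot>\<^bsub>cplx V\<^esub> b j \<in> Wfil V m \<times> Wfil V m \<and> pp m (c j z \<odot>\<^bsub>cplx V\<^esub> b j) =
     (gpart m (c j z) j)" if j: "j < N" for j
  proof -
    consider "n j = m" | "n j < m" | "m < n j" by linarith
    then show ?thesis
    proof cases
      case 1
      then have bj: "b j \<in> Wfil V m \<times> Wfil V m" using b_W[OF j] by simp
      show ?thesis unfolding if_P[OF 1] using WW(4)[OF bj] proj_pair_lin(2)[OF bj bj] by blast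
    next
      case 2
      then have "b j \<in> Wfil V (m - 1) \<times> Wfil V (m - 1)" using b_W[OF j] mono[of "n j" "m - 1"] by auto
      then have *: "c j z \<odot>\<^bsub>cplx V\<^esub> b j \<in> Wfil V (m - 1) \<times> Wfil V (m - 1)" by (rule WW(4))
      have ne: "n j \<noteq> m" using 2 by simp
      show ?thesis unfolding if_not_P[OF ne]
        using subsetD[OF mono *, of m] pp_zero[OF *] by (intro conjI) simp_all
    next
      case 3
      have ne: "n j \<noteq> m" using 3 by simp
      have *: "c j z \<odot>\<^bsub>cplx V\<^esub> b j = \<zero>\<^bsub>cplx V\<^esub>" unfolding c_W[OF z j 3] by (rule C.smult_0[OF b_closed[OF j]])
      show ?thesis unfolding if_not_P[OF ne] * using WW(2) pp_zero[OF WW(2)] by blast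
    qed
  qed
  note x1 = conjunct1[OF x] and x2 = conjunct2[OF x]
  have "pp m z = pp m (\<Oplus>\<^bsub>cplx V\<^esub>j\<in>{..<N}. c j z \<odot>\<^bsub>cplx V\<^esub> b j)"
    by (rule arg_cong[of _ _ "pp m", OF expand[OF WW(6)[OF z]]])
  also have "\<dots> = (\<Oplus>\<^bsub>cplx (gr_W V m)\<^esub>j\<in>{..<N}. pp m (c j z \<odot>\<^bsub>cplx V\<^esub> b j))"
    by (rule pp_finsum, rule x1, simp)
  also have "\<dots> = (\<Oplus>\<^bsub>cplx (gr_W V m)\<^esub>j\<in>{..<N}. gpart m (c j z) j)"
  proof (rule CG.finsum_cong')
    show "(\<lambda>j. gpart m (c j z) j) \<in> {..<N} \<rightarrow> carrier (cplx (gr_W V m))"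
      by (rule Pi_I, subst x2[symmetric], simp, rule pp_closed, rule x1, simp)
  qed (rule refl, rule x2, simp)
  finally show ?thesis .
qed

lemma term_closed:
  "(\<lambda>j. gpart m (a j) j) \<in> {..<N} \<rightarrow> carrier (cplx (gr_W V m))"
proof (rule Pi_I)
  fix j assume "j \<in> {..<N}"
  then have "pp m (b j) \<in> carrier (cplx (gr_W V m))" if "n j = m" using pp_closed[OF b_W[of j]] that by simp
  then show "(gpart m (a j) j) \<in> carrier (cplx (gr_W V m))"
    using CG.scl[of "pp m (b j)" m "a j"] CG.zero_closed[of m] by (cases "n j = m") (simp_all only: if_True if_False refl simp_thms)
qed

lemma gcomp_sum:
  "gcomp m (\<Oplus>\<^bsub>cplx U\<^esub>j\<in>{..<N}. a j \<odot>\<^bsub>cplx U\<^esub> b' j) =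
    (\<Oplus>\<^bsub>cplx (gr_W V m)\<^esub>j\<in>{..<N}. gpart m (a j) j)"
proof -
  have "gcomp m (\<Oplus>\<^bsub>cplx U\<^esub>j\<in>{..<N}. a j \<odot>\<^bsub>cplx U\<^esub> b' j) = (\<Oplus>\<^bsub>cplx (gr_W V m)\<^esub>j\<in>{..<N}. gcomp m (a j \<odot>\<^bsub>cplx U\<^esub> b' j))"
    by (rule k.finsum) (rule U.C.scl, rule b'_closed, simp)
  also have "\<dots> = (\<Oplus>\<^bsub>cplx (gr_W V m)\<^esub>j\<in>{..<N}. gpart m (a j) j)"
  proof (rule CG.finsum_cong')
    show "(\<lambda>j. gpart m (a j) j) \<in> {..<N} \<rightarrow> carrier (cplx (gr_W V m))"
      by (rule term_closed)
    fix j assume "j \<in> {..<N}"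
    then have bj: "b' j \<in> carrier (cplx U)" by (simp only: lessThan_iff b'_closed)
    show "gcomp m (a j \<odot>\<^bsub>cplx U\<^esub> b' j) = (gpart m (a j) j)"
      unfolding k.smult[OF bj] unfolding b'_def gcomp_gsym
      by (cases "n j = m") (simp_all only: CG.smult_zero if_True if_False refl simp_thms)
  qed simp
  finally show ?thesis .
qed

lemma U_expand:
  assumes u: "u \<in> carrier (cplx U)"
  shows "u = (\<Oplus>\<^bsub>cplx U\<^esub>j\<in>{..<N}. c' j u \<odot>\<^bsub>cplx U\<^esub> b' j)"
proof (rule gcomp_eqI)
  fix m
  obtain z where z: "z \<in> Wfil V m \<times> Wfil V m" "gcomp m u = pp m z" using gcomp_rep[OF u] .
  show "gcomp m u = gcomp m (\<Oplus>\<^bsub>cplx U\<^esub>j\<in>{..<N}. c' j u \<odot>\<^bsub>cplx U\<^esub> b' j)"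
    unfolding gcomp_sum z(2) pp_expand[OF z(1)]
  proof (rule CG.finsum_cong')
    show "(\<lambda>j. gpart m (c' j u) j) \<in> {..<N} \<rightarrow> carrier (cplx (gr_W V m))"
      by (rule term_closed)
    fix j assume "j \<in> {..<N}"
    then have j: "j < N" by simp
    show "(gpart m (c j z) j) =
      (gpart m (c' j u) j)"
      using c'_eq[OF j, of z u] z by (cases "n j = m") simp_all
  qed simp
qed

lemma U_frame: "frame U N b' c' d"
  unfolding frame_def using b'_F c'_functional U_expand c'_F by blast

text \<open>
  The two comparison maps: \<open>\<alpha>\<close> replaces \<open>b j\<close> by \<open>b' j\<close> in the expansion of \<open>z\<close>, and \<open>\<sigma>\<close> does the opposite
  for \<open>u\<close>.
\<close>

definition "\<alpha> z = (\<Oplus>\<^bsub>cplx U\<^esub>j\<in>{..<N}. c j z \<odot>\<^bsub>cplx U\<^esub> b' j)"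
definition "\<sigma> u = (\<Oplus>\<^bsub>cplx V\<^esub>j\<in>{..<N}. c' j u \<odot>\<^bsub>cplx V\<^esub> b j)"

lemma U_anti: "p \<le> q \<Longrightarrow> Ffil U q \<subseteq> Ffil U p"
  using F_anti[of p q] unfolding subset_iff Ffil_U by blast

lemma \<alpha>_lin: "\<alpha> \<in> lin (cplx V) (cplx U)"
  unfolding \<alpha>_def[abs_def] by (rule frame_map_lin[OF C.is_vsp U.C.is_vsp c_functional b'_closed])

lemma \<sigma>_lin: "\<sigma> \<in> lin (cplx U) (cplx V)"
  unfolding \<sigma>_def[abs_def] by (rule frame_map_lin[OF U.C.is_vsp C.is_vsp c'_functional b_closed])

lemma \<alpha>_F: assumes "z \<in> Ffil V p" shows "\<alpha> z \<in> Ffil U p"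
  unfolding \<alpha>_def
proof (rule U.C.subsp_combination[OF U.F_sub b'_closed])
  fix j assume "j < N"
  then show "c j z = 0 \<or> b' j \<in> Ffil U p"
    using assms c_F[of z p j] U_anti[of p "d j"] b'_F[of j] by (cases "d j < p") auto
qed

lemma \<sigma>_F: assumes "u \<in> Ffil U p" shows "\<sigma> u \<in> Ffil V p"
  unfolding \<sigma>_def
proof (rule C.subsp_combination[OF F_sub b_closed])
  fix j assume "j < N"
  then show "c' j u = 0 \<or> b j \<in> Ffil V p"
    using assms c'_F[of u p j] F_anti[of p "d j"] b_F[of j] by (cases "d j < p") auto
qed

lemma \<alpha>_W: assumes "z \<in> Wfil V m \<times> Wfil V m" shows "\<alpha> z \<in> Wfil U m \<times> Wfil U m"
  unfolding \<alpha>_def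
proof (rule U.C.subsp_combination[OF UW2 b'_closed])
  fix j assume "j < N"
  then show "c j z = 0 \<or> b' j \<in> Wfil U m \<times> Wfil U m"
    using assms c_W[of z m j] U.W_mono[of "n j" m] b'_W[of j] by (cases "m < n j") auto
qed

lemma \<sigma>_W: assumes "u \<in> Wfil U m \<times> Wfil U m" shows "\<sigma> u \<in> Wfil V m \<times> Wfil V m"
  unfolding \<sigma>_def
proof (rule C.subsp_combination[OF W2 b_closed])
  fix j assume "j < N"
  then show "c' j u = 0 \<or> b j \<in> Wfil V m \<times> Wfil V m"
    using assms c'_W[of u m j] W_mono[of "n j" m] b_W[of j] by (cases "m < n j") auto
qed

text \<open>
  \<open>\<alpha>\<close> induces the identity on \<open>gr\<^sup>W\<close>: in degree \<open>m\<close> both elements have the expansion of \<open>pp_expand\<close>.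
\<close>

lemma \<alpha>_gsym:
  assumes z: "z \<in> Wfil V m \<times> Wfil V m"
  shows "\<alpha> z \<ominus>\<^bsub>cplx U\<^esub> map_prod (gsym m) (gsym m) z \<in> Wfil U (m - 1) \<times> Wfil U (m - 1)"
proof -
  let ?s = "map_prod (gsym m) (gsym m) z"
  have s: "?s \<in> Wfil U m \<times> Wfil U m" using z gsym_W by auto
  note cl = U.C.subspD(6)[OF UW2 \<alpha>_W[OF z]] U.C.subspD(6)[OF UW2 s]
  let ?u = "\<alpha> z \<ominus>\<^bsub>cplx U\<^esub> ?s"
  have u: "?u \<in> carrier (cplx U)" by (rule U.C.minus_closed[OF cl])
  have uW: "?u \<in> Wfil U m \<times> Wfil U m" by (rule U.C.subspD(5)[OF UW2 \<alpha>_W[OF z] s])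
  have "gcomp i ?u = \<zero>\<^bsub>cplx (gr_W V i)\<^esub>" if i: "i > m - 1" for i
  proof (cases "i = m")
    case True
    have "gcomp m (\<alpha> z) = pp m z" unfolding \<alpha>_def gcomp_sum pp_expand[OF z] ..
    moreover have "gcomp m ?s = pp m z" unfolding gcomp_gsym by simp
    ultimately have "gcomp m ?u = pp m z \<ominus>\<^bsub>cplx (gr_W V m)\<^esub> pp m z" unfolding k.minus[OF cl] by (simp only:)
    then show ?thesis unfolding True CG.minus_self[OF pp_closed[OF z]] .
  next
    case False then show ?thesis using gcomp_above[OF uW, of i] i by auto
  qed
  then have "fst ?u i = \<zero>\<^bsub>gr_W V i\<^esub> \<and> snd ?u i = \<zero>\<^bsub>gr_W V i\<^esub>" if "i > m - 1" for i
    using that by (simp add: gcomp_def)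
  then show ?thesis using u by (simp add: mem_Times_iff Wfil_gr)
qed

text \<open>
  \<open>\<sigma>\<close> induces the identity on \<open>gr\<^sup>W\<close>: the coordinates of \<open>z\<close> and of its class agree at weight \<open>m\<close>, and the
  terms of lower weight lie in \<open>W (m - 1)\<close>.
\<close>

lemma \<sigma>_gsym:
  assumes z: "z \<in> Wfil V m \<times> Wfil V m"
  shows "\<sigma> (map_prod (gsym m) (gsym m) z) \<ominus>\<^bsub>cplx V\<^esub> z \<in> Wfil V (m - 1) \<times> Wfil V (m - 1)"
proof -
  let ?s = "map_prod (gsym m) (gsym m) z"
  note zC = C.subspD(6)[OF W2 z]
  have "\<sigma> ?s \<ominus>\<^bsub>cplx V\<^esub> z = \<sigma> ?s \<ominus>\<^bsub>cplx V\<^esub> (\<Oplus>\<^bsub>cplx V\<^esub>j\<in>{..<N}. c j z \<odot>\<^bsub>cplx V\<^esub> b j)"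
    by (rule arg_cong[of _ _ "\<lambda>x. \<sigma> ?s \<ominus>\<^bsub>cplx V\<^esub> x", OF expand[OF zC]])
  also have "\<dots> = (\<Oplus>\<^bsub>cplx V\<^esub>j\<in>{..<N}. c' j ?s \<odot>\<^bsub>cplx V\<^esub> b j \<ominus>\<^bsub>cplx V\<^esub> c j z \<odot>\<^bsub>cplx V\<^esub> b j)"
    unfolding \<sigma>_def by (rule C.finsum_minus) (rule C.scl, rule b_closed, simp)+
  also have "\<dots> \<in> Wfil V (m - 1) \<times> Wfil V (m - 1)"
  proof (rule C.subsp_finsum[OF W2])
    fix j assume "j \<in> {..<N}"
    then have j: "j < N" by simp
    have bC: "a \<odot>\<^bsub>cplx V\<^esub> b j \<in> carrier (cplx V)" for a by (rule C.scl[OF b_closed[OF j]])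
    consider "n j = m" | "n j < m" | "m < n j" by linarith
    then show "c' j ?s \<odot>\<^bsub>cplx V\<^esub> b j \<ominus>\<^bsub>cplx V\<^esub> c j z \<odot>\<^bsub>cplx V\<^esub> b j \<in> Wfil V (m - 1) \<times> Wfil V (m - 1)"
    proof cases
      case 1
      have "gcomp (n j) ?s = pp (n j) z" unfolding gcomp_gsym 1 by simp
      then have "c' j ?s = c j z" using z 1 by (intro c'_eq[OF j]) simp_all
      then show ?thesis using C.minus_self[OF bC] C.subspD(2)[OF W2] by (simp only:)
    next
      case 2
      then have "b j \<in> Wfil V (m - 1) \<times> Wfil V (m - 1)" using b_W[OF j] W_mono[of "n j" "m - 1"] by auto
      then show ?thesis by (intro C.subspD(5)[OF W2] C.subspD(4)[OF W2])
    next
      case 3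
      have "gcomp (n j) ?s = \<zero>\<^bsub>cplx (gr_W V (n j))\<^esub>" unfolding gcomp_gsym using 3 by simp
      then have "c' j ?s = c j z" using c'_zero[OF j] c_W[OF z j 3] by simp
      then show ?thesis using C.minus_self[OF bC] C.subspD(2)[OF W2] by (simp only:)
    qed
  qed
  finally show ?thesis .
qed

lemma U_top: "Ffil U hi' = {\<zero>\<^bsub>cplx U\<^esub>}"
proof
  show "Ffil U hi' \<subseteq> {\<zero>\<^bsub>cplx U\<^esub>}"
  proof
    fix u assume u: "u \<in> Ffil U hi'"
    have "gcomp m u = gcomp m \<zero>\<^bsub>cplx U\<^esub>" for m
    proof -
      obtain z where "z \<in> Ffil V hi'" "gcomp m u = pp m z" using u unfolding Ffil_U by blast
      then show ?thesis using k.zero[of m] pp_zero[OF C.subspD(2)[OF W2], of m] unfolding F_top by (metis singletonD)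
    qed
    then show "u \<in> {\<zero>\<^bsub>cplx U\<^esub>}" using gcomp_eqI by blast
  qed
  show "{\<zero>\<^bsub>cplx U\<^esub>} \<subseteq> Ffil U hi'" using U.C.subspD(2)[OF U.F_sub] by blast
qed

lemma U_low: "Ffil U lo' = carrier (cplx U)"
proof
  show "carrier (cplx U) \<subseteq> Ffil U lo'"
  proof
    fix u assume u: "u \<in> carrier (cplx U)"
    have "\<exists>z \<in> Ffil V lo' \<inter> Wfil V m \<times> Wfil V m. gcomp m u = pp m z" for m
      using gcomp_rep[OF u, of m] C.subspD(6)[OF W2] unfolding F_low by blast
    then show "u \<in> Ffil U lo'" using u unfolding Ffil_U by blast
  qed
qed (use Ffil_U in blast)

lemma U_bounded: "bounded_fvs U"
proof (rule bounded_fvs.intro[OF gr_fvs], unfold_locales)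
  have "Wfil U lo = {\<zero>\<^bsub>U\<^esub>}"
  proof -
    have "u = \<zero>\<^bsub>U\<^esub>" if u: "u \<in> Wfil U lo" for u
    proof (rule HOL.ext)
      fix m show "u m = \<zero>\<^bsub>U\<^esub> m"
      proof (cases "lo < m")
        case True then show ?thesis using u by (simp add: Wfil_gr gr_simps(1))
      next
        case False
        then have "Wfil V m = {\<zero>}" using W_mono[of m lo] W_bot subspD(2)[OF W_sub, of m] by auto
        moreover have "u m \<in> carrier (gr_W V m)" using u by (simp add: Wfil_gr gr_carrier)
        ultimately obtain v where "v = \<zero>" "u m = proj m v" using proj_surj[of "u m" m] by blast
        then show ?thesis using proj_zero[OF subspD(2)[OF W_sub]] by (simp add: gr_simps(1))
      qed
    qed
    then show ?thesis using U.subspD(2)[OF U.W_sub] by blast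
  qed
  then show "\<exists>lo. Wfil U lo = {\<zero>\<^bsub>U\<^esub>}" by blast
  have "Wfil U hi = carrier U"
  proof -
    have "u m = \<zero>\<^bsub>gr_W V m\<^esub>" if u: "u \<in> carrier U" and m: "hi < m" for u m
    proof -
      have "u m \<in> carrier (gr_W V m)" using u by (simp add: gr_carrier)
      then obtain v where v: "v \<in> Wfil V m" "u m = proj m v" using proj_surj by blast
      have "v \<in> Wfil V (m - 1)" using Wfil_carrier[OF v(1)] W_mono[of hi "m - 1"] m W_top by auto
      then show ?thesis unfolding v(2) by (rule proj_zero)
    qed
    then show ?thesis by (auto simp: Wfil_gr)
  qed
  then show "\<exists>hi. Wfil U hi = carrier U" by blast
qed

end

lemma range_reflect: "range (\<lambda>p :: int. f (- p)) = range f"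
proof -
  have "surj (uminus :: int \<Rightarrow> int)" by (rule surjI[of _ uminus]) simp
  then have "f ` range (uminus :: int \<Rightarrow> int) = range f" by (simp only:)
  then show ?thesis by (simp only: image_image)
qed

text \<open>
  Finite dimension turns the Hausdorff and exhaustiveness conditions into bounds for both filtrations, as
  \<open>biframe_exists\<close> requires.
\<close>

lemma mhs_biframed:
  assumes "mhs V"
  obtains N b c d n lo hi lo' hi' where "biframed V N b c d n lo hi lo' hi'"
proof -
  interpret mhs V by fact
  have vs: "vsp V" by (simp add: vsp_def vectorspace_axioms)
  interpret V: fvs V by (rule fvs.intro[OF vs W_subspace W_mono F_subspace])
  obtain A where A: "finite A" "A \<subseteq> carrier V" "LinearCombinations.module.span class_ring V A = carrier V"
    using finite_dimensional unfolding fin_dim_def by blast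
  obtain G where G: "finite G" "G \<subseteq> carrier (cplx V)" "LinearCombinations.module.span class_ring (cplx V) G = carrier (cplx V)"
    using cplx_finitely_generated[OF vs A] by blast
  obtain hi' where hi': "Ffil V hi' = {\<zero>\<^bsub>cplx V\<^esub>}"
    using V.C.separated_filtration_bounded[OF G F_subspace F_antimono F_Hausdorff] .
  obtain lo where lo: "Wfil V (- lo) = {\<zero>\<^bsub>V\<^esub>}"
  proof (rule V.separated_filtration_bounded[OF A, of "\<lambda>p. Wfil V (- p)"])
    show "(\<Inter>p. Wfil V (- p)) = {\<zero>\<^bsub>V\<^esub>}" unfolding range_reflect by (rule W_Hausdorff)
  qed (use W_subspace W_mono in simp_all)
  obtain hi where hi: "Wfil V hi = carrier V"
    using V.exhaustive_filtration_bounded[OF A W_subspace W_mono W_exhaustive] .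
  obtain lo' where lo': "Ffil V (- lo') = carrier (cplx V)"
  proof (rule V.C.exhaustive_filtration_bounded[OF G, of "\<lambda>p. Ffil V (- p)"])
    show "(\<Union>p. Ffil V (- p)) = carrier (cplx V)" unfolding range_reflect by (rule F_exhaustive)
  qed (use F_subspace F_antimono in simp_all)
  have "\<exists>N b c d n. biframe (cplx V) (Ffil V) (\<lambda>m. Wfil V m \<times> Wfil V m) (carrier (cplx V)) N b c d n"
  proof (rule V.C.biframe_exists[OF G F_subspace F_antimono F_exhaustive hi'])
    show "subsp (Wfil V n \<times> Wfil V n) (cplx V)" for n by (rule subsp_cplx[OF vs W_subspace])
    show "Wfil V m \<times> Wfil V m \<subseteq> Wfil V n \<times> Wfil V n" if "m \<le> n" for m n using W_mono[OF that] by blast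
    show "(\<Union>n. Wfil V n \<times> Wfil V n) = carrier (cplx V)"
    proof
      show "carrier (cplx V) \<subseteq> (\<Union>n. Wfil V n \<times> Wfil V n)"
        unfolding cplx_simps(1) hi[symmetric] by (rule UN_upper) simp
      show "(\<Union>n. Wfil V n \<times> Wfil V n) \<subseteq> carrier (cplx V)"
        using V.C.subspD(1)[OF subsp_cplx[OF vs W_subspace]] by blast
    qed
    show "Wfil V (- lo) \<times> Wfil V (- lo) = {\<zero>\<^bsub>cplx V\<^esub>}" using lo by simp
  qed
  then obtain N b c d n where "biframe (cplx V) (Ffil V) (\<lambda>m. Wfil V m \<times> Wfil V m) (carrier (cplx V)) N b c d n"
    by blast
  then have "biframed V N b c d n (- lo) hi (- lo') hi'"
    using F_antimono lo hi lo' hi' by (intro biframed.intro biframed_axioms.intro V.fvs_axioms) auto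
  then show ?thesis by (rule that)
qed

section \<open>The torsor of splittings\<close>

context biframed begin

interpretation U: bounded_fvs U by (rule U_bounded)
interpretation B: bounded_fvs V using W_bot W_top by unfold_locales blast+
interpretation EU: endo_fvs U by unfold_locales

lemma symbol_eq: "symbol V m f = (\<lambda>k. gsym m (f k))"
  unfolding symbol_def gsym_def proj_def by (rule refl)

lemma gsym_zero: "gsym m \<zero> = \<zero>\<^bsub>U\<^esub>"
proof (rule HOL.ext)
  fix i show "gsym m \<zero> i = \<zero>\<^bsub>U\<^esub> i"
    using proj_zero[OF subspD(2)[OF W_sub], of m] by (simp add: gsym_def gr_simps(1))
qed

lemma symbol_W: assumes f: "f \<in> Wfil (tensor_S V) m" shows "symbol V m f \<in> Wfil (tensor_S U) m"
proof -
  have f': "f \<in> carrier (S_vs V)" "\<And>k. f k \<in> Wfil V m" using f by (auto simp: Wfil_tensor)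
  obtain K where K: "\<And>k. k \<ge> K \<Longrightarrow> f k = \<zero>" using S_vs_bound[OF f'(1)] by metis
  have "symbol V m f \<in> carrier (S_vs U)"
  proof (rule S_vs_carrierI)
    show "symbol V m f k \<in> carrier U" for k unfolding symbol_eq by (rule U.Wfil_carrier[OF gsym_W[OF f'(2)]])
    show "symbol V m f k = \<zero>\<^bsub>U\<^esub>" if "K \<le> k" for k
      unfolding symbol_eq K[OF that] by (rule gsym_zero)
  qed
  then show ?thesis unfolding U.Wfil_tensor symbol_eq using gsym_W[OF f'(2)] by blast
qed

lemma symbol_surj:
  assumes g: "g \<in> Wfil (tensor_S U) m"
  obtains f where "f \<in> Wfil (tensor_S V) m" "g \<ominus>\<^bsub>S_vs U\<^esub> symbol V m f \<in> Wfil (tensor_S U) (m - 1)"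
proof -
  have g': "g \<in> carrier (S_vs U)" "\<And>k. g k \<in> Wfil U m" using g by (auto simp: U.Wfil_tensor)
  have gc: "g k i \<in> carrier (gr_W V i)" for k i using g'(2)[of k] by (simp add: Wfil_gr gr_carrier)
  \<comment> \<open>the case distinction makes \<open>f\<close> finitely supported, as the chosen
    representative of a zero class may be nonzero\<close>
  define f where "f k = (if g k = \<zero>\<^bsub>U\<^esub> then \<zero> else rep m (g k m))" for k
  have fW: "f k \<in> Wfil V m" for k
    using rep(1)[OF gc] subspD(2)[OF W_sub] by (simp add: f_def)
  have fp: "g k m = proj m (f k)" for k
    using rep(2)[OF gc, of k m] proj_zero[OF subspD(2)[OF W_sub], of m] by (simp add: f_def gr_simps(1))
  obtain K where K: "\<And>k. k \<ge> K \<Longrightarrow> g k = \<zero>\<^bsub>U\<^esub>" using S_vs_bound[OF g'(1)] by metis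
  have "f \<in> carrier (S_vs V)"
    by (rule S_vs_carrierI[OF Wfil_carrier[OF fW], of K]) (simp add: f_def K)
  then have f: "f \<in> Wfil (tensor_S V) m" using fW by (simp add: Wfil_tensor)
  have sC: "symbol V m f \<in> carrier (S_vs U)" using U.S.subspD(6)[OF U.W_tensor_sub symbol_W[OF f]] .
  have "g k \<ominus>\<^bsub>U\<^esub> gsym m (f k) \<in> Wfil U (m - 1)" for k
  proof -
    note c = U.Wfil_carrier[OF g'(2)[of k]] U.Wfil_carrier[OF gsym_W[OF fW[of k]]]
    interpret G: vsp "gr_W V i" for i by (rule vsp_gr_W)
    have "(g k \<ominus>\<^bsub>U\<^esub> gsym m (f k)) i = \<zero>\<^bsub>gr_W V i\<^esub>" if "m - 1 < i" for i
    proof (cases "i = m")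
      case True
      have "gsym m (f k) m = g k m" unfolding fp by (simp add: gsym_def)
      then show ?thesis unfolding True gr_apply(3)[OF c] using G.minus_self[OF gc[of k m]] by (simp only:)
    next
      case False
      then have "g k i = \<zero>\<^bsub>gr_W V i\<^esub>" using g'(2)[of k] that by (simp add: Wfil_gr)
      moreover have "gsym m (f k) i = \<zero>\<^bsub>gr_W V i\<^esub>" using False by (simp add: gsym_def)
      ultimately show ?thesis unfolding gr_apply(3)[OF c] using G.minus_self[OF G.zero_closed] by (simp only:)
    qed
    then show ?thesis using U.minus_closed[OF c] by (simp add: Wfil_gr)
  qed
  then have "g \<ominus>\<^bsub>S_vs U\<^esub> symbol V m f \<in> Wfil (tensor_S U) (m - 1)"
    using U.S.minus_closed[OF g'(1) sC] U.S_vs_apply(3)[OF g'(1) sC]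
    unfolding U.Wfil_tensor by (simp only: mem_Collect_eq symbol_eq simp_thms)
  then show ?thesis using that f by blast
qed

text \<open>
  From here on, the group is handled through its description by unipotent automorphisms.
\<close>

lemma split_group_carrier: "carrier (split_group V) = S_unip U"
proof
  show "carrier (split_group V) \<subseteq> S_unip U"
    using EU.id_plus_act_unip by (auto simp: split_group_def Let_def simp del: S_vs_simps)
  show "S_unip U \<subseteq> carrier (split_group V)"
  proof
    fix g assume "g \<in> S_unip U"
    from EU.unip_is_act[OF U_anti U_frame this] obtain e where
      "e \<in> Wfil (tensor_S (End_qmhs U)) (- 1) \<inter> gam 0 (tensor_S (End_qmhs U))"
      "g = (\<lambda>f\<in>carrier (S_vs U). f \<oplus>\<^bsub>S_vs U\<^esub> End_act U e f)" .
    then show "g \<in> carrier (split_group V)" by (auto simp: split_group_def Let_def simp del: S_vs_simps)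
  qed
qed

lemma split_group_simps:
  "monoid.mult (split_group V) g h = compose (carrier (S_vs U)) g h"
  "\<one>\<^bsub>split_group V\<^esub> = (\<lambda>f\<in>carrier (S_vs U). f)"
  by (simp_all add: split_group_def Let_def)

lemma unip_funcset: "g \<in> S_unip U \<Longrightarrow> g \<in> carrier (S_vs U) \<rightarrow> carrier (S_vs U)"
  using S_hom_closed[of g U U] by (simp add: S_unip_def)

lemma unip_ext: "g \<in> S_unip U \<Longrightarrow> g \<in> extensional (carrier (S_vs U))"
  by (simp add: S_unip_def S_hom_def)

lemma split_group: "group (split_group V)"
proof (rule groupI, unfold split_group_carrier split_group_simps)
  fix g assume g: "g \<in> S_unip U"
  show "compose (carrier (S_vs U)) (\<lambda>f\<in>carrier (S_vs U). f) g = g"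
    by (rule Id_compose[OF unip_funcset[OF g] unip_ext[OF g]])
  obtain h where h: "h \<in> S_unip U" "\<And>f. f \<in> carrier (S_vs U) \<Longrightarrow> h (g f) = f"
    using U.S_unip_left_inverse[OF g] by blast
  then have "compose (carrier (S_vs U)) h g = (\<lambda>f\<in>carrier (S_vs U). f)" by (auto simp: compose_def)
  then show "\<exists>h\<in>S_unip U. compose (carrier (S_vs U)) h g = (\<lambda>f\<in>carrier (S_vs U). f)" using h(1) by blast
  fix h assume h: "h \<in> S_unip U"
  show "compose (carrier (S_vs U)) g h \<in> S_unip U" by (rule U.S_unip_compose[OF g h])
  fix k assume k: "k \<in> S_unip U"
  show "compose (carrier (S_vs U)) (compose (carrier (S_vs U)) g h) k = compose (carrier (S_vs U)) g (compose (carrier (S_vs U)) h k)"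
    using compose_assoc[OF unip_funcset[OF k], of g h] by simp
next
  show "(\<lambda>f\<in>carrier (S_vs U). f) \<in> S_unip U" by (rule U.S_unip_id)
qed

definition "gr_id \<phi> \<longleftrightarrow> (\<forall>m. \<forall>f\<in>Wfil (tensor_S V) m. \<phi> f \<ominus>\<^bsub>S_vs U\<^esub> symbol V m f \<in> Wfil (tensor_S U) (m - 1))"

text \<open>
  The inverse of a splitting is \<open>\<S>\<close>-linear, as the inverse of any \<open>\<S>\<close>-linear bijection.
\<close>

lemma splittings_iff:
  "\<phi> \<in> S_splittings V \<longleftrightarrow> \<phi> \<in> S_hom V U \<and> gr_id \<phi> \<and> (\<exists>\<psi>\<in>S_hom U V.
     (\<forall>x\<in>carrier (S_vs V). \<psi> (\<phi> x) = x) \<and> (\<forall>y\<in>carrier (S_vs U). \<phi> (\<psi> y) = y))"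
proof
  assume "\<phi> \<in> S_splittings V"
  then have \<phi>: "\<phi> \<in> S_hom V U" "gr_id \<phi>" and iso: "\<phi> \<in> qmhs_iso (tensor_S V) (tensor_S U)"
    using S_hom_iff[OF vs U.vs, of \<phi>] by (auto simp: S_splittings_def S_hom_eq gr_id_def qmhs_iso_def simp del: S_vs_simps)
  obtain \<psi> where \<psi>: "\<psi> \<in> qmhs_hom (tensor_S U) (tensor_S V)"
    "\<And>x. x \<in> carrier (S_vs V) \<Longrightarrow> \<psi> (\<phi> x) = x" "\<And>y. y \<in> carrier (S_vs U) \<Longrightarrow> \<phi> (\<psi> y) = y"
    using iso by (auto simp: qmhs_iso_def simp del: S_vs_simps)
  have l: "\<psi> \<in> lin (S_vs U) (S_vs V)" using \<psi>(1) by (simp add: qmhs_hom_def lin_tensor_S)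
  then have c: "\<psi> y \<in> carrier (S_vs V)" if "y \<in> carrier (S_vs U)" for y using that by (auto simp: LinearCombinations.module_hom_def)
  have "\<psi> (shift U y) = shift V (\<psi> y)" if y: "y \<in> carrier (S_vs U)" for y
  proof -
    have "\<phi> (shift V (\<psi> y)) = shift U y" using \<phi>(1) c[OF y] \<psi>(3)[OF y] by (simp add: S_hom_def S_lin_def)
    then show ?thesis using \<psi>(2)[OF shift_closed[OF c[OF y]]] by simp
  qed
  then have "\<psi> \<in> S_hom U V" using \<psi>(1) l by (simp add: S_hom_eq S_lin_def)
  then show "\<phi> \<in> S_hom V U \<and> gr_id \<phi> \<and> (\<exists>\<psi>\<in>S_hom U V.
     (\<forall>x\<in>carrier (S_vs V). \<psi> (\<phi> x) = x) \<and> (\<forall>y\<in>carrier (S_vs U). \<phi> (\<psi> y) = y))"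
    using \<phi> \<psi>(2,3) by blast
next
  assume "\<phi> \<in> S_hom V U \<and> gr_id \<phi> \<and> (\<exists>\<psi>\<in>S_hom U V.
     (\<forall>x\<in>carrier (S_vs V). \<psi> (\<phi> x) = x) \<and> (\<forall>y\<in>carrier (S_vs U). \<phi> (\<psi> y) = y))"
  then show "\<phi> \<in> S_splittings V"
    using S_hom_iff[OF vs U.vs, of \<phi>] by (auto simp: S_splittings_def S_hom_eq gr_id_def qmhs_iso_def simp del: S_vs_simps)
qed

lemma S_hom_minus:
  assumes "fvs X" "fvs Y" "\<phi> \<in> S_hom X Y" "f \<in> carrier (S_vs X)" "g \<in> carrier (S_vs X)"
  shows "\<phi> (f \<ominus>\<^bsub>S_vs X\<^esub> g) = \<phi> f \<ominus>\<^bsub>S_vs Y\<^esub> \<phi> g"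
proof -
  interpret X: fvs X by fact
  interpret Y: fvs Y by fact
  interpret linmap "S_vs X" "S_vs Y" \<phi> by unfold_locales (rule S_hom_lin[OF assms(3)])
  show ?thesis by (rule minus[OF assms(4,5)])
qed

lemma W_tensor_carrier: "f \<in> Wfil (tensor_S V) m \<Longrightarrow> f \<in> carrier (S_vs V)"
  "g \<in> Wfil (tensor_S U) m \<Longrightarrow> g \<in> carrier (S_vs U)"
  by (simp_all add: Wfil_tensor U.Wfil_tensor)

text \<open>
  \<open>\<phi>\<close> and \<open>\<psi>\<close> come from \<open>\<alpha>\<close> and \<open>\<sigma>\<close>.  They induce inverse maps on \<open>gr\<^sup>W\<close>, but need not be inverse to each
  other.
\<close>

lemma splitting_pair:
  obtains \<phi> \<psi> where "\<phi> \<in> S_hom V U" "\<psi> \<in> S_hom U V" "gr_id \<phi>"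
    "\<forall>m. \<forall>f\<in>Wfil (tensor_S V) m. \<psi> (symbol V m f) \<ominus>\<^bsub>S_vs V\<^esub> f \<in> Wfil (tensor_S V) (m - 1)"
proof -
  obtain s where s: "[:- \<i>, 1:] ^ nat (hi' - lo') dvd cpoly (s, - 1)" using real_poly_approximates_i by blast
  interpret A: S_ext V U \<alpha> s hi' lo'
    by (rule S_ext.intro[OF fvs_axioms U.fvs_axioms
          S_ext_axioms.intro[OF \<alpha>_lin \<alpha>_F \<alpha>_W F_anti F_top U_low s]])
  interpret S: S_ext U V \<sigma> s hi' lo'
    by (rule S_ext.intro[OF U.fvs_axioms fvs_axioms
          S_ext_axioms.intro[OF \<sigma>_lin \<sigma>_F \<sigma>_W U_anti U_top F_low s]])
  have symC: "symbol V m f \<in> carrier (S_vs U)" if "f \<in> Wfil (tensor_S V) m" for m f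
    using W_tensor_carrier(2)[OF symbol_W[OF that]] .
  have z: "(v, \<zero>) \<in> Wfil V m \<times> Wfil V m" if "v \<in> Wfil V m" for v m using that subspD(2)[OF W_sub] by simp
  have 1: "S_extension V U s \<alpha> f \<ominus>\<^bsub>S_vs U\<^esub> symbol V m f \<in> Wfil (tensor_S U) (m - 1)"
    if f: "f \<in> Wfil (tensor_S V) m" for m f
  proof -
    have "A.A v \<ominus>\<^bsub>U\<^esub> gsym m v \<in> Wfil U (m - 1) \<and> A.B v \<in> Wfil U (m - 1)" if v: "v \<in> Wfil V m" for v
    proof -
      note cl = A.AB_W[OF v, THEN U.Wfil_carrier] U.Wfil_carrier[OF gsym_W[OF v]]
      have "\<alpha> (v, \<zero>) \<ominus>\<^bsub>cplx U\<^esub> (gsym m v, \<zero>\<^bsub>U\<^esub>) \<in> Wfil U (m - 1) \<times> Wfil U (m - 1)"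
        using \<alpha>_gsym[OF z[OF v]] gsym_zero by simp
      then show ?thesis unfolding A.\<tau>_real[OF Wfil_carrier[OF v]] using cl
        by (simp add: cplx_minus[OF U.vs])
    qed
    then show ?thesis unfolding symbol_eq
      by (intro A.\<phi>_congruent[OF W_tensor_carrier(1)[OF f] symC[OF f, unfolded symbol_eq]])
        (use f in \<open>simp_all add: Wfil_tensor\<close>)
  qed
  have 2: "S_extension U V s \<sigma> (symbol V m f) \<ominus>\<^bsub>S_vs V\<^esub> f \<in> Wfil (tensor_S V) (m - 1)"
    if f: "f \<in> Wfil (tensor_S V) m" for m f
  proof -
    have "S.A (gsym m v) \<ominus> v \<in> Wfil V (m - 1) \<and> S.B (gsym m v) \<in> Wfil V (m - 1)" if v: "v \<in> Wfil V m" for v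
    proof -
      note cl = S.AB_W[OF gsym_W[OF v], THEN Wfil_carrier] Wfil_carrier[OF v]
      have "\<sigma> (gsym m v, \<zero>\<^bsub>U\<^esub>) \<ominus>\<^bsub>cplx V\<^esub> (v, \<zero>) \<in> Wfil V (m - 1) \<times> Wfil V (m - 1)"
        using \<sigma>_gsym[OF z[OF v]] gsym_zero by simp
      then show ?thesis unfolding S.\<tau>_real[OF U.Wfil_carrier[OF gsym_W[OF v]]] using cl
        by (simp add: cplx_minus[OF vs])
    qed
    then show ?thesis
      by (intro S.\<phi>_congruent[OF symC[OF f] W_tensor_carrier(1)[OF f]])
        (use f in \<open>simp_all add: Wfil_tensor symbol_eq\<close>)
  qed
  show ?thesis using that[OF A.\<phi>_S_hom S.\<phi>_S_hom] 1 2 unfolding gr_id_def by blast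
qed

end

context biframed begin

interpretation U: bounded_fvs U by (rule U_bounded)
interpretation B: bounded_fvs V using W_bot W_top by unfold_locales blast+

text \<open>
  With the maps of \<open>splitting_pair\<close>, both \<open>\<psi>\<phi>\<close> and \<open>\<phi>\<psi>\<close> are unipotent and hence invertible, so \<open>\<phi>\<close> is an
  isomorphism with inverse \<open>(\<psi>\<phi>)\<^sup>-\<^sup>1\<psi>\<close>.
\<close>

lemma splittings_nonempty: "S_splittings V \<noteq> {}"
proof -
  obtain \<phi> \<psi> where \<phi>: "\<phi> \<in> S_hom V U" and \<psi>: "\<psi> \<in> S_hom U V" and gr: "gr_id \<phi>"
    and \<psi>gr': "\<forall>m. \<forall>f\<in>Wfil (tensor_S V) m. \<psi> (symbol V m f) \<ominus>\<^bsub>S_vs V\<^esub> f \<in> Wfil (tensor_S V) (m - 1)"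
    using splitting_pair .
  have \<psi>gr: "\<psi> (symbol V m f) \<ominus>\<^bsub>S_vs V\<^esub> f \<in> Wfil (tensor_S V) (m - 1)" if "f \<in> Wfil (tensor_S V) m" for f m
    using \<psi>gr' that by blast
  have \<phi>gr: "\<phi> f \<ominus>\<^bsub>S_vs U\<^esub> symbol V m f \<in> Wfil (tensor_S U) (m - 1)" if "f \<in> Wfil (tensor_S V) m" for f m
    using gr that by (simp add: gr_id_def)
  let ?C = "carrier (S_vs V)" and ?D = "carrier (S_vs U)"
  have 1: "compose ?C \<psi> \<phi> \<in> S_unip V"
    unfolding S_unip_def
  proof (intro CollectI conjI allI ballI)
    show "compose ?C \<psi> \<phi> \<in> S_hom V V" by (rule S_hom_compose[OF fvs_axioms U.vs \<psi> \<phi>])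
    fix m f assume f: "f \<in> Wfil (tensor_S V) m"
    note fC = W_tensor_carrier(1)[OF f] and sC = W_tensor_carrier(2)[OF symbol_W[OF f]]
    have "\<psi> (\<phi> f) \<ominus>\<^bsub>S_vs V\<^esub> \<psi> (symbol V m f) \<in> Wfil (tensor_S V) (m - 1)"
      using S_hom_W[OF \<psi> \<phi>gr[OF f]] S_hom_minus[OF U.fvs_axioms fvs_axioms \<psi> S_hom_closed[OF \<phi> fC] sC] by simp
    from S.subsp_telescope[OF W_tensor_sub S_hom_closed[OF \<psi> S_hom_closed[OF \<phi> fC]] S_hom_closed[OF \<psi> sC] fC this \<psi>gr[OF f]]
    show "compose ?C \<psi> \<phi> f \<ominus>\<^bsub>S_vs V\<^esub> f \<in> Wfil (tensor_S V) (m - 1)" using fC by (simp add: compose_def)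
  qed
  have 2: "compose ?D \<phi> \<psi> \<in> S_unip U"
    unfolding S_unip_def
  proof (intro CollectI conjI allI ballI)
    show "compose ?D \<phi> \<psi> \<in> S_hom U U" by (rule S_hom_compose[OF U.fvs_axioms vs \<phi> \<psi>])
    fix m g assume g: "g \<in> Wfil (tensor_S U) m"
    note gC = W_tensor_carrier(2)[OF g]
    obtain f where f: "f \<in> Wfil (tensor_S V) m" and gf: "g \<ominus>\<^bsub>S_vs U\<^esub> symbol V m f \<in> Wfil (tensor_S U) (m - 1)"
      using symbol_surj[OF g] .
    note fC = W_tensor_carrier(1)[OF f] and sC = W_tensor_carrier(2)[OF symbol_W[OF f]]
    note \<psi>g = S_hom_closed[OF \<psi> gC]
    have "\<psi> g \<ominus>\<^bsub>S_vs V\<^esub> \<psi> (symbol V m f) \<in> Wfil (tensor_S V) (m - 1)"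
      using S_hom_W[OF \<psi> gf] S_hom_minus[OF U.fvs_axioms fvs_axioms \<psi> gC sC] by simp
    from S.subsp_telescope[OF W_tensor_sub \<psi>g S_hom_closed[OF \<psi> sC] fC this \<psi>gr[OF f]]
    have "\<psi> g \<ominus>\<^bsub>S_vs V\<^esub> f \<in> Wfil (tensor_S V) (m - 1)" .
    from S_hom_W[OF \<phi> this] have "\<phi> (\<psi> g) \<ominus>\<^bsub>S_vs U\<^esub> \<phi> f \<in> Wfil (tensor_S U) (m - 1)"
      unfolding S_hom_minus[OF fvs_axioms U.fvs_axioms \<phi> \<psi>g fC] .
    from U.S.subsp_telescope[OF U.W_tensor_sub S_hom_closed[OF \<phi> \<psi>g] S_hom_closed[OF \<phi> fC] sC this \<phi>gr[OF f]]
    have "\<phi> (\<psi> g) \<ominus>\<^bsub>S_vs U\<^esub> symbol V m f \<in> Wfil (tensor_S U) (m - 1)" .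
    from U.S.subsp_telescope[OF U.W_tensor_sub S_hom_closed[OF \<phi> \<psi>g] sC gC this
        U.S.subsp_minus_swap[OF U.W_tensor_sub gC sC gf]]
    show "compose ?D \<phi> \<psi> g \<ominus>\<^bsub>S_vs U\<^esub> g \<in> Wfil (tensor_S U) (m - 1)" using gC by (simp add: compose_def)
  qed
  obtain h where h: "h \<in> S_unip V" "\<And>f. f \<in> ?C \<Longrightarrow> h (\<psi> (\<phi> f)) = f"
    using B.S_unip_left_inverse[OF 1] by (auto simp: compose_def simp del: S_vs_simps)
  interpret G: group "split_group V" by (rule split_group)
  obtain k where k: "k \<in> S_unip U" "compose ?D (compose ?D \<phi> \<psi>) k = (\<lambda>f\<in>?D. f)"
    using G.r_inv_ex[of "compose ?D \<phi> \<psi>"] 2 unfolding split_group_carrier split_group_simps by blast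
  have surj: "\<exists>f\<in>?C. \<phi> f = g" if g: "g \<in> ?D" for g
  proof -
    have kg: "k g \<in> ?D" using unip_funcset[OF k(1)] g by blast
    have "\<phi> (\<psi> (k g)) = g" using fun_cong[OF k(2), of g] g kg by (simp add: compose_def)
    then show ?thesis using S_hom_closed[OF \<psi> kg] by blast
  qed
  have h': "h \<in> S_hom V V" using h(1) by (simp add: S_unip_def)
  let ?\<chi> = "compose ?D h \<psi>"
  have \<chi>: "?\<chi> \<in> S_hom U V" by (rule S_hom_compose[OF U.fvs_axioms vs h' \<psi>])
  have l: "?\<chi> (\<phi> f) = f" if "f \<in> ?C" for f
    using h(2)[OF that] S_hom_closed[OF \<phi> that] by (simp add: compose_def)
  have r: "\<phi> (?\<chi> g) = g" if "g \<in> ?D" for g using surj[OF that] l by metis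
  have "\<phi> \<in> S_splittings V" unfolding splittings_iff using \<phi> gr \<chi> l r by blast
  then show ?thesis by blast
qed

lemma splitting_translate:
  assumes g: "g \<in> S_unip U" and \<phi>: "\<phi> \<in> S_splittings V"
  shows "compose (carrier (S_vs V)) g \<phi> \<in> S_splittings V"
proof -
  let ?C = "carrier (S_vs V)" and ?D = "carrier (S_vs U)"
  obtain \<psi> where \<phi>': "\<phi> \<in> S_hom V U" "gr_id \<phi>" and \<psi>: "\<psi> \<in> S_hom U V"
    and inv: "\<And>x. x \<in> ?C \<Longrightarrow> \<psi> (\<phi> x) = x" "\<And>y. y \<in> ?D \<Longrightarrow> \<phi> (\<psi> y) = y"
    using \<phi> unfolding splittings_iff by blast
  interpret G: group "split_group V" by (rule split_group)
  have g': "g \<in> S_hom U U" using g by (simp add: S_unip_def)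
  obtain k where k: "k \<in> S_unip U" and kg: "compose ?D k g = (\<lambda>f\<in>?D. f)" and gk: "compose ?D g k = (\<lambda>f\<in>?D. f)"
    using G.l_inv[of g] G.r_inv[of g] G.inv_closed[of g] g unfolding split_group_carrier split_group_simps by blast
  have k': "k \<in> S_hom U U" using k by (simp add: S_unip_def)
  have kg': "k (g y) = y" if "y \<in> ?D" for y using fun_cong[OF kg, of y] that by (simp add: compose_def)
  have gk': "g (k y) = y" if "y \<in> ?D" for y using fun_cong[OF gk, of y] that by (simp add: compose_def)
  show ?thesis unfolding splittings_iff
  proof (intro conjI bexI[of _ "compose ?D \<psi> k"] ballI)
    show "compose ?C g \<phi> \<in> S_hom V U" by (rule S_hom_compose[OF fvs_axioms U.vs g' \<phi>'(1)])
    show "compose ?D \<psi> k \<in> S_hom U V" by (rule S_hom_compose[OF U.fvs_axioms U.vs \<psi> k'])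
    show "compose ?D \<psi> k (compose ?C g \<phi> x) = x" if x: "x \<in> ?C" for x
    proof -
      note c = S_hom_closed[OF \<phi>'(1) x]
      show ?thesis using kg'[OF c] inv(1)[OF x] S_hom_closed[OF g' c] x by (simp add: compose_def)
    qed
    show "compose ?C g \<phi> (compose ?D \<psi> k y) = y" if y: "y \<in> ?D" for y
    proof -
      note c = S_hom_closed[OF k' y]
      show ?thesis using gk'[OF y] inv(2)[OF c] S_hom_closed[OF \<psi> c] y by (simp add: compose_def)
    qed
    show "gr_id (compose ?C g \<phi>)" unfolding gr_id_def
    proof (intro allI ballI)
      fix m f assume f: "f \<in> Wfil (tensor_S V) m"
      note fC = W_tensor_carrier(1)[OF f] and sC = W_tensor_carrier(2)[OF symbol_W[OF f]]
      note c = S_hom_closed[OF \<phi>'(1) fC]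
      have "g (\<phi> f) \<ominus>\<^bsub>S_vs U\<^esub> \<phi> f \<in> Wfil (tensor_S U) (m - 1)"
        using g S_hom_W[OF \<phi>'(1) f] by (simp add: S_unip_def)
      moreover have "\<phi> f \<ominus>\<^bsub>S_vs U\<^esub> symbol V m f \<in> Wfil (tensor_S U) (m - 1)"
        using \<phi>'(2) f by (simp add: gr_id_def)
      ultimately have "g (\<phi> f) \<ominus>\<^bsub>S_vs U\<^esub> symbol V m f \<in> Wfil (tensor_S U) (m - 1)"
        by (rule U.S.subsp_telescope[OF U.W_tensor_sub S_hom_closed[OF g' c] c sC])
      then show "compose ?C g \<phi> f \<ominus>\<^bsub>S_vs U\<^esub> symbol V m f \<in> Wfil (tensor_S U) (m - 1)"
        using fC by (simp add: compose_def)
    qed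
  qed
qed

lemma splitting_ext: "\<phi> \<in> S_splittings V \<Longrightarrow> \<phi> \<in> extensional (carrier (S_vs V))"
  unfolding splittings_iff S_hom_def by blast

lemma splitting_funcset: "\<phi> \<in> S_splittings V \<Longrightarrow> \<phi> \<in> carrier (S_vs V) \<rightarrow> carrier (S_vs U)"
  using S_hom_closed[of \<phi> V U] unfolding splittings_iff by blast

lemma split_action_apply:
  "\<phi> \<in> S_splittings V \<Longrightarrow> split_action V g \<phi> = compose (carrier (S_vs V)) g \<phi>"
  by (simp add: split_action_def)

lemma split_action_mult:
  assumes "g \<in> S_unip U" "h \<in> S_unip U" "\<phi> \<in> S_splittings V"
  shows "split_action V (compose (carrier (S_vs U)) g h) \<phi> = split_action V g (split_action V h \<phi>)"
proof -
  have "split_action V h \<phi> \<in> S_splittings V" using splitting_translate[OF assms(2,3)] split_action_apply[OF assms(3)] by simp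
  then show ?thesis
    using compose_assoc[OF splitting_funcset[OF assms(3)], of g h]
    by (simp only: split_action_apply assms(3))
qed

lemma split_action_one:
  assumes "\<phi> \<in> S_splittings V"
  shows "split_action V (\<lambda>f\<in>carrier (S_vs U). f) \<phi> = \<phi>"
  unfolding split_action_apply[OF assms] by (rule Id_compose[OF splitting_funcset[OF assms] splitting_ext[OF assms]])

lemma split_action_closed:
  "g \<in> S_unip U \<Longrightarrow> \<phi> \<in> S_splittings V \<Longrightarrow> split_action V g \<phi> \<in> S_splittings V"
  using splitting_translate split_action_apply by simp

lemma split_group_action: "group_action (split_group V) (S_splittings V) (split_action V)"
proof -
  interpret G: group "split_group V" by (rule split_group)
  let ?E = "S_splittings V"
  have ext: "split_action V g \<in> extensional ?E" for g by (simp add: split_action_def)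
  have Bij: "split_action V g \<in> Bij ?E" if g: "g \<in> S_unip U" for g
  proof -
    obtain k where k: "k \<in> S_unip U" and kg: "compose (carrier (S_vs U)) k g = (\<lambda>f\<in>carrier (S_vs U). f)"
      and gk: "compose (carrier (S_vs U)) g k = (\<lambda>f\<in>carrier (S_vs U). f)"
      using G.l_inv[of g] G.r_inv[of g] G.inv_closed[of g] g unfolding split_group_carrier split_group_simps by blast
    have "bij_betw (split_action V g) ?E ?E"
    proof (rule bij_betw_byWitness[of _ "split_action V k"])
      show "\<forall>\<phi>\<in>?E. split_action V k (split_action V g \<phi>) = \<phi>"
        using split_action_mult[OF k g] split_action_one by (simp add: kg)
      show "\<forall>\<phi>\<in>?E. split_action V g (split_action V k \<phi>) = \<phi>"
        using split_action_mult[OF g k] split_action_one by (simp add: gk)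
    qed (use split_action_closed g k in blast)+
    then show ?thesis using ext by (simp add: Bij_def)
  qed
  have "split_action V \<in> hom (split_group V) (BijGroup ?E)"
  proof (rule homI)
    show "split_action V g \<in> carrier (BijGroup ?E)" if "g \<in> carrier (split_group V)" for g
      using Bij that by (simp add: BijGroup_def split_group_carrier)
    fix g h assume "g \<in> carrier (split_group V)" "h \<in> carrier (split_group V)"
    then have gh: "g \<in> S_unip U" "h \<in> S_unip U" by (simp_all add: split_group_carrier)
    have "split_action V (compose (carrier (S_vs U)) g h) = compose ?E (split_action V g) (split_action V h)"
      by (rule extensionalityI[OF ext compose_extensional]) (simp add: split_action_mult[OF gh] compose_eq)
    then show "split_action V (g \<otimes>\<^bsub>split_group V\<^esub> h) = split_action V g \<otimes>\<^bsub>BijGroup ?E\<^esub> split_action V h"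
      using Bij[OF gh(1)] Bij[OF gh(2)] by (simp add: BijGroup_def split_group_simps)
  qed
  then show ?thesis
    using group_BijGroup[of ?E] split_group
    by (simp add: group_action_def group_hom_def group_hom_axioms_def)
qed

text \<open>
  The element that carries \<open>x\<close> to \<open>y\<close> is \<open>yx\<^sup>-\<^sup>1\<close>; it induces the identity on \<open>gr\<^sup>W\<close> because \<open>x\<close> and \<open>y\<close> do.
\<close>

lemma split_action_transitive:
  assumes x: "x \<in> S_splittings V" and y: "y \<in> S_splittings V"
  shows "\<exists>!g. g \<in> S_unip U \<and> split_action V g x = y"
proof -
  let ?C = "carrier (S_vs V)" and ?D = "carrier (S_vs U)"
  obtain \<psi> where x': "x \<in> S_hom V U" "gr_id x" and \<psi>: "\<psi> \<in> S_hom U V"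
    and inv: "\<And>f. f \<in> ?C \<Longrightarrow> \<psi> (x f) = f" "\<And>g. g \<in> ?D \<Longrightarrow> x (\<psi> g) = g"
    using x unfolding splittings_iff by blast
  have y': "y \<in> S_hom V U" "gr_id y" using y unfolding splittings_iff by blast+
  let ?g = "compose ?D y \<psi>"
  have "?g \<in> S_unip U" unfolding S_unip_def
  proof (intro CollectI conjI allI ballI)
    show "?g \<in> S_hom U U" by (rule S_hom_compose[OF U.fvs_axioms vs y'(1) \<psi>])
    fix m u assume u: "u \<in> Wfil (tensor_S U) m"
    note uC = W_tensor_carrier(2)[OF u]
    let ?f = "\<psi> u"
    have f: "?f \<in> Wfil (tensor_S V) m" by (rule S_hom_W[OF \<psi> u])
    note fC = W_tensor_carrier(1)[OF f] and sC = W_tensor_carrier(2)[OF symbol_W[OF f]]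
    have 1: "y ?f \<ominus>\<^bsub>S_vs U\<^esub> symbol V m ?f \<in> Wfil (tensor_S U) (m - 1)"
      "u \<ominus>\<^bsub>S_vs U\<^esub> symbol V m ?f \<in> Wfil (tensor_S U) (m - 1)"
      using x'(2) y'(2) f inv(2)[OF uC] unfolding gr_id_def by (blast, metis)
    have "y ?f \<ominus>\<^bsub>S_vs U\<^esub> u \<in> Wfil (tensor_S U) (m - 1)"
      by (rule U.S.subsp_telescope[OF U.W_tensor_sub S_hom_closed[OF y'(1) fC] sC uC 1(1)
          U.S.subsp_minus_swap[OF U.W_tensor_sub uC sC 1(2)]])
    then show "?g u \<ominus>\<^bsub>S_vs U\<^esub> u \<in> Wfil (tensor_S U) (m - 1)" using uC by (simp add: compose_def)
  qed
  moreover have "split_action V ?g x = y"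
    unfolding split_action_apply[OF x]
  proof (rule extensionalityI[OF compose_extensional splitting_ext[OF y]])
    fix f assume f: "f \<in> ?C"
    show "compose ?C ?g x f = y f" using S_hom_closed[OF x'(1) f] inv(1)[OF f] f by (simp add: compose_def)
  qed
  moreover have "g = ?g" if g: "g \<in> S_unip U" and gx: "split_action V g x = y" for g
  proof (rule extensionalityI[OF unip_ext[OF g] compose_extensional])
    fix u assume u: "u \<in> ?D"
    have "y (\<psi> u) = g (x (\<psi> u))"
      using S_hom_closed[OF \<psi> u] unfolding gx[symmetric] split_action_apply[OF x] by (simp add: compose_def)
    then show "g u = ?g u" using inv(2)[OF u] u by (simp add: compose_def)
  qed
  ultimately show ?thesis by blast
qed

end

theorem proposition2p21:
  fixes V :: "'a qmhs"
  assumes "mhs V"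
  shows "S_splittings V \<noteq> {} \<and> torsor (split_group V) (S_splittings V) (split_action V)"
proof -
  obtain N b c d n lo hi lo' hi' where "biframed V N b c d n lo hi lo' hi'"
    using mhs_biframed[OF assms] .
  then interpret biframed V N b c d n lo hi lo' hi' .
  have "torsor_axioms (split_group V) (S_splittings V) (split_action V)"
    using splittings_nonempty split_action_transitive
    by (simp add: torsor_axioms_def split_group_carrier)
  then show ?thesis using splittings_nonempty split_group_action by (simp add: torsor_def)
qed

end
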